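(* For the $K$-user ergodic fading Gaussian interference channel described in the context, if the network is in a minimal bottleneck state then its ergodic sum capacity is $C_\Sigma=\frac K2\log(1+2\,\mathrm{SNR})$.
   Context: Model: fix an integer $K\ge 2$, $\mathcal K=\{1,\dots,K\}$, and a constant $\mathrm{SNR}>0$. At each channel use $n\in\mathbb N$, receiver $r\in\mathcal K$ observes $Y^{[r]}(n)=\sum_{t\in\mathcal K}H^{[rt]}(n)e^{j\phi^{[rt]}(n)}X^{[t]}(n)+Z^{[r]}(n)$, where $X^{[t]}(n)\in\mathbb C$ is the symbol of transmitter $t$ with power constraint $E|X^{[t]}|^2\le 1$, the noises $Z^{[r]}(n)$ are zero-mean unit-variance circularly symmetric complex Gaussian, i.i.d. over $n$; the phases $\phi^{[rt]}(n)$ are i.i.d. uniform on $[0,2\pi)$ (over $r,t,n$) and independent of the strengths; direct strengths are $H^{[kk]}(n)=\sqrt{\mathrm{SNR}}$ for all $k,n$; cross strengths are $H^{[rt]}(n)=\sqrt{\mathrm{INR}^{[rt]}(n)}$ for $r\ne t$, where the collection $(\mathrm{INR}^{[rt]}(n))_{r\ne t}$ is i.i.d. over $n$ with an arbitrary (possibly correlated across links) distribution on $[0,\infty)^{K(K-1)}$. $H^{[rt]}$ is the link from transmitter $t$ to receiver $r$. All transmitters and receivers know all channel strengths and phases, and codewords may depend on the channel states. There are $K$ independent messages, $W_k$ sent from transmitter $k$ to receiver $k$; achievable rates and the sum capacity $C_\Sigma$ are defined in the standard Shannon sense. Logarithms are base 2. Definitions: a cross-channel $H^{[rt]}$, $r\neq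 t$, is a bottleneck link if $\mathrm{INR}^{[rt]}(n)=\mathrm{SNR}$ for all $n$. For a set $B$ of ordered pairs $(r,t)$, $r\ne t$, the network in which exactly the links in $B$ are constrained to be bottleneck links is in a bottleneck state if its sum capacity takes the same value for every choice of the distribution of the strengths of the cross-links not in $B$ (subject to the model above). A bottleneck state is minimal if there is no bottleneck state (for the same $K$) with strictly fewer bottleneck links. *)

theory Defs
  imports "HOL-Probability.Probability"
begin

text \<open>Users/receivers are indexed by 1..K. A per-channel-use state is a pair
  (INR, phase): INR is indexed by ordered off-diagonal pairs (r,t), phases by all pairs (r,t).\<close>

type_synonym state = "((nat \<times> nat) \<Rightarrow> real) \<times> ((nat \<times> nat) \<Rightarrow> real)"

definition offdiag :: "nat \<Rightarrow> (nat \<times> nat) set" where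
  "offdiag K = {(r, t). r \<in> {1..K} \<and> t \<in> {1..K} \<and> r \<noteq> t}"

definition phase_meas :: "nat \<Rightarrow> ((nat \<times> nat) \<Rightarrow> real) measure" where
  "phase_meas K = PiM ({1..K} \<times> {1..K}) (\<lambda>_. uniform_measure lborel {0..<2*pi})"

definition state_meas :: "nat \<Rightarrow> ((nat \<times> nat) \<Rightarrow> real) measure \<Rightarrow> state measure" where
  "state_meas K D = D \<Otimes>\<^sub>M phase_meas K"

definition state_seq_meas :: "nat \<Rightarrow> ((nat \<times> nat) \<Rightarrow> real) measure \<Rightarrow> nat \<Rightarrow> (nat \<Rightarrow> state) measure" where
  "state_seq_meas K D N = PiM {..<N} (\<lambda>_. state_meas K D)"

definition cgauss :: "complex measure" where
  "cgauss = density lborel (\<lambda>z. ennreal (exp (- (cmod z * cmod z)) / pi))"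

definition noise_seq_meas :: "nat \<Rightarrow> nat \<Rightarrow> (nat \<times> nat \<Rightarrow> complex) measure" where
  "noise_seq_meas K N = PiM ({..<N} \<times> {1..K}) (\<lambda>_. cgauss)"

definition exper :: "nat \<Rightarrow> ((nat \<times> nat) \<Rightarrow> real) measure \<Rightarrow> nat
    \<Rightarrow> ((nat \<Rightarrow> state) \<times> (nat \<times> nat \<Rightarrow> complex)) measure" where
  "exper K D N = state_seq_meas K D N \<Otimes>\<^sub>M noise_seq_meas K N"

definition gain :: "real \<Rightarrow> state \<Rightarrow> nat \<Rightarrow> nat \<Rightarrow> complex" where
  "gain SNR s r t =
     complex_of_real (sqrt (if r = t then SNR else fst s (r, t))) * cis (snd s (r, t))"

text \<open>Encoders: f t m sq n is the symbol of transmitter t at time n for message m,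
  given the whole state sequence sq. Received symbol Y^[r](n):\<close>
definition chan_output :: "nat \<Rightarrow> real \<Rightarrow> (nat \<Rightarrow> nat \<Rightarrow> (nat \<Rightarrow> state) \<Rightarrow> nat \<Rightarrow> complex)
    \<Rightarrow> (nat \<Rightarrow> nat) \<Rightarrow> (nat \<Rightarrow> state) \<Rightarrow> (nat \<times> nat \<Rightarrow> complex) \<Rightarrow> nat \<Rightarrow> nat \<Rightarrow> complex" where
  "chan_output K SNR f w sq z r n = (\<Sum>t\<in>{1..K}. gain SNR (sq n) r t * f t (w t) sq n) + z (n, r)"

text \<open>A block code of length N with message set sizes M k, encoders f, decoders g
  (decoder k sees its received block and the state sequence), satisfying the power
  constraint E|X^[t](n)|^2 \<le> 1 (expectation over the uniform message and the states).\<close>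
definition is_code :: "nat \<Rightarrow> real \<Rightarrow> ((nat \<times> nat) \<Rightarrow> real) measure \<Rightarrow> nat \<Rightarrow> (nat \<Rightarrow> nat)
    \<Rightarrow> (nat \<Rightarrow> nat \<Rightarrow> (nat \<Rightarrow> state) \<Rightarrow> nat \<Rightarrow> complex)
    \<Rightarrow> (nat \<Rightarrow> (nat \<Rightarrow> complex) \<times> (nat \<Rightarrow> state) \<Rightarrow> nat) \<Rightarrow> bool" where
  "is_code K SNR D N M f g \<longleftrightarrow>
     0 < N \<and> (\<forall>k\<in>{1..K}. 1 \<le> M k) \<and>
     (\<forall>t\<in>{1..K}. \<forall>m<M t. \<forall>n<N. (\<lambda>sq. f t m sq n) \<in> borel_measurable (state_seq_meas K D N)) \<and>
     (\<forall>k\<in>{1..K}. g k \<in> measurable (PiM {..<N} (\<lambda>_. borel) \<Otimes>\<^sub>M state_seq_meas K D N)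
                                  (count_space UNIV)) \<and>
     (\<forall>t\<in>{1..K}. \<forall>n<N.
        ennreal (1 / real (M t)) *
          (\<Sum>m<M t. \<integral>\<^sup>+ sq. ennreal ((cmod (f t m sq n))^2) \<partial>state_seq_meas K D N) \<le> 1)"

definition err_prob :: "nat \<Rightarrow> real \<Rightarrow> ((nat \<times> nat) \<Rightarrow> real) measure \<Rightarrow> nat \<Rightarrow> (nat \<Rightarrow> nat)
    \<Rightarrow> (nat \<Rightarrow> nat \<Rightarrow> (nat \<Rightarrow> state) \<Rightarrow> nat \<Rightarrow> complex)
    \<Rightarrow> (nat \<Rightarrow> (nat \<Rightarrow> complex) \<times> (nat \<Rightarrow> state) \<Rightarrow> nat) \<Rightarrow> real" where
  "err_prob K SNR D N M f g =
     (1 / (\<Prod>k\<in>{1..K}. real (M k))) *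
     (\<Sum>w\<in>PiE {1..K} (\<lambda>k. {..<M k}).
        measure (exper K D N)
          {(sq, z) \<in> space (exper K D N).
             \<exists>k\<in>{1..K}. g k (restrict (\<lambda>n. chan_output K SNR f w sq z k n) {..<N}, sq) \<noteq> w k})"

definition achievable :: "nat \<Rightarrow> real \<Rightarrow> ((nat \<times> nat) \<Rightarrow> real) measure \<Rightarrow> (nat \<Rightarrow> real) \<Rightarrow> bool" where
  "achievable K SNR D R \<longleftrightarrow>
     (\<forall>k\<in>{1..K}. 0 \<le> R k) \<and>
     (\<forall>\<epsilon>>0. \<exists>N0. \<forall>N\<ge>N0. \<exists>M f g. is_code K SNR D N M f g \<and>
         (\<forall>k\<in>{1..K}. 2 powr (real N * R k) \<le> real (M k)) \<and>
         err_prob K SNR D N M f g \<le> \<epsilon>)"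

definition sum_capacity :: "nat \<Rightarrow> real \<Rightarrow> ((nat \<times> nat) \<Rightarrow> real) measure \<Rightarrow> ereal" where
  "sum_capacity K SNR D = Sup {ereal (\<Sum>k\<in>{1..K}. R k) | R. achievable K SNR D R}"

definition admissible_dist :: "nat \<Rightarrow> real \<Rightarrow> (nat \<times> nat) set \<Rightarrow> ((nat \<times> nat) \<Rightarrow> real) measure \<Rightarrow> bool" where
  "admissible_dist K SNR B D \<longleftrightarrow>
     prob_space D \<and> sets D = sets (PiM (offdiag K) (\<lambda>_. borel)) \<and>
     (AE x in D. \<forall>p\<in>offdiag K. 0 \<le> x p) \<and>
     (AE x in D. \<forall>p\<in>B. x p = SNR)"

definition bottleneck_state :: "nat \<Rightarrow> real \<Rightarrow> (nat \<times> nat) set \<Rightarrow> bool" where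
  "bottleneck_state K SNR B \<longleftrightarrow>
     B \<subseteq> offdiag K \<and>
     (\<forall>D1 D2. admissible_dist K SNR B D1 \<and> admissible_dist K SNR B D2 \<longrightarrow>
        sum_capacity K SNR D1 = sum_capacity K SNR D2)"

definition minimal_bottleneck_state :: "nat \<Rightarrow> real \<Rightarrow> (nat \<times> nat) set \<Rightarrow> bool" where
  "minimal_bottleneck_state K SNR B \<longleftrightarrow>
     bottleneck_state K SNR B \<and>
     \<not> (\<exists>B'. bottleneck_state K SNR B' \<and> card B' < card B)"

end

theory Submission
  imports Defs "HOL-Real_Asymp.Real_Asymp"
begin

text \<open>The distribution in which every cross link has strength \<open>SNR\<close> is admissible for every set of
  bottleneck links, so the capacity of a network in a bottleneck state is the capacity for this
  distribution.

  Upper bound: for each pair of users, one receiver can decode its own message, remove its own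
  signal and emulate the other receiver, so the two rates add up to at most \<open>log 2 (1 + 2 * SNR)\<close>;
  sum over a cycle of users.

  Lower bound (ergodic interference alignment): a symbol is sent twice, in two states with nearly
  equal direct and nearly opposite cross channels. Adding the two received values cancels the
  interference and leaves a Gaussian channel of signal-to-noise ratio \<open>2 * SNR\<close>, used for half of
  the time. Random Gaussian codebooks and a threshold test on the information density achieve
  its capacity.\<close>

section \<open>The circularly symmetric complex Gaussian\<close>

text \<open>No mutual information and no Fano inequality occur. In the converse the decoding regions
  are disjoint, so their masses under one reference Gaussian law sum to at most one; a change of
  measure turns this into a bound on the rates. The law has variance \<open>1 + 2 * SNR\<close>,
  noise plus the power of two users. It is centred at the mean received signal because codebooks
  need not have mean zero; only after centring do the mixed terms of the two codebooks cancel.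

  The obstacle in the direct part is that exactly opposite states have probability zero. Phases are
  therefore quantised: all cells are equally likely, so a cell and its opposite occur about equally
  often, but a small residual interference remains. It depends on the codewords of the other users
  and is carried along as a perturbation of the received signal. What is matched is the phase of a
  cross link relative to the direct phase of its transmitter, since encoders undo their own direct
  phase to make the wanted copies add coherently. Concentration always comes from Chebyshev's
  inequality; only the exponentially many wrong codewords need an exponential bound.\<close>

lemma lborel_complex:
  "(lborel :: complex measure) = distr (lborel \<Otimes>\<^sub>M lborel) borel (\<lambda>(x, y). Complex x y)"
proof (rule lborel_eqI)
  have [measurable]: "(\<lambda>(x, y). Complex x y) \<in> borel_measurable (borel \<Otimes>\<^sub>M borel)"
    by (simp add: borel_measurable_complex_iff split_beta')
  fix l u :: complex assume le: "\<And>b. b \<in> Basis \<Longrightarrow> l \<bullet> b \<le> u \<bullet> b"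
  have le': "Re l \<le> Re u" "Im l \<le> Im u" using le[of 1] le[of \<i>] by (auto simp: Basis_complex_def)
  have "(\<lambda>(x, y). Complex x y) -` box l u = {Re l<..<Re u} \<times> {Im l<..<Im u}"
    by (auto simp: box_def Basis_complex_def)
  then show "emeasure (distr (lborel \<Otimes>\<^sub>M lborel) borel (\<lambda>(x, y). Complex x y)) (box l u)
      = ennreal (\<Prod>b\<in>Basis. (u - l) \<bullet> b)"
    using le' by (simp add: emeasure_distr space_pair_measure lborel.emeasure_pair_measure_Times
        Basis_complex_def ennreal_mult[symmetric])
qed simp

lemma measurable_Complex_pair [measurable]:
  "(\<lambda>(x, y). Complex x y) \<in> borel_measurable (borel \<Otimes>\<^sub>M borel)"
  by (simp add: borel_measurable_complex_iff split_beta')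

lemma nn_integral_lborel_complex:
  assumes [measurable]: "f \<in> borel_measurable borel"
  shows "(\<integral>\<^sup>+z. f z \<partial>lborel) = (\<integral>\<^sup>+x. \<integral>\<^sup>+y. f (Complex x y) \<partial>lborel \<partial>lborel)"
proof -
  have "(\<lambda>p. f (Complex (fst p) (snd p))) \<in> borel_measurable (lborel \<Otimes>\<^sub>M lborel)"
    using measurable_compose[OF measurable_Complex_pair, of f borel] assms
    by (simp add: split_beta' cong: measurable_cong_sets)
  then show ?thesis
    by (subst lborel_complex) (simp add: nn_integral_distr lborel.nn_integral_fst[symmetric] split_beta')
qed

text \<open>The density of CN(\<mu>, v). Here \<open>v\<close> is the total variance, so the real
  and the imaginary part have variance \<open>v / 2\<close> each.\<close>

definition cnormal_density :: "complex \<Rightarrow> real \<Rightarrow> complex \<Rightarrow> real" where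
  "cnormal_density \<mu> v z = exp (- (cmod (z - \<mu>))\<^sup>2 / v) / (pi * v)"

lemma cnormal_density_measurable [measurable]: "cnormal_density \<mu> v \<in> borel_measurable borel"
  unfolding cnormal_density_def by measurable

lemma cnormal_density_nonneg: "0 < v \<Longrightarrow> 0 \<le> cnormal_density \<mu> v z"
  by (simp add: cnormal_density_def)

lemma cnormal_density_Complex:
  assumes "0 < v"
  shows "cnormal_density \<mu> v (Complex x y)
    = normal_density (Re \<mu>) (sqrt (v / 2)) x * normal_density (Im \<mu>) (sqrt (v / 2)) y"
  using assms unfolding cnormal_density_def normal_density_def
  by (simp add: cmod_power2 exp_add[symmetric] add_divide_distrib diff_divide_distrib)

lemma nn_integral_normal_density: "0 < \<sigma> \<Longrightarrow> (\<integral>\<^sup>+x. ennreal (normal_density \<mu> \<sigma> x) \<partial>lborel) = 1"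
  using prob_space.emeasure_space_1[OF prob_space_normal_density[of \<sigma> \<mu>]]
  by (simp add: emeasure_density)

lemma nn_integral_cnormal_density:
  assumes "0 < v"
  shows "(\<integral>\<^sup>+z. ennreal (cnormal_density \<mu> v z) \<partial>lborel) = 1"
  using assms
  by (simp add: nn_integral_lborel_complex cnormal_density_Complex ennreal_mult
      nn_integral_cmult nn_integral_normal_density)

lemma cgauss_eq: "cgauss = density lborel (\<lambda>z. ennreal (cnormal_density 0 1 z))"
  by (simp add: cgauss_def cnormal_density_def power2_eq_square)

lemma sets_cgauss [simp, measurable_cong]: "sets cgauss = sets borel"
  and space_cgauss [simp]: "space cgauss = UNIV"
  by (simp_all add: cgauss_def)

lemma prob_space_cgauss: "prob_space cgauss"
  by (rule prob_spaceI) (simp add: cgauss_eq emeasure_density nn_integral_cnormal_density)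

interpretation cgauss: prob_space cgauss by (rule prob_space_cgauss)

text \<open>Independence of the real and imaginary parts, each N(0, 1/2), is what transports the
  known moments of the real normal distribution to \<open>cgauss\<close>.\<close>

lemma cgauss_distr:
  defines "N \<equiv> density lborel (\<lambda>x. ennreal (normal_density 0 (sqrt (1/2)) x))"
  shows "cgauss = distr (N \<Otimes>\<^sub>M N) borel (\<lambda>(x, y). Complex x y)"
proof (rule measure_eqI)
  interpret N: prob_space N unfolding N_def by (rule prob_space_normal_density) simp
  have NN: "N \<Otimes>\<^sub>M N = density (lborel \<Otimes>\<^sub>M lborel)
      (\<lambda>(x, y). ennreal (normal_density 0 (sqrt (1/2)) x) * ennreal (normal_density 0 (sqrt (1/2)) y))"
    unfolding N_def by (rule pair_measure_density)
      (auto intro!: lborel.sigma_finite_measure_axioms N.sigma_finite_measure_axioms[unfolded N_def])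
  fix A assume "A \<in> sets cgauss"
  then have [measurable]: "A \<in> sets borel" by simp
  have [measurable]: "(\<lambda>(x, y). Complex x y) \<in> measurable (lborel \<Otimes>\<^sub>M lborel) borel"
    by (simp cong: measurable_cong_sets)
  have "emeasure cgauss A = (\<integral>\<^sup>+z. ennreal (cnormal_density 0 1 z) * indicator A z \<partial>lborel)"
    by (simp add: cgauss_eq emeasure_density)
  also have "\<dots> = (\<integral>\<^sup>+p. ennreal (cnormal_density 0 1 (case p of (x, y) \<Rightarrow> Complex x y))
      * indicator A (case p of (x, y) \<Rightarrow> Complex x y) \<partial>(lborel \<Otimes>\<^sub>M lborel))"
    by (subst lborel_complex) (simp add: nn_integral_distr)
  also have "\<dots> = (\<integral>\<^sup>+p. indicator A (case p of (x, y) \<Rightarrow> Complex x y) \<partial>(N \<Otimes>\<^sub>M N))"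
    unfolding NN by (subst nn_integral_density)
      (auto simp: split_beta' cnormal_density_Complex ennreal_mult intro!: nn_integral_cong)
  also have "\<dots> = (\<integral>\<^sup>+z. indicator A z \<partial>distr (N \<Otimes>\<^sub>M N) borel (\<lambda>(x, y). Complex x y))"
    unfolding NN by (simp add: nn_integral_distr del: nn_integral_indicator)
  also have "\<dots> = emeasure (distr (N \<Otimes>\<^sub>M N) borel (\<lambda>(x, y). Complex x y)) A"
    by simp
  finally show "emeasure cgauss A = emeasure (distr (N \<Otimes>\<^sub>M N) borel (\<lambda>(x, y). Complex x y)) A" .
qed simp

lemma
  fixes f :: "real \<Rightarrow> real"
  assumes [measurable]: "f \<in> borel_measurable borel"
    and f: "has_bochner_integral lborel (\<lambda>x. normal_density 0 (sqrt (1/2)) x * f x) c"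
  shows has_bochner_integral_cgauss_Re: "has_bochner_integral cgauss (\<lambda>z. f (Re z)) c"
    and has_bochner_integral_cgauss_Im: "has_bochner_integral cgauss (\<lambda>z. f (Im z)) c"
proof -
  let ?N = "density lborel (\<lambda>x. ennreal (normal_density 0 (sqrt (1/2)) x))"
  interpret N: prob_space ?N by (rule prob_space_normal_density) simp
  interpret NN: pair_prob_space ?N ?N ..
  have N: "has_bochner_integral ?N f c"
    using f by (intro has_bochner_integral_density) auto
  have "has_bochner_integral (distr (?N \<Otimes>\<^sub>M ?N) ?N fst) f c"
    using N by (simp add: N.distr_pair_fst)
  then have 1: "has_bochner_integral (?N \<Otimes>\<^sub>M ?N) (\<lambda>p. f (fst p)) c"
    by (auto simp: has_bochner_integral_iff integrable_distr_eq integral_distr)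
  then have 2: "has_bochner_integral (?N \<Otimes>\<^sub>M ?N) (\<lambda>p. f (snd p)) c"
    using NN.integrable_product_swap[of "\<lambda>p. f (fst p)"] NN.integral_product_swap[of "\<lambda>p. f (fst p)"]
    by (auto simp: has_bochner_integral_iff split_beta')
  have [measurable]: "(\<lambda>(x, y). Complex x y) \<in> measurable (?N \<Otimes>\<^sub>M ?N) borel"
    by (simp cong: measurable_cong_sets)
  show "has_bochner_integral cgauss (\<lambda>z. f (Re z)) c" "has_bochner_integral cgauss (\<lambda>z. f (Im z)) c"
    using 1 2 unfolding cgauss_distr
    by (auto simp: has_bochner_integral_iff integrable_distr_eq integral_distr split_beta')
qed

lemma has_bochner_integral_cgauss_cmod2:
  "has_bochner_integral cgauss (\<lambda>z. (cmod z)\<^sup>2) 1"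
proof -
  have "has_bochner_integral lborel (\<lambda>x. normal_density 0 (sqrt (1/2)) x * x\<^sup>2) (1/2)"
    using normal_moment_even[of "sqrt (1/2)" 0 1] by simp
  from has_bochner_integral_add[OF has_bochner_integral_cgauss_Re[OF _ this]
      has_bochner_integral_cgauss_Im[OF _ this]]
  show ?thesis by (simp add: cmod_power2)
qed

lemma has_bochner_integral_cgauss_Re_Im:
  "has_bochner_integral cgauss Re 0" "has_bochner_integral cgauss Im 0"
proof -
  have "has_bochner_integral lborel (\<lambda>x. normal_density 0 (sqrt (1/2)) x * x) 0"
    by (rule normal_moment_nz_1) simp
  from has_bochner_integral_cgauss_Re[OF _ this] has_bochner_integral_cgauss_Im[OF _ this]
  show "has_bochner_integral cgauss Re 0" "has_bochner_integral cgauss Im 0" by auto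
qed

text \<open>The Chebyshev bounds for energies need a finite variance of the squared modulus. Fourth
  powers of the two coordinates dominate, since (a + b)^2 is at most 2a^2 + 2b^2.\<close>

lemma integrable_cgauss_cmod4: "integrable cgauss (\<lambda>z. ((cmod z)\<^sup>2)\<^sup>2)"
proof -
  have *: "has_bochner_integral lborel (\<lambda>x. normal_density 0 (sqrt (1/2)) x * x ^ 4) (3/4)"
    using normal_moment_even[of "sqrt (1/2)" 0 2] by (simp add: fact_numeral power2_eq_square)
  show ?thesis
  proof (rule Bochner_Integration.integrable_bound)
    show "integrable cgauss (\<lambda>z. 2 * Re z ^ 4 + 2 * Im z ^ 4)"
      using has_bochner_integral_cgauss_Re[OF _ *] has_bochner_integral_cgauss_Im[OF _ *]
      by (auto simp: has_bochner_integral_iff)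
    have "((cmod z)\<^sup>2)\<^sup>2 \<le> 2 * Re z ^ 4 + 2 * Im z ^ 4" for z
      using sum_squares_ge_zero[of "(Re z)\<^sup>2 - (Im z)\<^sup>2" 0]
      unfolding cmod_power2 by (simp add: power2_eq_square power4_eq_xxxx algebra_simps)
    then show "AE z in cgauss. norm (((cmod z)\<^sup>2)\<^sup>2) \<le> norm (2 * Re z ^ 4 + 2 * Im z ^ 4)"
      by (intro AE_I2) (auto intro: order_trans)
  qed simp
qed

lemma has_bochner_integral_cgauss_linear:
  "has_bochner_integral cgauss (\<lambda>z. Re (w * z)) 0"
proof -
  have "has_bochner_integral cgauss (\<lambda>z. Re w * Re z - Im w * Im z) (Re w * 0 - Im w * 0)"
    by (intro has_bochner_integral_diff has_bochner_integral_mult_right has_bochner_integral_cgauss_Re_Im)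
  then show ?thesis by simp
qed

lemma has_bochner_integral_cgauss_shift_cmod2:
  "has_bochner_integral cgauss (\<lambda>z. (cmod (d + z))\<^sup>2) ((cmod d)\<^sup>2 + 1)"
proof -
  have "has_bochner_integral cgauss (\<lambda>z. (cmod d)\<^sup>2 + 2 * Re (cnj d * z) + (cmod z)\<^sup>2)
      ((cmod d)\<^sup>2 + 2 * 0 + 1)"
    using cgauss.emeasure_space_1
    by (intro has_bochner_integral_add has_bochner_integral_mult_right has_bochner_integral_cgauss_linear
        has_bochner_integral_cgauss_cmod2)
       (simp add: has_bochner_integral_iff cgauss.prob_space[simplified])
  also have "(\<lambda>z. (cmod d)\<^sup>2 + 2 * Re (cnj d * z) + (cmod z)\<^sup>2) = (\<lambda>z. (cmod (d + z))\<^sup>2)"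
    unfolding cmod_power2 by (auto simp: power2_eq_square algebra_simps)
  finally show ?thesis by simp
qed

section \<open>Translating, tilting and rotating the Gaussian\<close>

lemma nn_integral_lborel_translate:
  fixes x :: "'a::euclidean_space"
  assumes [measurable]: "f \<in> borel_measurable borel"
  shows "(\<integral>\<^sup>+z. f (x + z) \<partial>lborel) = (\<integral>\<^sup>+z. f z \<partial>lborel)"
  using assms by (subst (2) lborel_distr_plus[of x, symmetric]) (simp add: nn_integral_distr)

text \<open>The weight is a likelihood ratio: the density of CN(\<mu>, v) at \<open>x + z\<close>
  over the noise density at \<open>z\<close>. Under the reweighted noise the received value has the
  reference law, whatever \<open>x\<close> was sent.\<close>

lemma distr_cgauss_tilted:
  assumes v: "0 < v"
  shows "distr (density cgauss (\<lambda>z. ennreal (exp ((cmod z)\<^sup>2 - (cmod (x + z - \<mu>))\<^sup>2 / v - ln v)))) borel (\<lambda>z. x + z)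
    = density lborel (\<lambda>z. ennreal (cnormal_density \<mu> v z))" (is "distr (density _ ?h) _ _ = ?Q")
proof (rule measure_eqI)
  fix A assume "A \<in> sets (distr (density cgauss ?h) borel (\<lambda>z. x + z))"
  then have [measurable]: "A \<in> sets borel" by simp
  have eq: "cnormal_density 0 1 z * exp ((cmod z)\<^sup>2 - (cmod (x + z - \<mu>))\<^sup>2 / v - ln v)
      = cnormal_density \<mu> v (x + z)" for z
    using v by (simp add: cnormal_density_def exp_diff exp_minus) (simp add: field_simps)
  have "emeasure (distr (density cgauss ?h) borel (\<lambda>z. x + z)) A
      = (\<integral>\<^sup>+z. indicator A z \<partial>distr (density cgauss ?h) borel (\<lambda>z. x + z))"
    by simp
  also have "\<dots> = (\<integral>\<^sup>+z. ennreal (cnormal_density 0 1 z) * (?h z * indicator A (x + z)) \<partial>lborel)"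
    unfolding cgauss_eq by (simp add: nn_integral_distr nn_integral_density del: nn_integral_indicator)
  also have "\<dots> = (\<integral>\<^sup>+z. ennreal (cnormal_density \<mu> v (x + z)) * indicator A (x + z) \<partial>lborel)"
    by (intro nn_integral_cong)
       (simp add: eq[symmetric] ennreal_mult cnormal_density_nonneg mult.assoc)
  also have "\<dots> = (\<integral>\<^sup>+z. ennreal (cnormal_density \<mu> v z) * indicator A z \<partial>lborel)"
    by (rule nn_integral_lborel_translate) measurable
  also have "\<dots> = emeasure ?Q A"
    by (simp add: emeasure_density)
  finally show "emeasure (distr (density cgauss ?h) borel (\<lambda>z. x + z)) A = emeasure ?Q A" .
qed simp

text \<open>With one coordinate fixed, a shear is a translation of the other one; Fubini's theorem
  allows either coordinate to be the inner one.\<close>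

lemma
  assumes [measurable]: "f \<in> borel_measurable borel"
  shows nn_integral_lborel_shear_Re:
      "(\<integral>\<^sup>+z. f (z + of_real (t * Im z)) \<partial>lborel) = (\<integral>\<^sup>+z. f z \<partial>lborel)" (is ?R)
    and nn_integral_lborel_shear_Im:
      "(\<integral>\<^sup>+z. f (z + \<i> * of_real (t * Re z)) \<partial>lborel) = (\<integral>\<^sup>+z. f z \<partial>lborel)" (is ?I)
proof -
  have C[measurable]: "(\<lambda>p. f (Complex (a p) (b p))) \<in> borel_measurable M"
    if [measurable]: "a \<in> borel_measurable M" "b \<in> borel_measurable M" for a b and M :: "'x measure"
    using measurable_compose[OF measurable_Pair[OF that] measurable_compose[OF measurable_Complex_pair assms]]
    by simp
  have T: "(\<integral>\<^sup>+x. g (x + c) \<partial>lborel) = (\<integral>\<^sup>+x. g x \<partial>lborel)"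
    if "g \<in> borel_measurable borel" for g and c :: real
    using nn_integral_lborel_translate[OF that, of c] by (simp add: add.commute)
  have "(\<integral>\<^sup>+z. f (z + of_real (t * Im z)) \<partial>lborel)
      = (\<integral>\<^sup>+y. \<integral>\<^sup>+x. f (Complex (x + t * y) y) \<partial>lborel \<partial>lborel)"
    by (subst nn_integral_lborel_complex, measurable, subst lborel_pair.Fubini')
       (auto intro!: nn_integral_cong arg_cong[where f=f] simp: complex_eq_iff)
  also have "\<dots> = (\<integral>\<^sup>+y. \<integral>\<^sup>+x. f (Complex x y) \<partial>lborel \<partial>lborel)"
    by (intro nn_integral_cong T) measurable
  also have "\<dots> = (\<integral>\<^sup>+z. f z \<partial>lborel)"
    by (subst nn_integral_lborel_complex, measurable, subst lborel_pair.Fubini') auto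
  finally show ?R .
  have "(\<integral>\<^sup>+z. f (z + \<i> * of_real (t * Re z)) \<partial>lborel)
      = (\<integral>\<^sup>+x. \<integral>\<^sup>+y. f (Complex x (y + t * x)) \<partial>lborel \<partial>lborel)"
    by (subst nn_integral_lborel_complex)
       (auto intro!: nn_integral_cong arg_cong[where f=f] simp: complex_eq_iff)
  also have "\<dots> = (\<integral>\<^sup>+x. \<integral>\<^sup>+y. f (Complex x y) \<partial>lborel \<partial>lborel)"
    by (intro nn_integral_cong T) measurable
  also have "\<dots> = (\<integral>\<^sup>+z. f z \<partial>lborel)"
    by (subst nn_integral_lborel_complex) simp_all
  finally show ?I .
qed

text \<open>A rotation with nonzero sine is a product of three shears.\<close>
lemma nn_integral_lborel_rotate:
  fixes c :: complex
  assumes [measurable]: "f \<in> borel_measurable borel" and c: "cmod c = 1"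
  shows "(\<integral>\<^sup>+z. f (c * z) \<partial>lborel) = (\<integral>\<^sup>+z. f z \<partial>lborel)"
proof -
  have rot: "(\<integral>\<^sup>+z. f (c * z) \<partial>lborel) = (\<integral>\<^sup>+z. f z \<partial>lborel)"
    if [measurable]: "f \<in> borel_measurable borel" and c: "cmod c = 1" "Im c \<noteq> 0" for f c
  proof -
    \<comment> \<open>For \<open>c = cis \<theta>\<close> this is - tan(\<theta>/2): two horizontal
      shears with this factor enclose a vertical shear with factor sin \<theta>.\<close>
    define t where "t = (Re c - 1) / Im c"
    define s where "s z = z + complex_of_real (t * Im z)" for z
    define r where "r z = z + \<i> * complex_of_real (Im c * Re z)" for z
    have [measurable]: "s \<in> borel_measurable borel" "r \<in> borel_measurable borel"
      unfolding s_def[abs_def] r_def[abs_def] by measurable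
    have t: "Im c * t = Re c - 1" using c by (simp add: t_def)
    have sq: "(Re c)\<^sup>2 + (Im c)\<^sup>2 = 1" using c by (metis cmod_power2 one_power2)
    have "Im c * (t * (1 + Re c)) = (Im c * t) * (1 + Re c)" by simp
    also have "\<dots> = (Re c)\<^sup>2 - 1" unfolding t by (simp add: power2_eq_square algebra_simps)
    also have "\<dots> = Im c * (- Im c)" using sq by (simp add: power2_eq_square)
    finally have "Im c * (t * (1 + Re c)) = Im c * (- Im c)" .
    then have t': "t * (1 + Re c) = - Im c" using c(2) by (metis mult_left_cancel)
    have "c * z = s (r (s z))" for z
    proof (rule complex_eqI)
      show "Im (c * z) = Im (s (r (s z)))"
        unfolding s_def r_def using arg_cong[OF t, of "\<lambda>u. u * Im z"]
        by (simp add: algebra_simps)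
      show "Re (c * z) = Re (s (r (s z)))"
        unfolding s_def r_def using arg_cong[OF t, of "\<lambda>u. u * Re z"]
          arg_cong[OF t, of "\<lambda>u. t * u * Im z"] arg_cong[OF t', of "\<lambda>u. u * Im z"]
        by (simp add: algebra_simps)
    qed
    then have "(\<integral>\<^sup>+z. f (c * z) \<partial>lborel) = (\<integral>\<^sup>+z. (f \<circ> s \<circ> r) (s z) \<partial>lborel)"
      by simp
    also have "\<dots> = (\<integral>\<^sup>+z. (f \<circ> s) (r z) \<partial>lborel)"
      using nn_integral_lborel_shear_Re[of "f \<circ> s \<circ> r" t, folded s_def] by simp
    also have "\<dots> = (\<integral>\<^sup>+z. f (s z) \<partial>lborel)"
      using nn_integral_lborel_shear_Im[of "f \<circ> s" "Im c", folded r_def] by simp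
    also have "\<dots> = (\<integral>\<^sup>+z. f z \<partial>lborel)"
      unfolding s_def by (rule nn_integral_lborel_shear_Re) simp
    finally show ?thesis .
  qed
  show ?thesis
  proof (cases "Im c = 0")
    case True
    \<comment> \<open>A half turn has sine zero and is written as two quarter turns, each covered by
      \<open>rot\<close>.\<close>
    then have "c = 1 \<or> c = \<i> * \<i>"
      using c by (auto simp: complex_eq_iff cmod_def)
    moreover have "(\<integral>\<^sup>+z. f (\<i> * \<i> * z) \<partial>lborel) = (\<integral>\<^sup>+z. f z \<partial>lborel)"
      using rot[of "\<lambda>z. f (\<i> * z)" \<i>] rot[of f \<i>] by (simp add: mult.assoc)
    ultimately show ?thesis by auto
  qed (use rot c in simp)
qed

text \<open>The density depends on the modulus only and Lebesgue measure is invariant under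
  rotations. A receiver may therefore rotate its observation without changing the noise law.\<close>

lemma distr_cgauss_rotate:
  assumes c: "cmod c = 1"
  shows "distr cgauss borel (\<lambda>z. c * z) = cgauss"
proof (rule measure_eqI)
  fix A assume "A \<in> sets (distr cgauss borel (\<lambda>z. c * z))"
  then have [measurable]: "A \<in> sets borel" by simp
  have "emeasure (distr cgauss borel (\<lambda>z. c * z)) A = (\<integral>\<^sup>+z. indicator A z \<partial>distr cgauss borel (\<lambda>z. c * z))"
    by simp
  also have "\<dots> = (\<integral>\<^sup>+z. ennreal (cnormal_density 0 1 (c * z)) * indicator A (c * z) \<partial>lborel)"
    unfolding cgauss_eq
    by (simp add: nn_integral_distr nn_integral_density cnormal_density_def norm_mult c del: nn_integral_indicator)
  also have "\<dots> = (\<integral>\<^sup>+z. ennreal (cnormal_density 0 1 z) * indicator A z \<partial>lborel)"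
    by (rule nn_integral_lborel_rotate[OF _ c]) measurable
  also have "\<dots> = emeasure cgauss A"
    by (simp add: cgauss_eq emeasure_density)
  finally show "emeasure (distr cgauss borel (\<lambda>z. c * z)) A = emeasure cgauss A" .
qed simp

section \<open>Product measures\<close>

text \<open>Boxes determine the product measure, and over a box the integral of a product density
  factors into the one-coordinate identities \<open>eq\<close>. This lifts the tilting of one noise
  value, and with density one also the rotation, to whole blocks.\<close>

lemma distr_PiM_tilted:
  assumes I: "finite I" and M: "\<And>i. prob_space (M i)" and N: "\<And>i. prob_space (N i)"
    and h [measurable]: "\<And>i. h i \<in> borel_measurable (M i)"
    and T [measurable]: "\<And>i. T i \<in> measurable (M i) (N i)"
    and eq: "\<And>i. distr (density (M i) (h i)) (N i) (T i) = N i"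
  shows "distr (density (PiM I M) (\<lambda>x. \<Prod>i\<in>I. h i (x i))) (PiM I N) (\<lambda>x. \<lambda>i\<in>I. T i (x i)) = PiM I N"
proof -
  interpret M: product_sigma_finite M
    unfolding product_sigma_finite_def using M prob_space_imp_sigma_finite by blast
  interpret N: product_sigma_finite N
    unfolding product_sigma_finite_def using N prob_space_imp_sigma_finite by blast
  have T' [measurable]: "(\<lambda>x. \<lambda>i\<in>I. T i (x i)) \<in> measurable (PiM I M) (PiM I N)"
    by measurable
  show ?thesis
  proof (rule N.PiM_eqI[OF I])
    fix A assume A: "\<And>i. i \<in> I \<Longrightarrow> A i \<in> sets (N i)"
    have A' [measurable]: "Pi\<^sub>E I A \<in> sets (PiM I N)" using A I by (intro sets_PiM_I_finite) auto
    have [measurable]: "(\<lambda>x. indicator (A i) (T i x) :: ennreal) \<in> borel_measurable (M i)" if "i \<in> I" for i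
      using A[OF that] by measurable
    have "emeasure (distr (density (PiM I M) (\<lambda>x. \<Prod>i\<in>I. h i (x i))) (PiM I N) (\<lambda>x. \<lambda>i\<in>I. T i (x i))) (Pi\<^sub>E I A)
      = (\<integral>\<^sup>+x. indicator (Pi\<^sub>E I A) x \<partial>distr (density (PiM I M) (\<lambda>x. \<Prod>i\<in>I. h i (x i))) (PiM I N) (\<lambda>x. \<lambda>i\<in>I. T i (x i)))"
      by simp
    also have "\<dots> = (\<integral>\<^sup>+x. (\<Prod>i\<in>I. h i (x i)) * indicator (Pi\<^sub>E I A) (\<lambda>i\<in>I. T i (x i)) \<partial>PiM I M)"
      by (simp add: nn_integral_distr nn_integral_density del: nn_integral_indicator)
    also have "\<dots> = (\<integral>\<^sup>+x. (\<Prod>i\<in>I. h i (x i) * indicator (A i) (T i (x i))) \<partial>PiM I M)"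
    proof (intro nn_integral_cong)
      fix x
      have "(indicator (Pi\<^sub>E I A) (\<lambda>i\<in>I. T i (x i)) :: ennreal) = (\<Prod>i\<in>I. indicator (A i) (T i (x i)))"
        using I by (auto simp: indicator_def PiE_iff prod_zero_iff)
      then show "(\<Prod>i\<in>I. h i (x i)) * indicator (Pi\<^sub>E I A) (\<lambda>i\<in>I. T i (x i))
        = (\<Prod>i\<in>I. h i (x i) * indicator (A i) (T i (x i)))"
        by (simp add: prod.distrib)
    qed
    also have "\<dots> = (\<Prod>i\<in>I. \<integral>\<^sup>+x. h i x * indicator (A i) (T i x) \<partial>M i)"
      by (rule M.product_nn_integral_prod[OF I]) measurable
    also have "\<dots> = (\<Prod>i\<in>I. emeasure (N i) (A i))"
    proof (rule prod.cong[OF refl])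
      fix i assume i: "i \<in> I"
      have [measurable]: "A i \<in> sets (N i)" using A i by simp
      have "emeasure (N i) (A i) = (\<integral>\<^sup>+x. indicator (A i) x \<partial>distr (density (M i) (h i)) (N i) (T i))"
        by (simp add: eq)
      also have "\<dots> = (\<integral>\<^sup>+x. h i x * indicator (A i) (T i x) \<partial>M i)"
        by (simp add: nn_integral_distr nn_integral_density del: nn_integral_indicator)
      finally show "(\<integral>\<^sup>+x. h i x * indicator (A i) (T i x) \<partial>M i) = emeasure (N i) (A i)" by simp
    qed
    finally show "emeasure (distr (density (PiM I M) (\<lambda>x. \<Prod>i\<in>I. h i (x i))) (PiM I N)
        (\<lambda>x. \<lambda>i\<in>I. T i (x i))) (Pi\<^sub>E I A) = (\<Prod>i\<in>I. emeasure (N i) (A i))" .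
  qed simp
qed

lemma distr_PiM_componentwise:
  assumes I: "finite I" and M: "prob_space M"
    and T [measurable]: "\<And>i. T i \<in> measurable M M"
    and eq: "\<And>i. distr M M (T i) = M"
  shows "distr (PiM I (\<lambda>_. M)) (PiM I (\<lambda>_. M)) (\<lambda>x. \<lambda>i\<in>I. T i (x i)) = PiM I (\<lambda>_. M)"
  using distr_PiM_tilted[of I "\<lambda>_. M" "\<lambda>_. M" "\<lambda>_ _. 1" T] assms by (simp add: density_1)

lemma has_bochner_integral_PiM_component:
  fixes f :: "'a \<Rightarrow> 'b::{banach,second_countable_topology}"
  assumes M: "\<And>i. i \<in> I \<Longrightarrow> prob_space (M i)" and i: "i \<in> I"
    and f: "has_bochner_integral (M i) f c"
  shows "has_bochner_integral (PiM I M) (\<lambda>x. f (x i)) c"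
proof -
  have [measurable]: "f \<in> borel_measurable (M i)" using f by (auto simp: has_bochner_integral_iff)
  have "has_bochner_integral (distr (PiM I M) (M i) (\<lambda>x. x i)) f c"
    using f by (subst distr_PiM_component[OF M i])
  then show ?thesis
    using i by (auto simp: has_bochner_integral_iff integrable_distr_eq integral_distr)
qed

section \<open>Chebyshev bounds for sums over independent coordinates\<close>

lemma (in prob_space) indep_vars_Chebyshev:
  fixes X :: "'i \<Rightarrow> 'a \<Rightarrow> real"
  assumes I: "finite I" and ind: "indep_vars (\<lambda>_. borel) X I"
    and mean: "\<And>i. i \<in> I \<Longrightarrow> expectation (X i) = 0"
    and sq: "\<And>i. i \<in> I \<Longrightarrow> integrable M (\<lambda>x. (X i x)\<^sup>2)"
    and var: "\<And>i. i \<in> I \<Longrightarrow> expectation (\<lambda>x. (X i x)\<^sup>2) \<le> s i"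
    and a: "0 < a"
  shows "prob {x \<in> space M. a \<le> \<bar>\<Sum>i\<in>I. X i x\<bar>} \<le> (\<Sum>i\<in>I. s i) / a\<^sup>2"
proof -
  have rv [measurable]: "X i \<in> borel_measurable M" if "i \<in> I" for i
    using ind that by (auto simp: indep_vars_def)
  have int: "integrable M (X i)" if "i \<in> I" for i
    using square_integrable_imp_integrable[OF rv[OF that] sq[OF that]] .
  have XX: "has_bochner_integral M (\<lambda>x. X i x * X j x) (if i = j then expectation (\<lambda>x. (X i x)\<^sup>2) else 0)"
    if "i \<in> I" "j \<in> I" for i j
  proof (cases "i = j")
    case True then show ?thesis using sq[OF that(1)] by (simp add: has_bochner_integral_iff power2_eq_square)
  next
    case False
    have "indep_vars (\<lambda>_. borel) X {i, j}" using indep_vars_subset[OF ind] that by auto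
    from indep_vars_lebesgue_integral[OF _ this] indep_vars_integrable[OF _ this]
    show ?thesis using False that int mean by (auto simp: has_bochner_integral_iff)
  qed
  have S: "(\<Sum>i\<in>I. X i x)\<^sup>2 = (\<Sum>i\<in>I. \<Sum>j\<in>I. X i x * X j x)" for x
    by (simp add: power2_eq_square sum_product)
  have "has_bochner_integral M (\<lambda>x. (\<Sum>i\<in>I. X i x)\<^sup>2)
      (\<Sum>i\<in>I. \<Sum>j\<in>I. if i = j then expectation (\<lambda>x. (X i x)\<^sup>2) else 0)"
    unfolding S by (intro has_bochner_integral_sum XX)
  then have E: "has_bochner_integral M (\<lambda>x. (\<Sum>i\<in>I. X i x)\<^sup>2) (\<Sum>i\<in>I. expectation (\<lambda>x. (X i x)\<^sup>2))"
    using I by (simp add: sum.delta')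
  have "prob {x \<in> space M. a \<le> \<bar>\<Sum>i\<in>I. X i x\<bar>} \<le> expectation (\<lambda>x. (\<Sum>i\<in>I. X i x)\<^sup>2) / a\<^sup>2"
    using E a by (intro second_moment_method) (auto simp: has_bochner_integral_iff)
  also have "\<dots> \<le> (\<Sum>i\<in>I. s i) / a\<^sup>2"
    using E var by (intro divide_right_mono) (auto simp: has_bochner_integral_iff intro: sum_mono)
  finally show ?thesis .
qed

lemma indep_vars_PiM_coordinates:
  assumes "\<And>i. i \<in> I \<Longrightarrow> prob_space (M i)"
  shows "prob_space.indep_vars (PiM I M) M (\<lambda>i x. x i) I"
proof -
  interpret P: prob_space "PiM I M" by (rule prob_space_PiM[OF assms])
  show ?thesis
  proof (cases "I = {}")
    case True then show ?thesis unfolding P.indep_vars_def P.indep_sets_def by auto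
  next
    case False
    have "distr (PiM I M) (PiM I M) (\<lambda>x. \<lambda>i\<in>I. x i) = distr (PiM I M) (PiM I M) (\<lambda>x. x)"
      by (rule distr_cong) (auto simp: space_PiM PiE_def extensional_restrict)
    also have "\<dots> = PiM I M" by simp
    also have "\<dots> = PiM I (\<lambda>i. distr (PiM I M) (M i) (\<lambda>x. x i))"
      by (rule PiM_cong[OF refl], rule distr_PiM_component[OF assms, symmetric])
    finally show ?thesis
      by (subst P.indep_vars_iff_distr_eq_PiM'[OF False]) auto
  qed
qed

lemma PiM_Chebyshev:
  fixes f :: "'i \<Rightarrow> 'a \<Rightarrow> real"
  assumes M: "prob_space M" and J: "finite J" "J \<subseteq> I"
    and f [measurable]: "\<And>i. i \<in> J \<Longrightarrow> f i \<in> borel_measurable M"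
    and mean: "\<And>i. i \<in> J \<Longrightarrow> (\<integral>x. f i x \<partial>M) = 0"
    and sq: "\<And>i. i \<in> J \<Longrightarrow> integrable M (\<lambda>x. (f i x)\<^sup>2)"
    and var: "\<And>i. i \<in> J \<Longrightarrow> (\<integral>x. (f i x)\<^sup>2 \<partial>M) \<le> s i"
    and a: "0 < a"
  shows "measure (PiM I (\<lambda>_. M)) {x \<in> space (PiM I (\<lambda>_. M)). a \<le> \<bar>\<Sum>i\<in>J. f i (x i)\<bar>} \<le> (\<Sum>i\<in>J. s i) / a\<^sup>2"
proof -
  interpret P: prob_space "PiM I (\<lambda>_. M)" by (intro prob_space_PiM M)
  interpret M: prob_space M by fact
  have comp: "has_bochner_integral (PiM I (\<lambda>_. M)) (\<lambda>x. g (x i)) c"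
    if "has_bochner_integral M g c" "i \<in> J" for g :: "'a \<Rightarrow> real" and c i
    using that J M by (intro has_bochner_integral_PiM_component) auto
  have sq': "has_bochner_integral M (\<lambda>x. (f i x)\<^sup>2) (\<integral>x. (f i x)\<^sup>2 \<partial>M)" if "i \<in> J" for i
    using sq[OF that] by (rule has_bochner_integral_integrable)
  have m': "has_bochner_integral M (f i) 0" if "i \<in> J" for i
    using M.square_integrable_imp_integrable[OF f[OF that] sq[OF that]] mean[OF that]
    by (simp add: has_bochner_integral_iff)
  show ?thesis
  proof (rule P.indep_vars_Chebyshev[OF J(1) _ _ _ _ a])
    have "P.indep_vars (\<lambda>_. M) (\<lambda>i x. x i) J"
      by (rule P.indep_vars_subset[OF indep_vars_PiM_coordinates J(2)]) (rule M)
    then show "P.indep_vars (\<lambda>_. borel) (\<lambda>i x. f i (x i)) J"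
      by (rule P.indep_vars_compose2) auto
  qed (use comp[OF sq'] comp[OF m'] var in \<open>auto simp: has_bochner_integral_iff\<close>)
qed

lemma distr_PiM_two_components:
  assumes M: "prob_space M" and ij: "i \<in> I" "j \<in> I" "i \<noteq> j"
  shows "distr (PiM I (\<lambda>_. M)) (M \<Otimes>\<^sub>M M) (\<lambda>x. (x i, x j)) = M \<Otimes>\<^sub>M M"
proof -
  interpret P: prob_space "PiM I (\<lambda>_. M)" by (intro prob_space_PiM M)
  have "P.indep_var (PiM {i} (\<lambda>_. M)) (\<lambda>x. restrict (\<lambda>k. x k) {i}) (PiM {j} (\<lambda>_. M)) (\<lambda>x. restrict (\<lambda>k. x k) {j})"
    by (rule P.indep_var_restrict[OF indep_vars_PiM_coordinates]) (use M ij in auto)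
  from P.indep_var_compose[OF this, of "\<lambda>u. u i" M "\<lambda>u. u j" M]
  have "P.indep_var M (\<lambda>x. x i) M (\<lambda>x. x j)" by (simp add: comp_def)
  then show ?thesis
    using distr_PiM_component[of I "\<lambda>_. M" i] distr_PiM_component[of I "\<lambda>_. M" j] ij M
    by (simp add: P.indep_var_distribution_eq)
qed

text \<open>The blocks \<open>{a i, b i}\<close> are pairwise disjoint, hence independent, and each
  carries the law \<open>M \<Otimes>\<^sub>M M\<close>. This is the form needed for the noise of a
  symbol that is received at two times.\<close>

lemma PiM_Chebyshev_pairs:
  fixes h :: "'a \<times> 'a \<Rightarrow> real"
  assumes M: "prob_space M" and J: "finite J"
    and ab: "inj_on a J" "inj_on b J" "a ` J \<subseteq> I" "b ` J \<subseteq> I" "a ` J \<inter> b ` J = {}"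
    and h [measurable]: "h \<in> borel_measurable (M \<Otimes>\<^sub>M M)"
    and mean: "(\<integral>x. h x \<partial>(M \<Otimes>\<^sub>M M)) = 0"
    and sq: "integrable (M \<Otimes>\<^sub>M M) (\<lambda>x. (h x)\<^sup>2)"
    and c: "0 < c"
  shows "measure (PiM I (\<lambda>_. M)) {x \<in> space (PiM I (\<lambda>_. M)). c \<le> \<bar>\<Sum>i\<in>J. h (x (a i), x (b i))\<bar>}
    \<le> real (card J) * (\<integral>x. (h x)\<^sup>2 \<partial>(M \<Otimes>\<^sub>M M)) / c\<^sup>2"
proof -
  interpret P: prob_space "PiM I (\<lambda>_. M)" by (intro prob_space_PiM M)
  interpret M: prob_space M by fact
  interpret MM: pair_prob_space M M ..
  have comp: "has_bochner_integral (PiM I (\<lambda>_. M)) (\<lambda>x. g (x (a i), x (b i))) e"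
    if g: "has_bochner_integral (M \<Otimes>\<^sub>M M) g e" and i: "i \<in> J" for g :: "'a \<times> 'a \<Rightarrow> real" and e i
  proof -
    have [measurable]: "g \<in> borel_measurable (M \<Otimes>\<^sub>M M)" using g by (auto simp: has_bochner_integral_iff)
    have I: "a i \<in> I" "b i \<in> I" "a i \<noteq> b i" using ab i by auto
    have [measurable]: "(\<lambda>x. (x (a i), x (b i))) \<in> measurable (PiM I (\<lambda>_. M)) (M \<Otimes>\<^sub>M M)"
      using I by measurable
    have "has_bochner_integral (distr (PiM I (\<lambda>_. M)) (M \<Otimes>\<^sub>M M) (\<lambda>x. (x (a i), x (b i)))) g e"
      using g by (simp add: distr_PiM_two_components[OF M I])
    then show ?thesis
      by (auto simp: has_bochner_integral_iff integrable_distr_eq integral_distr)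
  qed
  have sq': "has_bochner_integral (M \<Otimes>\<^sub>M M) (\<lambda>x. (h x)\<^sup>2) (\<integral>x. (h x)\<^sup>2 \<partial>(M \<Otimes>\<^sub>M M))"
    using sq by (rule has_bochner_integral_integrable)
  have m': "has_bochner_integral (M \<Otimes>\<^sub>M M) h 0"
    using MM.square_integrable_imp_integrable[OF h sq] mean
    by (simp add: has_bochner_integral_iff)
  have "measure (PiM I (\<lambda>_. M)) {x \<in> space (PiM I (\<lambda>_. M)). c \<le> \<bar>\<Sum>i\<in>J. h (x (a i), x (b i))\<bar>}
    \<le> (\<Sum>i\<in>J. (\<integral>x. (h x)\<^sup>2 \<partial>(M \<Otimes>\<^sub>M M))) / c\<^sup>2"
  proof (rule P.indep_vars_Chebyshev[OF J _ _ _ _ c])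
    have "P.indep_vars (\<lambda>i. PiM {a i, b i} (\<lambda>_. M)) (\<lambda>i x. restrict (\<lambda>k. x k) {a i, b i}) J"
    proof (rule P.indep_vars_restrict[OF indep_vars_PiM_coordinates])
      show "disjoint_family_on (\<lambda>i. {a i, b i}) J"
        unfolding disjoint_family_on_def
      proof (intro ballI impI)
        fix i j assume ij: "i \<in> J" "j \<in> J" "i \<noteq> j"
        then have "a i \<noteq> a j" "b i \<noteq> b j" "a i \<noteq> b j" "a j \<noteq> b i"
          using ab by (auto dest: inj_onD)
        then show "{a i, b i} \<inter> {a j, b j} = {}" by auto
      qed
    qed (use ab M in auto)
    then have "P.indep_vars (\<lambda>_. borel) (\<lambda>i x. (\<lambda>u. h (u (a i), u (b i))) (restrict (\<lambda>k. x k) {a i, b i})) J"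
      by (rule P.indep_vars_compose2) measurable
    then show "P.indep_vars (\<lambda>_. borel) (\<lambda>i x. h (x (a i), x (b i))) J" by simp
  qed (use comp[OF sq'] comp[OF m'] in \<open>auto simp: has_bochner_integral_iff\<close>)
  then show ?thesis by simp
qed

text \<open>The logarithm is linearised by \<open>ln u \<le> u - 1\<close>. For cloud \<open>j\<close> it is applied to
  \<open>u = exp (- i) / 2\<close>, multiplied by \<open>card J\<close> on \<open>A j\<close>, where \<open>i\<close> is the log-likelihood ratio of
  the cloud against one Gaussian of mean \<open>\<mu>\<close> and variance \<open>v\<close>.\<close>
lemma gaussian_packing:
  fixes x :: "'j \<Rightarrow> 'n \<Rightarrow> complex"
  assumes T: "finite T" and J: "finite J" "J \<noteq> {}"
    and A: "\<And>j. j \<in> J \<Longrightarrow> A j \<in> sets (PiM T (\<lambda>_. borel))" "disjoint_family_on A J"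
    and v: "0 < v"
  shows "ln (real (card J)) * (\<Sum>j\<in>J. measure (PiM T (\<lambda>_. cgauss))
            {z \<in> space (PiM T (\<lambda>_. cgauss)). (\<lambda>n\<in>T. x j n + z n) \<in> A j})
    \<le> (\<Sum>j\<in>J. \<Sum>n\<in>T. ln v - 1 + ((cmod (x j n - \<mu> n))\<^sup>2 + 1) / v) + real (card J) * ln 2"
proof -
  define P where "P = PiM T (\<lambda>_. cgauss)"
  define Q where "Q = PiM T (\<lambda>n. density lborel (\<lambda>z. ennreal (cnormal_density (\<mu> n) v z)))"
  interpret P: prob_space P unfolding P_def by (intro prob_space_PiM prob_space_cgauss)
  have psQ: "prob_space (density lborel (\<lambda>z. ennreal (cnormal_density (\<mu> n) v z)))" for n
    by (rule prob_spaceI) (simp add: emeasure_density nn_integral_cnormal_density v)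
  interpret Q: prob_space Q unfolding Q_def by (intro prob_space_PiM psQ)
  have sets_P [measurable_cong]: "sets P = sets (PiM T (\<lambda>_. borel))"
    unfolding P_def by (intro sets_PiM_cong) auto
  have sets_Q [measurable_cong]: "sets Q = sets (PiM T (\<lambda>_. borel))"
    unfolding Q_def by (intro sets_PiM_cong) auto
  define L where "L = real (card J)"
  have L: "1 \<le> L" using J by (simp add: L_def Suc_le_eq card_gt_0_iff)
  \<comment> \<open>The logarithm of the noise density at \<open>z\<close> over the density of
    CN(\<mu> n, v) at \<open>x j n + z\<close>; the factor \<open>pi\<close> cancels.\<close>
  define d where "d j n z = ln v - (cmod z)\<^sup>2 + (cmod (x j n + z - \<mu> n))\<^sup>2 / v" for j n z
  define i where "i j z = (\<Sum>n\<in>T. d j n (z n))" for j z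
  define S where "S j = {z \<in> space P. (\<lambda>n\<in>T. x j n + z n) \<in> A j}" for j
  have [measurable]: "S j \<in> sets P" if "j \<in> J" for j
  proof -
    have [measurable]: "A j \<in> sets (PiM T (\<lambda>_. borel))" using A that by simp
    have "(\<lambda>z. \<lambda>n\<in>T. x j n + z n) \<in> measurable P (PiM T (\<lambda>_. borel))" by measurable
    from measurable_sets[OF this, of "A j"] show ?thesis
      using A that by (simp add: S_def vimage_def Int_def conj_commute)
  qed
  have d [measurable]: "d j n \<in> borel_measurable borel" for j n unfolding d_def[abs_def] by measurable
  have [measurable]: "i j \<in> borel_measurable P" for j unfolding i_def[abs_def] by measurable
  have i: "has_bochner_integral P (i j) (\<Sum>n\<in>T. ln v - 1 + ((cmod (x j n - \<mu> n))\<^sup>2 + 1) / v)" for j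
    unfolding i_def[abs_def] P_def
  proof (intro has_bochner_integral_sum has_bochner_integral_PiM_component prob_space_cgauss)
    fix n
    have "has_bochner_integral cgauss (\<lambda>z. ln v - (cmod z)\<^sup>2 + (cmod ((x j n - \<mu> n) + z))\<^sup>2 / v)
      (ln v - 1 + ((cmod (x j n - \<mu> n))\<^sup>2 + 1) / v)"
      using cgauss.prob_space
      by (intro has_bochner_integral_add has_bochner_integral_diff has_bochner_integral_divide_zero
          has_bochner_integral_cgauss_cmod2 has_bochner_integral_cgauss_shift_cmod2)
         (auto simp: has_bochner_integral_iff)
    then show "has_bochner_integral cgauss (d j n) (ln v - 1 + ((cmod (x j n - \<mu> n))\<^sup>2 + 1) / v)"
      unfolding d_def[abs_def] by (simp add: algebra_simps)
  qed
  have tilt: "distr (density P (\<lambda>z. ennreal (exp (- i j z)))) Q (\<lambda>z. \<lambda>n\<in>T. x j n + z n) = Q" for j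
  proof -
    have "distr (density (PiM T (\<lambda>_. cgauss)) (\<lambda>z. \<Prod>n\<in>T. ennreal (exp ((cmod (z n))\<^sup>2 - (cmod (x j n + z n - \<mu> n))\<^sup>2 / v - ln v))))
      Q (\<lambda>z. \<lambda>n\<in>T. x j n + z n) = Q"
      unfolding Q_def
    proof (rule distr_PiM_tilted[OF T prob_space_cgauss psQ])
      fix n
      show "distr (density cgauss (\<lambda>z. ennreal (exp ((cmod z)\<^sup>2 - (cmod (x j n + z - \<mu> n))\<^sup>2 / v - ln v))))
        (density lborel (\<lambda>z. ennreal (cnormal_density (\<mu> n) v z))) (\<lambda>z. x j n + z)
        = density lborel (\<lambda>z. ennreal (cnormal_density (\<mu> n) v z))"
        by (subst distr_cgauss_tilted[OF v, of "x j n" "\<mu> n", symmetric])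
           (intro distr_cong; simp)
    qed measurable
    also have "(\<lambda>z. \<Prod>n\<in>T. ennreal (exp ((cmod (z n))\<^sup>2 - (cmod (x j n + z n - \<mu> n))\<^sup>2 / v - ln v)))
      = (\<lambda>z. ennreal (exp (- i j z)))"
      by (simp add: prod_ennreal exp_sum[OF T, symmetric] i_def d_def sum_negf[symmetric] algebra_simps)
    finally show ?thesis unfolding P_def .
  qed
  have Tm [measurable]: "(\<lambda>z. \<lambda>n\<in>T. x j n + z n) \<in> measurable P Q" for j by measurable
  \<comment> \<open>Undoing the tilt: the noise average of \<open>exp (- i j z)\<close> over a
    region of received blocks is the mass of that region under \<open>Q\<close>, the same for every
    \<open>j\<close>.\<close>
  have nn: "(\<integral>\<^sup>+z. ennreal (exp (- i j z)) * indicator B (\<lambda>n\<in>T. x j n + z n) \<partial>P) = emeasure Q B"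
    if [measurable]: "B \<in> sets Q" for j B
  proof -
    have "emeasure Q B = (\<integral>\<^sup>+y. indicator B y \<partial>distr (density P (\<lambda>z. ennreal (exp (- i j z)))) Q (\<lambda>z. \<lambda>n\<in>T. x j n + z n))"
      by (simp add: tilt)
    also have "\<dots> = (\<integral>\<^sup>+z. ennreal (exp (- i j z)) * indicator B (\<lambda>n\<in>T. x j n + z n) \<partial>P)"
      by (simp add: nn_integral_distr nn_integral_density del: nn_integral_indicator)
    finally show ?thesis by simp
  qed
  have B: "has_bochner_integral P (\<lambda>z. exp (- i j z) * indicator B (\<lambda>n\<in>T. x j n + z n)) (measure Q B)"
    if [measurable]: "B \<in> sets Q" for j B
    using nn[of B j]
    by (intro has_bochner_integral_nn_integral)
       (auto simp: Q.emeasure_eq_measure ennreal_mult ennreal_indicator)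
  have one: "has_bochner_integral P (\<lambda>z. exp (- i j z)) 1" for j
  proof -
    have "has_bochner_integral P (\<lambda>z. exp (- i j z) * indicator (space Q) (\<lambda>n\<in>T. x j n + z n)) 1"
      using B[of "space Q" j] Q.prob_space by simp
    moreover have "(\<lambda>n\<in>T. x j n + z n) \<in> space Q" for z
      by (auto simp: Q_def space_PiM)
    ultimately show ?thesis by simp
  qed
  have main: "ln L * measure P (S j) \<le> (\<Sum>n\<in>T. ln v - 1 + ((cmod (x j n - \<mu> n))\<^sup>2 + 1) / v) + ln 2
      - 1/2 + L * measure Q (A j) / 2" if j: "j \<in> J" for j
  proof -
    have Aj [measurable]: "A j \<in> sets Q" using A j sets_Q by auto
    let ?f = "\<lambda>z. ln L * indicator (S j) z"
    let ?g = "\<lambda>z. i j z + (ln 2 - 1) + (exp (- i j z) / 2 + L * (exp (- i j z) * indicator (A j) (\<lambda>n\<in>T. x j n + z n)) / 2)"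
    have G: "has_bochner_integral P ?g
      ((\<Sum>n\<in>T. ln v - 1 + ((cmod (x j n - \<mu> n))\<^sup>2 + 1) / v) + (ln 2 - 1) + (1 / 2 + L * measure Q (A j) / 2))"
      using P.prob_space
      by (intro has_bochner_integral_add i has_bochner_integral_divide_zero has_bochner_integral_mult_right one B Aj)
         (auto simp: has_bochner_integral_iff)
    have F: "has_bochner_integral P ?f (ln L * measure P (S j))"
      using j by (intro has_bochner_integral_mult_right has_bochner_integral_real_indicator)
        (auto simp: P.emeasure_eq_measure)
    have FG: "integral\<^sup>L P ?f \<le> integral\<^sup>L P ?g"
    proof (rule integral_mono)
      fix z assume z: "z \<in> space P"
      define b where "b = indicator (S j) z * (1::real)"
      have b: "indicator (A j) (\<lambda>n\<in>T. x j n + z n) = b" "indicator (S j) z = b" "b = 0 \<or> b = 1"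
        using z by (auto simp: b_def S_def indicator_def)
      have "ln L * b - i j z - ln 2 = ln (exp (ln L * b - i j z) / 2)"
        by (simp add: ln_div)
      also have "\<dots> \<le> exp (ln L * b - i j z) / 2 - 1"
        by (intro ln_le_minus_one) simp
      \<comment> \<open>As \<open>b\<close> is 0 or 1, \<open>exp (ln L * b)\<close> is at most
        \<open>1 + L * b\<close>; this bound has a known mean by \<open>one\<close> and
        \<open>B\<close>.\<close>
      also have "exp (ln L * b - i j z) \<le> exp (- i j z) + L * exp (- i j z) * b"
        using b(3) L by (auto simp: exp_diff exp_minus field_simps)
      finally show "?f z \<le> ?g z"
        unfolding b by (simp add: algebra_simps)
    qed (use F G in \<open>auto simp: has_bochner_integral_iff\<close>)
    then show ?thesis
      unfolding has_bochner_integral_integral_eq[OF F] has_bochner_integral_integral_eq[OF G] by simp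
  qed
  \<comment> \<open>Disjointness enters here. It bounds the terms
    \<open>L * measure Q (A j) / 2\<close> by \<open>L / 2\<close> in total, which the
    \<open>card J\<close> copies of \<open>- 1/2\<close> cancel. This balance dictates the factor
    1/2 in the linearisation, whose price is \<open>ln 2\<close>.\<close>
  have "(\<Sum>j\<in>J. measure Q (A j)) = measure Q (\<Union>j\<in>J. A j)"
    using A sets_Q J by (intro Q.finite_measure_finite_Union[symmetric]) auto
  also have "\<dots> \<le> 1" by simp
  finally have Q1: "(\<Sum>j\<in>J. measure Q (A j)) \<le> 1" .
  have "ln L * (\<Sum>j\<in>J. measure P (S j)) = (\<Sum>j\<in>J. ln L * measure P (S j))"
    by (simp add: sum_distrib_left)
  also have "\<dots> \<le> (\<Sum>j\<in>J. (\<Sum>n\<in>T. ln v - 1 + ((cmod (x j n - \<mu> n))\<^sup>2 + 1) / v) + ln 2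
      - 1/2 + L * measure Q (A j) / 2)"
    by (intro sum_mono main)
  also have "\<dots> = (\<Sum>j\<in>J. \<Sum>n\<in>T. ln v - 1 + ((cmod (x j n - \<mu> n))\<^sup>2 + 1) / v) + L * ln 2
      - L / 2 + L / 2 * (\<Sum>j\<in>J. measure Q (A j))"
    by (simp add: sum.distrib sum_subtractf L_def sum_distrib_left)
  also have "\<dots> \<le> (\<Sum>j\<in>J. \<Sum>n\<in>T. ln v - 1 + ((cmod (x j n - \<mu> n))\<^sup>2 + 1) / v) + L * ln 2"
    using Q1 L mult_left_mono[of "\<Sum>j\<in>J. measure Q (A j)" 1 "L/2"] by simp
  finally show ?thesis unfolding L_def S_def P_def .
qed

section \<open>The network with equal strengths\<close>

lemma prob_space_phase_meas: "prob_space (phase_meas K)"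
  unfolding phase_meas_def by (intro prob_space_PiM prob_space_uniform_measure) auto

lemma prob_space_noise_seq_meas: "prob_space (noise_seq_meas K N)"
  unfolding noise_seq_meas_def by (intro prob_space_PiM prob_space_cgauss)

lemma has_bochner_integral_measure_section:
  assumes A: "prob_space A" and B: "prob_space B" and S: "S \<in> sets (A \<Otimes>\<^sub>M B)"
  shows "has_bochner_integral A (\<lambda>x. measure B (Pair x -` S)) (measure (A \<Otimes>\<^sub>M B) S)"
proof -
  interpret A: prob_space A by fact
  interpret B: prob_space B by fact
  interpret AB: pair_prob_space A B ..
  have m: "(\<lambda>x. emeasure B (Pair x -` S)) \<in> borel_measurable A"
    using S by (rule B.measurable_emeasure_Pair)
  show ?thesis
  proof (rule has_bochner_integral_nn_integral)
    show "(\<lambda>x. measure B (Pair x -` S)) \<in> borel_measurable A"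
      using m unfolding measure_def by measurable
    show "(\<integral>\<^sup>+x. ennreal (measure B (Pair x -` S)) \<partial>A) = ennreal (measure (A \<Otimes>\<^sub>M B) S)"
      using S by (simp add: B.emeasure_eq_measure[symmetric] AB.P.emeasure_eq_measure[symmetric] B.emeasure_pair_measure_alt)
  qed auto
qed

text \<open>Separates the messages of the two users under study from the remaining ones, which stay
  fixed while the two-user bound is applied.\<close>

lemma sum_PiE_insert_two:
  fixes F :: "('a \<Rightarrow> 'b) \<Rightarrow> 'c::comm_monoid_add"
  assumes rt: "r \<notin> R" "t \<notin> R" "r \<noteq> t"
  shows "(\<Sum>w\<in>PiE (insert r (insert t R)) A. F w)
    = (\<Sum>v\<in>PiE R A. \<Sum>(a, b)\<in>A r \<times> A t. F (v(t := b, r := a)))"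
proof -
  have 1: "(\<Sum>w\<in>PiE (insert i I) A. F w) = (\<Sum>a\<in>A i. \<Sum>v\<in>PiE I A. F (v(i := a)))"
    if "i \<notin> I" for i I and F :: "('a \<Rightarrow> 'b) \<Rightarrow> 'c"
    unfolding PiE_insert_eq
    by (subst sum.reindex[OF inj_combinator[OF that]]) (simp add: sum.cartesian_product split_beta')
  have "(\<Sum>w\<in>PiE (insert r (insert t R)) A. F w)
      = (\<Sum>a\<in>A r. \<Sum>b\<in>A t. \<Sum>v\<in>PiE R A. F (v(t := b, r := a)))"
    using rt by (simp add: 1)
  also have "\<dots> = (\<Sum>(a, b)\<in>A r \<times> A t. \<Sum>v\<in>PiE R A. F (v(t := b, r := a)))"
    by (rule sum.cartesian_product)
  also have "\<dots> = (\<Sum>v\<in>PiE R A. \<Sum>(a, b)\<in>A r \<times> A t. F (v(t := b, r := a)))"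
    unfolding split_beta' by (rule sum.swap)
  finally show ?thesis .
qed

text \<open>Deviations from the mean are orthogonal to constants, so centring removes exactly
  \<open>card A\<close> times the squared modulus of the mean.\<close>

lemma sum_cmod2_centered_le:
  fixes u :: "'a \<Rightarrow> complex"
  assumes A: "finite A"
  defines "m \<equiv> (\<Sum>a\<in>A. u a) / of_nat (card A)"
  shows "(\<Sum>a\<in>A. (cmod (u a - m))\<^sup>2) \<le> (\<Sum>a\<in>A. (cmod (u a))\<^sup>2)"
    and "(\<Sum>a\<in>A. u a - m) = 0"
proof -
  show z: "(\<Sum>a\<in>A. u a - m) = 0"
    using A by (cases "A = {}") (auto simp: m_def sum_subtractf)
  have "(cmod (u a))\<^sup>2 = (cmod (u a - m))\<^sup>2 + (cmod m)\<^sup>2 + 2 * Re ((u a - m) * cnj m)" for a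
    unfolding cmod_power2 by (simp add: power2_eq_square algebra_simps)
  then have "(\<Sum>a\<in>A. (cmod (u a))\<^sup>2) = (\<Sum>a\<in>A. (cmod (u a - m))\<^sup>2) + (\<Sum>a\<in>A. (cmod m)\<^sup>2)
      + 2 * Re ((\<Sum>a\<in>A. u a - m) * cnj m)"
    by (simp only: sum.distrib Re_sum sum_distrib_right sum_distrib_left)
  then show "(\<Sum>a\<in>A. (cmod (u a - m))\<^sup>2) \<le> (\<Sum>a\<in>A. (cmod (u a))\<^sup>2)"
    unfolding z by (simp add: sum_nonneg)
qed

text \<open>The two codebooks vary independently over \<open>A \<times> B\<close>, so after centring
  each of them the mixed terms sum to a product of zero sums. Powers add even if the codebooks have
  nonzero means.\<close>

lemma sum_cmod2_product_centered_le:
  fixes u :: "'a \<Rightarrow> complex" and y :: "'b \<Rightarrow> complex"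
  assumes A: "finite A" and B: "finite B"
  shows "(\<Sum>(a, b)\<in>A \<times> B. (cmod (u a + y b - ((\<Sum>a\<in>A. u a) / of_nat (card A) + (\<Sum>b\<in>B. y b) / of_nat (card B))))\<^sup>2)
    \<le> real (card B) * (\<Sum>a\<in>A. (cmod (u a))\<^sup>2) + real (card A) * (\<Sum>b\<in>B. (cmod (y b))\<^sup>2)"
proof -
  define p where "p a = u a - (\<Sum>a\<in>A. u a) / of_nat (card A)" for a
  define q where "q b = y b - (\<Sum>b\<in>B. y b) / of_nat (card B)" for b
  have p: "(\<Sum>a\<in>A. (cmod (p a))\<^sup>2) \<le> (\<Sum>a\<in>A. (cmod (u a))\<^sup>2)" "(\<Sum>a\<in>A. p a) = 0"
    unfolding p_def using sum_cmod2_centered_le[OF A, of u] by auto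
  have q: "(\<Sum>a\<in>B. (cmod (q a))\<^sup>2) \<le> (\<Sum>a\<in>B. (cmod (y a))\<^sup>2)" "(\<Sum>a\<in>B. q a) = 0"
    unfolding q_def using sum_cmod2_centered_le[OF B, of y] by auto
  have e: "(cmod (p a + q b))\<^sup>2 = (cmod (p a))\<^sup>2 + (cmod (q b))\<^sup>2 + 2 * Re (p a * cnj (q b))" for a b
    unfolding cmod_power2 by (simp add: power2_eq_square algebra_simps)
  have "(\<Sum>(a, b)\<in>A \<times> B. (cmod (u a + y b - ((\<Sum>a\<in>A. u a) / of_nat (card A) + (\<Sum>b\<in>B. y b) / of_nat (card B))))\<^sup>2)
      = (\<Sum>(a, b)\<in>A \<times> B. (cmod (p a + q b))\<^sup>2)"
    unfolding p_def q_def by (simp add: algebra_simps)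
  also have "\<dots> = (\<Sum>a\<in>A. \<Sum>b\<in>B. (cmod (p a))\<^sup>2 + (cmod (q b))\<^sup>2 + 2 * Re (p a * cnj (q b)))"
    by (simp only: sum.cartesian_product[symmetric] e)
  also have "\<dots> = real (card B) * (\<Sum>a\<in>A. (cmod (p a))\<^sup>2) + real (card A) * (\<Sum>b\<in>B. (cmod (q b))\<^sup>2)
      + 2 * Re ((\<Sum>a\<in>A. p a) * cnj (\<Sum>b\<in>B. q b))"
  proof -
    have "Re ((\<Sum>a\<in>A. p a) * cnj (\<Sum>b\<in>B. q b)) = (\<Sum>a\<in>A. \<Sum>b\<in>B. Re (p a * cnj (q b)))"
      unfolding cnj_sum sum_product Re_sum ..
    then show ?thesis by (simp only: sum.distrib sum_constant sum_distrib_left[symmetric])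
  qed
  finally show ?thesis using p q by (simp add: add_mono mult_left_mono)
qed

lemma borel_measurable_cis: "f \<in> borel_measurable M \<Longrightarrow> (\<lambda>x. cis (f x)) \<in> borel_measurable M"
  by (simp add: cis_conv_exp)

text \<open>By the definition of a bottleneck state it suffices to treat the network in which all
  cross links are as strong as the direct ones.\<close>
locale equal_strength =
  fixes K :: nat and SNR :: real and D :: "((nat \<times> nat) \<Rightarrow> real) measure"
  assumes K: "2 \<le> K" and SNR: "0 < SNR"
    and adm: "admissible_dist K SNR (offdiag K) D"
begin

lemma prob_D: "prob_space D" and sets_D [measurable_cong]: "sets D = sets (PiM (offdiag K) (\<lambda>_. borel))"
  using adm by (auto simp: admissible_dist_def)

lemma AE_D: "AE x in D. \<forall>p\<in>offdiag K. x p = SNR"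
  using adm by (auto simp: admissible_dist_def)

lemma prob_state: "prob_space (state_meas K D)"
  unfolding state_meas_def by (intro prob_space_pair prob_D prob_space_phase_meas)

lemma prob_state_seq: "prob_space (state_seq_meas K D N)"
  unfolding state_seq_meas_def by (intro prob_space_PiM prob_state)

lemma prob_exper: "prob_space (exper K D N)"
  unfolding exper_def by (intro prob_space_pair prob_state_seq prob_space_noise_seq_meas)

text \<open>\<open>admissible_dist\<close> fixes the strengths almost surely, and finitely many
  channel uses give one common null set. Outside it all gains differ in phase only.\<close>

lemma AE_state_seq_gain:
  "AE sq in state_seq_meas K D N. \<forall>n<N. \<forall>r\<in>{1..K}. \<forall>t\<in>{1..K}.
     gain SNR (sq n) r t = complex_of_real (sqrt SNR) * cis (snd (sq n) (r, t))"
proof -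
  interpret D: prob_space D by (rule prob_D)
  interpret P: prob_space "phase_meas K" by (rule prob_space_phase_meas)
  have "AE x in distr (D \<Otimes>\<^sub>M phase_meas K) D fst. \<forall>p\<in>offdiag K. x p = SNR"
    using AE_D by (subst P.distr_pair_fst)
  then have "AE s in state_meas K D. \<forall>p\<in>offdiag K. fst s p = SNR"
    unfolding state_meas_def by (rule AE_distrD[rotated]) measurable
  then have "AE sq in state_seq_meas K D N. \<forall>p\<in>offdiag K. fst (sq n) p = SNR" if "n < N" for n
    unfolding state_seq_meas_def using that prob_state
    by (intro AE_PiM_component) auto
  then have "AE sq in state_seq_meas K D N. \<forall>n\<in>{..<N}. \<forall>p\<in>offdiag K. fst (sq n) p = SNR"
    by (rule AE_finite_allI[rotated]) auto
  then show ?thesis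
    by eventually_elim (auto simp: gain_def offdiag_def)
qed

lemma measurable_state_phase:
  assumes "n < N" "r \<in> {1..K}" "t \<in> {1..K}"
  shows "(\<lambda>sq. snd (sq n) (r, t)) \<in> borel_measurable (state_seq_meas K D N)"
proof -
  have "sets (phase_meas K) = sets (PiM ({1..K} \<times> {1..K}) (\<lambda>_. borel))"
    unfolding phase_meas_def by (intro sets_PiM_cong) auto
  then have "(\<lambda>x. x (r, t)) \<in> borel_measurable (phase_meas K)"
    using assms by (subst measurable_cong_sets) (auto intro!: measurable_component_singleton)
  moreover have "(\<lambda>sq. snd (sq n)) \<in> measurable (state_seq_meas K D N) (phase_meas K)"
    unfolding state_seq_meas_def state_meas_def
    by (rule measurable_compose[OF measurable_component_singleton[where i=n] measurable_snd]) (use assms in auto)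
  ultimately show ?thesis by (rule measurable_compose[rotated])
qed

lemma measurable_gain:
  assumes "n < N" "r \<in> {1..K}" "t \<in> {1..K}"
  shows "(\<lambda>sq. gain SNR (sq n) r t) \<in> borel_measurable (state_seq_meas K D N)"
proof (cases "r = t")
  case True
  then show ?thesis using borel_measurable_cis[OF measurable_state_phase[OF assms]] unfolding gain_def by simp
next
  case False
  then have "(\<lambda>x. x (r, t)) \<in> borel_measurable D"
    using assms by (subst measurable_cong_sets[OF sets_D refl])
      (auto intro!: measurable_component_singleton simp: offdiag_def)
  moreover have "(\<lambda>sq. fst (sq n)) \<in> measurable (state_seq_meas K D N) D"
    unfolding state_seq_meas_def state_meas_def
    by (rule measurable_compose[OF measurable_component_singleton[where i=n] measurable_fst]) (use assms in auto)
  ultimately have "(\<lambda>sq. fst (sq n) (r, t)) \<in> borel_measurable (state_seq_meas K D N)"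
    by (rule measurable_compose[rotated])
  then show ?thesis
    using False borel_measurable_cis[OF measurable_state_phase[OF assms]] unfolding gain_def by simp
qed

end

section \<open>Converse\<close>

text \<open>Each receiver reads its own coordinates of one i.i.d. array. The error probability of a
  single receiver depends only on this marginal law, which is the same for all; so the noise of one
  receiver can stand in for that of another.\<close>

lemma measure_noise_marginal:
  assumes k: "k \<in> {1..K}" and B: "B \<in> sets (PiM {..<N} (\<lambda>_. borel))"
  shows "measure (noise_seq_meas K N) {z \<in> space (noise_seq_meas K N). (\<lambda>n\<in>{..<N}. s n + z (n, k)) \<in> B}
    = measure (PiM {..<N} (\<lambda>_. cgauss)) {z \<in> space (PiM {..<N} (\<lambda>_. cgauss)). (\<lambda>n\<in>{..<N}. s n + z n) \<in> B}"
proof -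
  have re: "distr (PiM ({..<N} \<times> {1..K}) (\<lambda>_. cgauss)) (PiM {..<N} (\<lambda>_. cgauss)) (\<lambda>z. \<lambda>n\<in>{..<N}. z (n, k))
    = PiM {..<N} (\<lambda>_. cgauss)"
    using k by (intro distr_PiM_reindex[where f="\<lambda>n. (n, k)"] prob_space_cgauss) (auto simp: inj_on_def)
  have sets: "sets (PiM {..<N} (\<lambda>_. cgauss)) = sets (PiM {..<N} (\<lambda>_. borel))"
    by (intro sets_PiM_cong) auto
  have m1: "(\<lambda>z. \<lambda>n\<in>{..<N}. z (n, k)) \<in> measurable (PiM ({..<N} \<times> {1..K}) (\<lambda>_. cgauss)) (PiM {..<N} (\<lambda>_. cgauss))"
    using k by (intro measurable_restrict measurable_component_singleton) auto
  have m2: "(\<lambda>z. \<lambda>n\<in>{..<N}. s n + z n) \<in> measurable (PiM {..<N} (\<lambda>_. cgauss)) (PiM {..<N} (\<lambda>_. borel))"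
    by measurable
  let ?S = "{z \<in> space (PiM {..<N} (\<lambda>_. cgauss)). (\<lambda>n\<in>{..<N}. s n + z n) \<in> B}"
  have S: "?S \<in> sets (PiM {..<N} (\<lambda>_. cgauss))"
    using measurable_sets[OF m2 B] by (simp add: vimage_def Int_def conj_commute)
  have "measure (PiM {..<N} (\<lambda>_. cgauss)) ?S = measure (distr (PiM ({..<N} \<times> {1..K}) (\<lambda>_. cgauss)) (PiM {..<N} (\<lambda>_. cgauss)) (\<lambda>z. \<lambda>n\<in>{..<N}. z (n, k))) ?S"
    by (subst re) simp
  also have "\<dots> = measure (PiM ({..<N} \<times> {1..K}) (\<lambda>_. cgauss))
      ((\<lambda>z. \<lambda>n\<in>{..<N}. z (n, k)) -` ?S \<inter> space (PiM ({..<N} \<times> {1..K}) (\<lambda>_. cgauss)))"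
    by (rule measure_distr[OF m1 S])
  also have "(\<lambda>z. \<lambda>n\<in>{..<N}. z (n, k)) -` ?S \<inter> space (PiM ({..<N} \<times> {1..K}) (\<lambda>_. cgauss))
      = {z \<in> space (noise_seq_meas K N). (\<lambda>n\<in>{..<N}. s n + z (n, k)) \<in> B}"
    using k by (auto simp: noise_seq_meas_def space_PiM cong: restrict_cong)
  finally show ?thesis unfolding noise_seq_meas_def by (rule sym)
qed

lemma measure_gauss_rotate:
  fixes N :: nat
  assumes c: "\<And>n. cmod (c n) = 1" and B: "B \<in> sets (PiM {..<N} (\<lambda>_. borel))"
  shows "measure (PiM {..<N} (\<lambda>_. cgauss)) {z \<in> space (PiM {..<N} (\<lambda>_. cgauss)). (\<lambda>n\<in>{..<N}. s n + c n * z n) \<in> B}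
    = measure (PiM {..<N} (\<lambda>_. cgauss)) {z \<in> space (PiM {..<N} (\<lambda>_. cgauss)). (\<lambda>n\<in>{..<N}. s n + z n) \<in> B}"
proof -
  let ?P = "PiM {..<N} (\<lambda>_. cgauss)"
  have rot: "distr ?P ?P (\<lambda>z. \<lambda>n\<in>{..<N}. c n * z n) = ?P"
  proof (rule distr_PiM_componentwise[OF _ prob_space_cgauss])
    fix n
    have "distr cgauss cgauss ((*) (c n)) = distr cgauss borel (\<lambda>z. c n * z)"
      by (rule distr_cong) auto
    then show "distr cgauss cgauss ((*) (c n)) = cgauss" by (simp add: distr_cgauss_rotate c)
  qed auto
  have m1: "(\<lambda>z. \<lambda>n\<in>{..<N}. c n * z n) \<in> measurable ?P ?P"
    by measurable
  have m2: "(\<lambda>z. \<lambda>n\<in>{..<N}. s n + z n) \<in> measurable ?P (PiM {..<N} (\<lambda>_. borel))"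
    by measurable
  let ?S = "{z \<in> space ?P. (\<lambda>n\<in>{..<N}. s n + z n) \<in> B}"
  have S: "?S \<in> sets ?P"
    using measurable_sets[OF m2 B] by (simp add: vimage_def Int_def conj_commute)
  have "measure ?P ?S = measure (distr ?P ?P (\<lambda>z. \<lambda>n\<in>{..<N}. c n * z n)) ?S"
    by (subst rot) simp
  also have "\<dots> = measure ?P ((\<lambda>z. \<lambda>n\<in>{..<N}. c n * z n) -` ?S \<inter> space ?P)"
    by (rule measure_distr[OF m1 S])
  also have "(\<lambda>z. \<lambda>n\<in>{..<N}. c n * z n) -` ?S \<inter> space ?P = {z \<in> space ?P. (\<lambda>n\<in>{..<N}. s n + c n * z n) \<in> B}"
    by (auto simp: space_PiM cong: restrict_cong)
  finally show ?thesis by (rule sym)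
qed

context equal_strength begin

definition sig :: "(nat \<Rightarrow> nat \<Rightarrow> (nat \<Rightarrow> state) \<Rightarrow> nat \<Rightarrow> complex) \<Rightarrow> (nat \<Rightarrow> nat) \<Rightarrow> (nat \<Rightarrow> state) \<Rightarrow> nat \<Rightarrow> nat \<Rightarrow> complex" where
  "sig f w sq r n = (\<Sum>t\<in>{1..K}. gain SNR (sq n) r t * f t (w t) sq n)"

definition err_event :: "nat \<Rightarrow> (nat \<Rightarrow> nat \<Rightarrow> (nat \<Rightarrow> state) \<Rightarrow> nat \<Rightarrow> complex)
    \<Rightarrow> (nat \<Rightarrow> (nat \<Rightarrow> complex) \<times> (nat \<Rightarrow> state) \<Rightarrow> nat) \<Rightarrow> (nat \<Rightarrow> nat)
    \<Rightarrow> ((nat \<Rightarrow> state) \<times> (nat \<times> nat \<Rightarrow> complex)) set" where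
  "err_event N f g w = {x \<in> space (exper K D N). \<exists>k\<in>{1..K}.
     g k (\<lambda>n\<in>{..<N}. sig f w (fst x) k n + snd x (n, k), fst x) \<noteq> w k}"

lemma err_prob_eq:
  "err_prob K SNR D N M f g = (1 / (\<Prod>k\<in>{1..K}. real (M k))) *
     (\<Sum>w\<in>PiE {1..K} (\<lambda>k. {..<M k}). measure (exper K D N) (err_event N f g w))"
  unfolding err_prob_def err_event_def chan_output_def sig_def
  by (intro arg_cong2[where f="(*)"] sum.cong refl arg_cong[where f="measure _"]) auto

lemma measurable_sig:
  assumes f: "\<And>t m n. t \<in> {1..K} \<Longrightarrow> m < M t \<Longrightarrow> n < N \<Longrightarrow> (\<lambda>sq. f t m sq n) \<in> borel_measurable (state_seq_meas K D N)"
    and w: "\<And>t. t \<in> {1..K} \<Longrightarrow> w t < M t" and r: "r \<in> {1..K}" "n < N"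
  shows "(\<lambda>sq. sig f w sq r n) \<in> borel_measurable (state_seq_meas K D N)"
  unfolding sig_def using r
  by (intro borel_measurable_sum borel_measurable_times measurable_gain f w) auto

lemma err_event_measurable:
  assumes f: "\<And>t m n. t \<in> {1..K} \<Longrightarrow> m < M t \<Longrightarrow> n < N \<Longrightarrow> (\<lambda>sq. f t m sq n) \<in> borel_measurable (state_seq_meas K D N)"
    and w: "\<And>t. t \<in> {1..K} \<Longrightarrow> w t < M t"
    and g: "\<And>k. k \<in> {1..K} \<Longrightarrow> g k \<in> measurable (PiM {..<N} (\<lambda>_. borel) \<Otimes>\<^sub>M state_seq_meas K D N) (count_space UNIV)"
  shows "err_event N f g w \<in> sets (exper K D N)"
proof -
  have "{x \<in> space (exper K D N). g k (\<lambda>n\<in>{..<N}. sig f w (fst x) k n + snd x (n, k), fst x) \<noteq> w k}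
      \<in> sets (exper K D N)" if k: "k \<in> {1..K}" for k
  proof -
    have fst: "fst \<in> measurable (exper K D N) (state_seq_meas K D N)" unfolding exper_def by measurable
    have "(\<lambda>x. sig f w (fst x) k n + snd x (n, k)) \<in> borel_measurable (exper K D N)" if n: "n < N" for n
    proof (rule borel_measurable_add)
      show "(\<lambda>x. sig f w (fst x) k n) \<in> borel_measurable (exper K D N)"
        by (rule measurable_compose[OF fst]) (rule measurable_sig[where M=M, OF f w k n])
      have "(\<lambda>z. z (n, k)) \<in> measurable (noise_seq_meas K N) cgauss"
        unfolding noise_seq_meas_def using n k by (intro measurable_component_singleton) auto
      then have "(\<lambda>z. z (n, k)) \<in> borel_measurable (noise_seq_meas K N)"
        by (simp cong: measurable_cong_sets)
      moreover have "snd \<in> measurable (exper K D N) (noise_seq_meas K N)"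
        unfolding exper_def by measurable
      ultimately show "(\<lambda>x. snd x (n, k)) \<in> borel_measurable (exper K D N)"
        by (rule measurable_compose[rotated])
    qed
    then have "(\<lambda>x. \<lambda>n\<in>{..<N}. sig f w (fst x) k n + snd x (n, k)) \<in> measurable (exper K D N) (PiM {..<N} (\<lambda>_. borel))"
      by (intro measurable_restrict) auto
    from measurable_compose[OF measurable_Pair[OF this fst] g[OF k]]
    have [measurable]: "(\<lambda>x. g k (\<lambda>n\<in>{..<N}. sig f w (fst x) k n + snd x (n, k), fst x)) \<in> measurable (exper K D N) (count_space UNIV)" .
    show ?thesis by measurable
  qed
  moreover have "err_event N f g w = (\<Union>k\<in>{1..K}. {x \<in> space (exper K D N). g k (\<lambda>n\<in>{..<N}. sig f w (fst x) k n + snd x (n, k), fst x) \<noteq> w k})"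
    by (auto simp: err_event_def)
  ultimately show ?thesis by auto
qed

text \<open>Receiver \<open>r\<close> decodes its own message, strips its own signal and rotates what is left; as the link
  from \<open>t\<close> to \<open>r\<close> is as strong as that from \<open>t\<close> to \<open>t\<close>, it can then emulate receiver \<open>t\<close>.
  So it decodes both messages.\<close>
lemma two_user_bound_pointwise:
  fixes v :: "nat \<Rightarrow> nat"
  assumes M: "\<And>t. t \<in> {1..K} \<Longrightarrow> 1 \<le> M t"
    and f: "\<And>t m n. t \<in> {1..K} \<Longrightarrow> m < M t \<Longrightarrow> n < N \<Longrightarrow> (\<lambda>sq. f t m sq n) \<in> borel_measurable (state_seq_meas K D N)"
    and g: "\<And>k. k \<in> {1..K} \<Longrightarrow> g k \<in> measurable (PiM {..<N} (\<lambda>_. borel) \<Otimes>\<^sub>M state_seq_meas K D N) (count_space UNIV)"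
    and rt: "r \<in> {1..K}" "t \<in> {1..K}" "r \<noteq> t"
    and v: "\<And>k. k \<in> {1..K} - {r, t} \<Longrightarrow> v k < M k"
    and sq: "sq \<in> space (state_seq_meas K D N)"
    and gain: "\<And>n r t. n < N \<Longrightarrow> r \<in> {1..K} \<Longrightarrow> t \<in> {1..K} \<Longrightarrow>
       gain SNR (sq n) r t = complex_of_real (sqrt SNR) * cis (snd (sq n) (r, t))"
  shows "ln (real (M r * M t)) * (\<Sum>(a, b)\<in>{..<M r} \<times> {..<M t}.
       1 - 2 * measure (noise_seq_meas K N) (Pair sq -` err_event N f g (v(t := b, r := a))))
    \<le> real (M r * M t) * (real N * (ln (1 + 2 * SNR) - 1 + 1 / (1 + 2 * SNR)) + ln 2)
      + SNR / (1 + 2 * SNR) * (\<Sum>n<N. real (M t) * (\<Sum>a<M r. (cmod (f r a sq n))\<^sup>2)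
          + real (M r) * (\<Sum>b<M t. (cmod (f t b sq n))\<^sup>2))"
proof -
  let ?J = "{..<M r} \<times> {..<M t}" and ?P = "PiM {..<N} (\<lambda>_. cgauss)"
  let ?Y = "PiM {..<N} (\<lambda>_. borel) :: (nat \<Rightarrow> complex) measure"
  define V where "V = 1 + 2 * SNR"
  have V: "0 < V" using SNR by (simp add: V_def)
  define w where "w a b = v(t := b, r := a)" for a b
  have w: "w a b k < M k" if "a < M r" "b < M t" "k \<in> {1..K}" for a b k
    using that v rt by (auto simp: w_def)
  have wr: "w a b r = a" "w a b t = b" for a b using rt by (auto simp: w_def)
  interpret P: prob_space ?P by (intro prob_space_PiM prob_space_cgauss)
  interpret NS: prob_space "noise_seq_meas K N" by (rule prob_space_noise_seq_meas)
  define x where "x = (\<lambda>(a, b) n. sig f (w a b) sq r n)"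
  define c where "c n = cis (snd (sq n) (t, t) - snd (sq n) (r, t))" for n
  \<comment> \<open>What receiver \<open>k\<close> gets from the transmitters other than
    \<open>t\<close>. The message of \<open>t\<close> does not enter, so 0 is a placeholder for it;
    given \<open>a\<close> the quantity is known, the other messages being fixed by
    \<open>v\<close>.\<close>
  define I where "I k a n = (\<Sum>l\<in>{1..K} - {t}. gain SNR (sq n) k l * f l (w a 0 l) sq n)" for k a n
  have sigI: "sig f (w a b) sq k n = gain SNR (sq n) k t * f t b sq n + I k a n" for a b k n
  proof -
    have "sig f (w a b) sq k n = gain SNR (sq n) k t * f t (w a b t) sq n
        + (\<Sum>l\<in>{1..K} - {t}. gain SNR (sq n) k l * f l (w a b l) sq n)"
      unfolding sig_def using rt by (subst sum.remove[of _ t]) auto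
    moreover have "w a b l = w a 0 l" if "l \<noteq> t" for l using that by (auto simp: w_def)
    ultimately show ?thesis unfolding I_def wr by simp
  qed
  define T where "T a y = (\<lambda>n\<in>{..<N}. c n * (y n - I r a n) + I t a n)" for a and y :: "nat \<Rightarrow> complex"
  \<comment> \<open>Regions of different pairs are disjoint: \<open>y\<close> determines
    \<open>a\<close> through the first decoder and then \<open>b\<close> through the second.\<close>
  define A where "A = (\<lambda>(a, b). {y \<in> space ?Y. g r (y, sq) = a \<and> g t (T a y, sq) = b})"
  have gk: "(\<lambda>y. g k (y, sq)) \<in> measurable ?Y (count_space UNIV)" if "k \<in> {1..K}" for k
    by (rule measurable_compose[OF measurable_Pair2'[OF sq] g[OF that]])
  have T: "T a \<in> measurable ?Y ?Y" for a
    unfolding T_def[abs_def] by measurable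
  have A: "A j \<in> sets ?Y" for j
  proof -
    have [measurable]: "(\<lambda>y. g r (y, sq)) \<in> measurable ?Y (count_space UNIV)"
      "(\<lambda>y. g t (T a y, sq)) \<in> measurable ?Y (count_space UNIV)" for a
      using gk[OF rt(1)] measurable_compose[OF T gk[OF rt(2)]] by auto
    show ?thesis unfolding A_def by (cases j) simp
  qed
  define Bad where "Bad k m = {y \<in> space ?Y. g k (y, sq) \<noteq> m}" for k m
  have Bad: "Bad k m \<in> sets ?Y" if "k \<in> {1..K}" for k m
  proof -
    have [measurable]: "(\<lambda>y. g k (y, sq)) \<in> measurable ?Y (count_space UNIV)" by (rule gk[OF that])
    show ?thesis unfolding Bad_def by measurable
  qed
  have err: "measure ?P {z \<in> space ?P. (\<lambda>n\<in>{..<N}. sig f (w a b) sq k n + z n) \<in> Bad k (w a b k)}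
      \<le> measure (noise_seq_meas K N) (Pair sq -` err_event N f g (w a b))"
    if ab: "a < M r" "b < M t" and k: "k \<in> {1..K}" for a b k
  proof -
    have ev: "err_event N f g (w a b) \<in> sets (exper K D N)"
      by (rule err_event_measurable[where M=M, OF f _ g]) (use w ab in auto)
    have "measure (noise_seq_meas K N) {z \<in> space (noise_seq_meas K N). (\<lambda>n\<in>{..<N}. sig f (w a b) sq k n + z (n, k)) \<in> Bad k (w a b k)}
      \<le> measure (noise_seq_meas K N) (Pair sq -` err_event N f g (w a b))"
    proof (rule NS.finite_measure_mono)
      show "Pair sq -` err_event N f g (w a b) \<in> sets (noise_seq_meas K N)"
        using ev unfolding exper_def by (rule sets_Pair1)
      show "{z \<in> space (noise_seq_meas K N). (\<lambda>n\<in>{..<N}. sig f (w a b) sq k n + z (n, k)) \<in> Bad k (w a b k)}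
        \<subseteq> Pair sq -` err_event N f g (w a b)"
        using sq k unfolding err_event_def Bad_def exper_def by (auto simp: space_pair_measure)
    qed
    then show ?thesis by (simp add: measure_noise_marginal[OF k Bad[OF k]])
  qed
  \<comment> \<open>The pair is missed only if receiver \<open>r\<close> errs or the emulated
    receiver \<open>t\<close> errs. Each is at most as likely as the whole error event, hence the
    factor 2.\<close>
  have succ: "1 - 2 * measure (noise_seq_meas K N) (Pair sq -` err_event N f g (w a b))
      \<le> measure ?P {z \<in> space ?P. (\<lambda>n\<in>{..<N}. x (a, b) n + z n) \<in> A (a, b)}"
    if ab: "a < M r" "b < M t" for a b
  proof -
    let ?S = "{z \<in> space ?P. (\<lambda>n\<in>{..<N}. x (a, b) n + z n) \<in> A (a, b)}"
    let ?R = "{z \<in> space ?P. (\<lambda>n\<in>{..<N}. sig f (w a b) sq r n + z n) \<in> Bad r a}"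
    let ?T = "{z \<in> space ?P. (\<lambda>n\<in>{..<N}. sig f (w a b) sq t n + c n * z n) \<in> Bad t b}"
    have ms: "{z \<in> space ?P. (\<lambda>n\<in>{..<N}. s n + d n * z n) \<in> B} \<in> sets ?P" if "B \<in> sets ?Y" for B s d
    proof -
      have "(\<lambda>z. \<lambda>n\<in>{..<N}. s n + d n * z n) \<in> measurable ?P ?Y" by measurable
      from measurable_sets[OF this that] show ?thesis by (simp add: vimage_def Int_def conj_commute)
    qed
    have m: "?S \<in> sets ?P" "?R \<in> sets ?P" "?T \<in> sets ?P"
      using ms[OF A, of "x (a, b)" "\<lambda>_. 1"] ms[OF Bad[OF rt(1)], of "sig f (w a b) sq r" "\<lambda>_. 1"]
        ms[OF Bad[OF rt(2)], of "sig f (w a b) sq t" c] by simp_all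
    have "space ?P \<subseteq> ?S \<union> (?R \<union> ?T)"
    proof
      fix z assume z: "z \<in> space ?P"
      let ?y = "\<lambda>n\<in>{..<N}. sig f (w a b) sq r n + z n"
      have "c n * gain SNR (sq n) r t = gain SNR (sq n) t t" if "n < N" for n
        using that rt by (simp add: gain c_def cis_mult)
      then have "c n * (?y n - I r a n) + I t a n = sig f (w a b) sq t n + c n * z n" if "n < N" for n
        using that unfolding sigI by (simp add: algebra_simps)
      then have Ty: "T a ?y = (\<lambda>n\<in>{..<N}. sig f (w a b) sq t n + c n * z n)"
        unfolding T_def by (intro restrict_ext) auto
      have "?y \<in> space ?Y" "T a ?y \<in> space ?Y" by (auto simp: space_PiM T_def)
      then show "z \<in> ?S \<union> (?R \<union> ?T)"
        using z unfolding A_def Bad_def x_def using Ty by auto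
    qed
    then have "measure ?P (space ?P) \<le> measure ?P (?S \<union> (?R \<union> ?T))"
      using m by (intro P.finite_measure_mono) auto
    also have "\<dots> \<le> measure ?P ?S + (measure ?P ?R + measure ?P ?T)"
      using m by (intro order_trans[OF measure_Un_le] add_left_mono measure_Un_le) auto
    finally have "1 \<le> measure ?P ?S + (measure ?P ?R + measure ?P ?T)"
      using P.prob_space by simp
    moreover have "measure ?P ?T = measure ?P {z \<in> space ?P. (\<lambda>n\<in>{..<N}. sig f (w a b) sq t n + z n) \<in> Bad t b}"
      by (rule measure_gauss_rotate[OF _ Bad[OF rt(2)]]) (simp add: c_def)
    ultimately show ?thesis
      using err[OF ab rt(1)] err[OF ab rt(2)] by (simp add: wr)
  qed
  \<comment> \<open>The received signal averaged over both messages, the others being fixed. With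
    this centre the summed deviation is bounded by the powers of the two users alone.\<close>
  define \<mu> where "\<mu> n = (\<Sum>a<M r. gain SNR (sq n) r r * f r a sq n) / of_nat (M r)
      + (\<Sum>b<M t. gain SNR (sq n) r t * f t b sq n) / of_nat (M t)
      + (\<Sum>l\<in>{1..K} - {t} - {r}. gain SNR (sq n) r l * f l (v l) sq n)" for n
  have pow: "(\<Sum>j\<in>?J. (cmod (x j n - \<mu> n))\<^sup>2) \<le> SNR * (real (M t) * (\<Sum>a<M r. (cmod (f r a sq n))\<^sup>2)
          + real (M r) * (\<Sum>b<M t. (cmod (f t b sq n))\<^sup>2))" if n: "n < N" for n
  proof -
    have I': "I r a n = gain SNR (sq n) r r * f r a sq n
        + (\<Sum>l\<in>{1..K} - {t} - {r}. gain SNR (sq n) r l * f l (v l) sq n)" for a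
    proof -
      have "I r a n = gain SNR (sq n) r r * f r (w a 0 r) sq n
        + (\<Sum>l\<in>{1..K} - {t} - {r}. gain SNR (sq n) r l * f l (w a 0 l) sq n)"
        unfolding I_def using rt by (subst sum.remove[of _ r]) auto
      then show ?thesis unfolding wr by (auto simp: w_def intro!: sum.cong)
    qed
    have "(\<Sum>j\<in>?J. (cmod (x j n - \<mu> n))\<^sup>2) = (\<Sum>(a, b)\<in>?J. (cmod (gain SNR (sq n) r r * f r a sq n + gain SNR (sq n) r t * f t b sq n
       - ((\<Sum>a<M r. gain SNR (sq n) r r * f r a sq n) / of_nat (card {..<M r})
         + (\<Sum>b<M t. gain SNR (sq n) r t * f t b sq n) / of_nat (card {..<M t}))))\<^sup>2)"
      unfolding x_def \<mu>_def sigI by (auto simp: I' algebra_simps intro!: sum.cong)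
    also have "\<dots> \<le> real (card {..<M t}) * (\<Sum>a<M r. (cmod (gain SNR (sq n) r r * f r a sq n))\<^sup>2)
       + real (card {..<M r}) * (\<Sum>b<M t. (cmod (gain SNR (sq n) r t * f t b sq n))\<^sup>2)"
      by (rule sum_cmod2_product_centered_le) auto
    also have "\<dots> = SNR * (real (M t) * (\<Sum>a<M r. (cmod (f r a sq n))\<^sup>2)
          + real (M r) * (\<Sum>b<M t. (cmod (f t b sq n))\<^sup>2))"
      using SNR n rt by (simp add: gain norm_mult power_mult_distrib sum_distrib_left[symmetric] algebra_simps)
    finally show ?thesis .
  qed
  have J: "finite ?J" "?J \<noteq> {}" using M[OF rt(1)] M[OF rt(2)] by (auto simp: lessThan_empty_iff)
  have cJ: "card ?J = M r * M t" by simp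
  have "0 < M r * M t" using M[OF rt(1)] M[OF rt(2)] by simp
  then have "1 \<le> real (M r * M t)" by linarith
  then have "ln (real (M r * M t)) * (\<Sum>(a, b)\<in>?J.
       1 - 2 * measure (noise_seq_meas K N) (Pair sq -` err_event N f g (w a b)))
    \<le> ln (real (M r * M t)) * (\<Sum>j\<in>?J. measure ?P {z \<in> space ?P. (\<lambda>n\<in>{..<N}. x j n + z n) \<in> A j})"
    by (intro mult_left_mono sum_mono) (auto intro!: succ ln_ge_zero)
  also have "\<dots> \<le> (\<Sum>j\<in>?J. \<Sum>n<N. ln V - 1 + ((cmod (x j n - \<mu> n))\<^sup>2 + 1) / V) + real (card ?J) * ln 2"
    unfolding cJ[symmetric]
    by (rule gaussian_packing[OF _ J A _ V]) (auto simp: disjoint_family_on_def A_def)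
  also have "(\<Sum>j\<in>?J. \<Sum>n<N. ln V - 1 + ((cmod (x j n - \<mu> n))\<^sup>2 + 1) / V)
      = (\<Sum>j\<in>?J. real N * (ln V - 1 + 1 / V)) + (\<Sum>n<N. (\<Sum>j\<in>?J. (cmod (x j n - \<mu> n))\<^sup>2)) / V"
  proof -
    have "(\<Sum>j\<in>?J. \<Sum>n<N. ln V - 1 + ((cmod (x j n - \<mu> n))\<^sup>2 + 1) / V)
      = (\<Sum>j\<in>?J. real N * (ln V - 1 + 1 / V) + (\<Sum>n<N. (cmod (x j n - \<mu> n))\<^sup>2) / V)"
      by (intro sum.cong refl) (simp add: add_divide_distrib sum.distrib sum_subtractf sum_divide_distrib algebra_simps)
    also have "\<dots> = (\<Sum>j\<in>?J. real N * (ln V - 1 + 1 / V)) + (\<Sum>j\<in>?J. \<Sum>n<N. (cmod (x j n - \<mu> n))\<^sup>2) / V"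
      by (simp only: sum.distrib sum_divide_distrib)
    also have "(\<Sum>j\<in>?J. \<Sum>n<N. (cmod (x j n - \<mu> n))\<^sup>2) = (\<Sum>n<N. \<Sum>j\<in>?J. (cmod (x j n - \<mu> n))\<^sup>2)"
      by (rule sum.swap)
    finally show ?thesis .
  qed
  also have "\<dots> \<le> (\<Sum>j\<in>?J. real N * (ln V - 1 + 1 / V)) + (\<Sum>n<N. SNR * (real (M t) * (\<Sum>a<M r. (cmod (f r a sq n))\<^sup>2)
          + real (M r) * (\<Sum>b<M t. (cmod (f t b sq n))\<^sup>2))) / V"
    using V by (intro add_left_mono divide_right_mono sum_mono pow) auto
  also have "(\<Sum>n<N. SNR * (real (M t) * (\<Sum>a<M r. (cmod (f r a sq n))\<^sup>2)
          + real (M r) * (\<Sum>b<M t. (cmod (f t b sq n))\<^sup>2)))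
      = SNR * (\<Sum>n<N. real (M t) * (\<Sum>a<M r. (cmod (f r a sq n))\<^sup>2)
          + real (M r) * (\<Sum>b<M t. (cmod (f t b sq n))\<^sup>2))"
    by (rule sum_distrib_left[symmetric])
  finally show ?thesis
    unfolding V_def[symmetric] w_def[symmetric] cJ
    by (simp add: algebra_simps)
qed

text \<open>The power constraint of \<open>is_code\<close> is an inequality between nonnegative
  integrals. Its finiteness supplies the integrability needed to average the pointwise bound over
  the states.\<close>

lemma
  assumes code: "is_code K SNR D N M f g" and t: "t \<in> {1..K}" and n: "n < N"
  shows code_power_integrable: "m < M t \<Longrightarrow> integrable (state_seq_meas K D N) (\<lambda>sq. (cmod (f t m sq n))\<^sup>2)"
    and code_power_sum_le: "(\<Sum>m<M t. \<integral>sq. (cmod (f t m sq n))\<^sup>2 \<partial>state_seq_meas K D N) \<le> real (M t)"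
proof -
  let ?S = "state_seq_meas K D N"
  define I where "I m = (\<integral>\<^sup>+ sq. ennreal ((cmod (f t m sq n))\<^sup>2) \<partial>?S)" for m
  have f: "(\<lambda>sq. f t m sq n) \<in> borel_measurable ?S" if "m < M t" for m
    using code t n that by (auto simp: is_code_def)
  have M: "1 \<le> M t" using code t by (auto simp: is_code_def)
  have P: "ennreal (1 / real (M t)) * (\<Sum>m<M t. I m) \<le> 1"
    using code t n by (auto simp: is_code_def I_def)
  have "(\<Sum>m<M t. I m) = ennreal (real (M t)) * (ennreal (1 / real (M t)) * (\<Sum>m<M t. I m))"
    using M by (simp add: mult.assoc[symmetric] ennreal_mult[symmetric])
  also have "\<dots> \<le> ennreal (real (M t)) * 1" using P by (intro mult_left_mono) auto
  finally have S: "(\<Sum>m<M t. I m) \<le> ennreal (real (M t))" by simp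
  have fin: "I m < \<infinity>" if "m < M t" for m
  proof -
    have "I m \<le> (\<Sum>m<M t. I m)" using that by (intro member_le_sum) auto
    also note S
    finally show ?thesis by (auto simp: less_top[symmetric] top_unique)
  qed
  show int: "integrable ?S (\<lambda>sq. (cmod (f t m sq n))\<^sup>2)" if "m < M t" for m
    using fin[OF that] f[OF that] unfolding I_def by (intro integrableI_bounded) auto
  have "(\<Sum>m<M t. ennreal (\<integral>sq. (cmod (f t m sq n))\<^sup>2 \<partial>?S)) = (\<Sum>m<M t. I m)"
    unfolding I_def using int by (intro sum.cong refl nn_integral_eq_integral[symmetric]) auto
  with S have "ennreal (\<Sum>m<M t. \<integral>sq. (cmod (f t m sq n))\<^sup>2 \<partial>?S) \<le> ennreal (real (M t))"
    by (simp add: sum_ennreal)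
  then show "(\<Sum>m<M t. \<integral>sq. (cmod (f t m sq n))\<^sup>2 \<partial>?S) \<le> real (M t)" by simp
qed

text \<open>The pointwise bound is integrated over the states for each choice of the remaining
  messages and then summed over these choices; the summed error events make up
  \<open>err_prob\<close> times the number of message tuples. The result takes the place of Fano's
  inequality.\<close>

lemma two_user_bound:
  assumes code: "is_code K SNR D N M f g" and rt: "r \<in> {1..K}" "t \<in> {1..K}" "r \<noteq> t"
  shows "(1 - 2 * err_prob K SNR D N M f g) * ln (real (M r * M t)) \<le> real N * ln (1 + 2 * SNR) + ln 2"
proof -
  let ?S = "state_seq_meas K D N" and ?J = "{..<M r} \<times> {..<M t}"
  interpret S: prob_space ?S by (rule prob_state_seq)
  have M: "\<And>t. t \<in> {1..K} \<Longrightarrow> 1 \<le> M t"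
    and f: "\<And>t m n. t \<in> {1..K} \<Longrightarrow> m < M t \<Longrightarrow> n < N \<Longrightarrow> (\<lambda>sq. f t m sq n) \<in> borel_measurable ?S"
    and g: "\<And>k. k \<in> {1..K} \<Longrightarrow> g k \<in> measurable (PiM {..<N} (\<lambda>_. borel) \<Otimes>\<^sub>M ?S) (count_space UNIV)"
    using code by (auto simp: is_code_def)
  define V where "V = 1 + 2 * SNR"
  have V: "0 < V" using SNR by (simp add: V_def)
  define e where "e w = measure (exper K D N) (err_event N f g w)" for w
  define R where "R = {1..K} - {r, t}"
  define MM where "MM = real (M r * M t)"
  have MM: "1 \<le> MM"
  proof -
    have "0 < M r * M t" using M[OF rt(1)] M[OF rt(2)] by simp
    then show ?thesis unfolding MM_def by linarith
  qed
  have fixed: "ln MM * (\<Sum>(a, b)\<in>?J. 1 - 2 * e (v(t := b, r := a))) \<le> MM * (real N * ln V + ln 2)"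
    if v: "v \<in> PiE R (\<lambda>k. {..<M k})" for v
  proof -
    define w where "w a b = v(t := b, r := a)" for a b
    have sec: "has_bochner_integral ?S (\<lambda>sq. measure (noise_seq_meas K N) (Pair sq -` err_event N f g (w a b))) (e (w a b))"
      if "a < M r" "b < M t" for a b
      unfolding e_def exper_def
    proof (intro has_bochner_integral_measure_section prob_state_seq prob_space_noise_seq_meas)
      have "w a b k < M k" if "k \<in> {1..K}" for k
        using that PiE_mem[OF v, of k] \<open>a < M r\<close> \<open>b < M t\<close>
        by (cases "k = r"; cases "k = t") (simp_all add: w_def R_def)
      from err_event_measurable[where M=M, OF f this g]
      show "err_event N f g (w a b) \<in> sets (?S \<Otimes>\<^sub>M noise_seq_meas K N)"
        unfolding exper_def .
    qed
    let ?L = "\<lambda>sq. ln MM * (\<Sum>(a, b)\<in>?J. 1 - 2 * measure (noise_seq_meas K N) (Pair sq -` err_event N f g (w a b)))"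
    let ?R = "\<lambda>sq. MM * (real N * (ln V - 1 + 1 / V) + ln 2)
      + SNR / V * (\<Sum>n<N. real (M t) * (\<Sum>a<M r. (cmod (f r a sq n))\<^sup>2)
          + real (M r) * (\<Sum>b<M t. (cmod (f t b sq n))\<^sup>2))"
    have const: "has_bochner_integral ?S (\<lambda>_. c) c" for c :: real
      using S.prob_space by (simp add: has_bochner_integral_iff)
    have L: "has_bochner_integral ?S ?L (ln MM * (\<Sum>(a, b)\<in>?J. 1 - 2 * e (w a b)))"
      unfolding split_beta'
      by (intro has_bochner_integral_mult_right has_bochner_integral_sum has_bochner_integral_diff const sec) auto
    define p where "p k n = (\<Sum>m<M k. \<integral>sq. (cmod (f k m sq n))\<^sup>2 \<partial>?S)" for k n
    have pk: "has_bochner_integral ?S (\<lambda>sq. \<Sum>m<M k. (cmod (f k m sq n))\<^sup>2) (p k n)"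
      if "k \<in> {1..K}" "n < N" for k n
      unfolding p_def using code_power_integrable[OF code that]
      by (intro has_bochner_integral_sum has_bochner_integral_integrable) auto
    have ple: "p k n \<le> real (M k)" if "k \<in> {1..K}" "n < N" for k n
      unfolding p_def by (rule code_power_sum_le[OF code that])
    have RR: "has_bochner_integral ?S ?R (MM * (real N * (ln V - 1 + 1 / V) + ln 2)
      + SNR / V * (\<Sum>n<N. real (M t) * p r n + real (M r) * p t n))"
      using rt by (intro has_bochner_integral_add has_bochner_integral_mult_right has_bochner_integral_sum const pk) auto
    have "integral\<^sup>L ?S ?L \<le> integral\<^sup>L ?S ?R"
    proof (rule integral_mono_AE)
      show "AE sq in ?S. ?L sq \<le> ?R sq"
        using AE_state_seq_gain[of N] AE_space
      proof eventually_elim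
        case (elim sq)
        show "?L sq \<le> ?R sq"
          unfolding MM_def w_def V_def
          by (rule two_user_bound_pointwise[OF M f g rt])
             (use elim PiE_mem[OF v] in \<open>simp_all add: R_def\<close>)
      qed
    qed (use L RR in \<open>auto simp: has_bochner_integral_iff\<close>)
    then have "ln MM * (\<Sum>(a, b)\<in>?J. 1 - 2 * e (w a b)) \<le> MM * (real N * (ln V - 1 + 1 / V) + ln 2)
      + SNR / V * (\<Sum>n<N. real (M t) * p r n + real (M r) * p t n)"
      unfolding has_bochner_integral_integral_eq[OF L] has_bochner_integral_integral_eq[OF RR] .
    also have "\<dots> \<le> MM * (real N * (ln V - 1 + 1 / V) + ln 2)
      + SNR / V * (\<Sum>n<N. real (M t) * real (M r) + real (M r) * real (M t))"
      using SNR V rt by (intro add_left_mono mult_left_mono sum_mono add_mono ple) auto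
    \<comment> \<open>The noise contributes 1 and the two power constraints \<open>2 * SNR\<close>
      to the numerator. The choice of \<open>V\<close> makes the quotient one, cancelling the
      \<open>- 1\<close>.\<close>
    also have "\<dots> = MM * (real N * (ln V - 1 + (1 + 2 * SNR) / V) + ln 2)"
      using V by (simp add: MM_def field_simps)
    also have "\<dots> = MM * (real N * ln V + ln 2)"
      using V by (simp add: V_def)
    finally show ?thesis unfolding w_def .
  qed
  have ins: "{1..K} = insert r (insert t R)" using rt by (auto simp: R_def)
  have nR: "r \<notin> R" "t \<notin> R" "finite R" by (auto simp: R_def)
  define Pr where "Pr = (\<Prod>k\<in>{1..K}. real (M k))"
  define PR where "PR = (\<Prod>k\<in>R. real (M k))"
  have Pr: "Pr = MM * PR" unfolding Pr_def PR_def MM_def ins using rt nR by simp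
  have PR: "0 < PR" unfolding PR_def using M by (intro prod_pos) (force simp: R_def)
  have cR: "real (card (PiE R (\<lambda>k. {..<M k}))) = PR"
    unfolding PR_def using nR by (simp add: card_PiE)
  have err: "Pr * err_prob K SNR D N M f g = (\<Sum>v\<in>PiE R (\<lambda>k. {..<M k}). \<Sum>(a, b)\<in>?J. e (v(t := b, r := a)))"
  proof -
    have "Pr * err_prob K SNR D N M f g = (\<Sum>w\<in>PiE {1..K} (\<lambda>k. {..<M k}). e w)"
      unfolding err_prob_eq e_def Pr_def[symmetric] using Pr PR MM by simp
    also have "\<dots> = (\<Sum>v\<in>PiE R (\<lambda>k. {..<M k}). \<Sum>(a, b)\<in>?J. e (v(t := b, r := a)))"
      unfolding ins by (rule sum_PiE_insert_two) (use nR rt in auto)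
    finally show ?thesis .
  qed
  have "Pr * ((1 - 2 * err_prob K SNR D N M f g) * ln MM)
      = ln MM * (\<Sum>v\<in>PiE R (\<lambda>k. {..<M k}). \<Sum>(a, b)\<in>?J. 1 - 2 * e (v(t := b, r := a)))"
  proof -
    have "(\<Sum>v\<in>PiE R (\<lambda>k. {..<M k}). \<Sum>(a, b)\<in>?J. 1 - 2 * e (v(t := b, r := a)))
      = PR * MM - 2 * (Pr * err_prob K SNR D N M f g)"
      unfolding err cR[symmetric] MM_def split_beta'
      by (simp add: sum_subtractf sum_distrib_left[symmetric])
    then show ?thesis by (simp only: Pr) (simp add: algebra_simps)
  qed
  also have "\<dots> = (\<Sum>v\<in>PiE R (\<lambda>k. {..<M k}). ln MM * (\<Sum>(a, b)\<in>?J. 1 - 2 * e (v(t := b, r := a))))"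
    by (rule sum_distrib_left)
  also have "\<dots> \<le> (\<Sum>v\<in>PiE R (\<lambda>k. {..<M k}). MM * (real N * ln V + ln 2))"
    by (intro sum_mono fixed)
  also have "\<dots> = Pr * (real N * ln V + ln 2)" by (simp add: cR Pr)
  finally show ?thesis
    using Pr PR MM unfolding MM_def[symmetric] V_def[symmetric] by (simp add: mult_le_cancel_left_pos)
qed

lemma achievable_pair_le:
  assumes ach: "achievable K SNR D R" and rt: "r \<in> {1..K}" "t \<in> {1..K}" "r \<noteq> t"
  shows "R r + R t \<le> log 2 (1 + 2 * SNR)"
proof -
  define C where "C = (R r + R t) * ln 2"
  have C0: "0 \<le> C" using ach rt by (auto simp: achievable_def C_def)
  have bound: "(1 - 2 * \<epsilon>) * C \<le> ln (1 + 2 * SNR) + \<epsilon>" if \<epsilon>: "0 < \<epsilon>" "\<epsilon> < 1/2" for \<epsilon> :: real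
  proof -
    obtain N0 where N0: "\<And>N. N \<ge> N0 \<Longrightarrow> \<exists>M f g. is_code K SNR D N M f g \<and>
         (\<forall>k\<in>{1..K}. 2 powr (real N * R k) \<le> real (M k)) \<and> err_prob K SNR D N M f g \<le> \<epsilon>"
      using ach \<epsilon> unfolding achievable_def by blast
    \<comment> \<open>Long blocks absorb the additive \<open>ln 2\<close> of the packing bound into
      \<epsilon> per channel use.\<close>
    obtain N1 :: nat where N1: "ln 2 / \<epsilon> < real N1" using reals_Archimedean2 by blast
    define N where "N = max N0 (Suc N1)"
    obtain M f g where code: "is_code K SNR D N M f g"
      and M: "\<And>k. k \<in> {1..K} \<Longrightarrow> 2 powr (real N * R k) \<le> real (M k)"
      and err: "err_prob K SNR D N M f g \<le> \<epsilon>"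
      using N0[of N] by (auto simp: N_def)
    have "ln 2 \<le> \<epsilon> * real N1" using N1 \<epsilon> by (simp add: field_simps)
    also have "\<dots> \<le> \<epsilon> * real N" using \<epsilon> by (intro mult_left_mono) (auto simp: N_def)
    finally have N: "0 < real N" "ln 2 \<le> \<epsilon> * real N" by (auto simp: N_def)
    have Mk: "real N * R k * ln 2 \<le> ln (real (M k))" "0 < real (M k)" if "k \<in> {1..K}" for k
    proof -
      have "0 < 2 powr (real N * R k)" by simp
      also note M[OF that]
      finally show p: "0 < real (M k)" .
      then have "ln (2 powr (real N * R k)) \<le> ln (real (M k))"
        using M[OF that] by (subst ln_le_cancel_iff) auto
      then show "real N * R k * ln 2 \<le> ln (real (M k))" by (simp add: ln_powr)
    qed
    have "real N * C \<le> ln (real (M r * M t))"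
      using Mk[OF rt(1)] Mk[OF rt(2)] by (simp add: C_def ln_mult algebra_simps)
    then have "(1 - 2 * \<epsilon>) * (real N * C) \<le> (1 - 2 * err_prob K SNR D N M f g) * ln (real (M r * M t))"
      using C0 N \<epsilon> err by (intro mult_mono) auto
    also have "\<dots> \<le> real N * ln (1 + 2 * SNR) + ln 2" by (rule two_user_bound[OF code rt])
    also have "\<dots> \<le> real N * (ln (1 + 2 * SNR) + \<epsilon>)" using N by (simp add: algebra_simps)
    finally have "real N * ((1 - 2 * \<epsilon>) * C) \<le> real N * (ln (1 + 2 * SNR) + \<epsilon>)"
      by (simp add: algebra_simps)
    then show ?thesis using N by (simp add: mult_le_cancel_left_pos)
  qed
  have "(1 - 2 * 0) * C \<le> ln (1 + 2 * SNR) + 0"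
  proof (rule tendsto_le)
    show "((\<lambda>\<epsilon>. (1 - 2 * \<epsilon>) * C) \<longlongrightarrow> (1 - 2 * 0) * C) (at_right 0)"
      "((\<lambda>\<epsilon>. ln (1 + 2 * SNR) + \<epsilon>) \<longlongrightarrow> ln (1 + 2 * SNR) + 0) (at_right 0)"
      by (intro tendsto_intros)+
    show "eventually (\<lambda>\<epsilon>. (1 - 2 * \<epsilon>) * C \<le> ln (1 + 2 * SNR) + \<epsilon>) (at_right (0::real))"
      by (rule eventually_mono[OF eventually_at_right_real[of 0 "1/2"]]) (use bound in auto)
  qed simp
  then show ?thesis by (simp add: C_def log_def field_simps)
qed

lemma converse:
  assumes ach: "achievable K SNR D R"
  shows "(\<Sum>k\<in>{1..K}. R k) \<le> real K / 2 * log 2 (1 + 2 * SNR)"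
proof -
  \<comment> \<open>The cyclic successor. It moves every user since \<open>K\<close> is at least 2,
    and each user lies in two of the pairs \<open>(k, \<sigma> k)\<close>.\<close>
  define \<sigma> where "\<sigma> k = (if k = K then 1 else Suc k)" for k
  have b: "bij_betw \<sigma> {1..K} {1..K}"
    by (rule bij_betw_byWitness[where f'="\<lambda>k. if k = 1 then K else k - 1"])
       (use K in \<open>auto simp: \<sigma>_def\<close>)
  have "2 * (\<Sum>k\<in>{1..K}. R k) = (\<Sum>k\<in>{1..K}. R k) + (\<Sum>k\<in>{1..K}. R (\<sigma> k))"
    using sum.reindex_bij_betw[OF b, of R] by simp
  also have "\<dots> = (\<Sum>k\<in>{1..K}. R k + R (\<sigma> k))" by (simp add: sum.distrib)
  also have "\<dots> \<le> (\<Sum>k\<in>{1..K}. log 2 (1 + 2 * SNR))"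
    by (intro sum_mono achievable_pair_le[OF ach]) (use K in \<open>auto simp: \<sigma>_def\<close>)
  finally show ?thesis by simp
qed

end

section \<open>Information density\<close>

text \<open>Information density of the channel \<open>Y = b C + W\<close> with \<open>C \<sim> CN(0,1)\<close> and
  \<open>W \<sim> CN(0,2)\<close>.\<close>
definition iden :: "real \<Rightarrow> complex \<Rightarrow> complex \<Rightarrow> real" where
  "iden b y c = ln (1 + b\<^sup>2 / 2) - (cmod (y - of_real b * c))\<^sup>2 / 2 + (cmod y)\<^sup>2 / (b\<^sup>2 + 2)"

lemma iden_measurable [measurable]:
  assumes [measurable]: "y \<in> borel_measurable M" "c \<in> borel_measurable M"
  shows "(\<lambda>x. iden b (y x) (c x)) \<in> borel_measurable M"
  unfolding iden_def by measurable

text \<open>The exponential is the density of the output given \<open>c\<close> over its marginal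
  density, so it averages to one over the input for every fixed output. Multiplied by the prior it
  is the posterior density of the input, again a Gaussian, which the proof finds by completing the
  square.\<close>

lemma nn_integral_exp_iden: "(\<integral>\<^sup>+c. ennreal (exp (iden b y c)) \<partial>cgauss) = 1"
proof -
  \<comment> \<open>\<open>\<beta> * y\<close> and \<open>v\<close> are the posterior mean and
    variance of the input.\<close>
  define \<beta> where "\<beta> = b / (2 + b\<^sup>2)"
  define v where "v = 2 / (2 + b\<^sup>2)"
  have b2: "0 < 2 + b\<^sup>2" by (rule add_pos_nonneg) auto
  have v: "0 < v" using b2 by (simp add: v_def)
  have sq: "- (cmod c)\<^sup>2 + (- (cmod (y - of_real b * c))\<^sup>2 / 2 + (cmod y)\<^sup>2 / (b\<^sup>2 + 2))
      = - (cmod (c - of_real \<beta> * y))\<^sup>2 / v" for c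
  proof -
    have vv: "1 / v = 1 + b\<^sup>2 / 2" "\<beta> / v = b / 2" "\<beta>\<^sup>2 / v = 1 / 2 - 1 / (b\<^sup>2 + 2)"
    proof -
      define d where "d = 2 + b\<^sup>2"
      have d: "0 < d" "b\<^sup>2 = d - 2" "\<beta> = b / d" "v = 2 / d" using b2 by (auto simp: d_def \<beta>_def v_def)
      show "1 / v = 1 + b\<^sup>2 / 2" using d(1) unfolding d(4) d(2) by (simp add: field_simps)
      show "\<beta> / v = b / 2" using d(1) unfolding d(3,4) by simp
      have "\<beta>\<^sup>2 / v = b\<^sup>2 / (2 * d)" using d(1) unfolding d(3,4) by (simp add: power_divide power2_eq_square)
      also have "\<dots> = 1 / 2 - 1 / (b\<^sup>2 + 2)" using d(1) unfolding d(2) by (simp add: field_simps)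
      finally show "\<beta>\<^sup>2 / v = 1 / 2 - 1 / (b\<^sup>2 + 2)" .
    qed
    have e1: "(cmod (y - of_real b * c))\<^sup>2 = (cmod y)\<^sup>2 + b\<^sup>2 * (cmod c)\<^sup>2 - 2 * b * Re (c * cnj y)"
      unfolding cmod_power2 by (simp add: power2_eq_square algebra_simps)
    have e2: "(cmod (c - of_real \<beta> * y))\<^sup>2 = (cmod c)\<^sup>2 + \<beta>\<^sup>2 * (cmod y)\<^sup>2 - 2 * \<beta> * Re (c * cnj y)"
      unfolding cmod_power2 by (simp add: power2_eq_square algebra_simps)
    have "(cmod (c - of_real \<beta> * y))\<^sup>2 / v = (cmod c)\<^sup>2 * (1 / v) + (\<beta>\<^sup>2 / v) * (cmod y)\<^sup>2 - 2 * (\<beta> / v) * Re (c * cnj y)"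
      unfolding e2 by (simp add: add_divide_distrib diff_divide_distrib)
    also have "\<dots> = (cmod c)\<^sup>2 + (cmod (y - of_real b * c))\<^sup>2 / 2 - (cmod y)\<^sup>2 / (b\<^sup>2 + 2)"
      unfolding vv e1 by (simp add: algebra_simps add_divide_distrib diff_divide_distrib)
    finally show ?thesis by simp
  qed
  have "cnormal_density 0 1 c * exp (iden b y c) = cnormal_density (of_real \<beta> * y) v c" for c
  proof -
    define z where "z = - (cmod (y - of_real b * c))\<^sup>2 / 2 + (cmod y)\<^sup>2 / (b\<^sup>2 + 2)"
    have "0 < 1 + b\<^sup>2 / 2" using b2 by simp
    moreover have "iden b y c = ln (1 + b\<^sup>2 / 2) + z" by (simp add: iden_def z_def)
    ultimately have "exp (iden b y c) = (1 + b\<^sup>2 / 2) * exp z" by (simp add: exp_add)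
    then have "cnormal_density 0 1 c * exp (iden b y c) = (1 + b\<^sup>2 / 2) / pi
      * exp (- (cmod c)\<^sup>2 + (- (cmod (y - of_real b * c))\<^sup>2 / 2 + (cmod y)\<^sup>2 / (b\<^sup>2 + 2)))"
      unfolding z_def[symmetric] exp_add by (simp add: cnormal_density_def mult_ac)
    also have "\<dots> = (1 + b\<^sup>2 / 2) / pi * exp (- (cmod (c - of_real \<beta> * y))\<^sup>2 / v)" unfolding sq ..
    also have "(1 + b\<^sup>2 / 2) / pi = 1 / (pi * v)" using b2 by (simp add: v_def field_simps)
    finally show ?thesis by (simp add: cnormal_density_def)
  qed
  then have "(\<integral>\<^sup>+c. ennreal (exp (iden b y c)) \<partial>cgauss) = (\<integral>\<^sup>+c. ennreal (cnormal_density (of_real \<beta> * y) v c) \<partial>lborel)"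
    unfolding cgauss_eq by (subst nn_integral_density)
      (auto simp: ennreal_mult[symmetric] cnormal_density_nonneg)
  also have "\<dots> = 1" by (rule nn_integral_cnormal_density[OF v])
  finally show ?thesis .
qed

text \<open>The mixed term is split by 2|v||e| \<le> \<tau>|v|^2 + |e|^2/\<tau>. A relative loss
  \<tau> on the main term is traded for a factor 1/\<tau> on the perturbation, harmless when its
  energy is of order \<tau>^2.\<close>

lemma cmod2_add_le:
  assumes "0 < \<tau>"
  shows "(cmod (v + e))\<^sup>2 \<le> (1 + \<tau>) * (cmod v)\<^sup>2 + (1 + 1 / \<tau>) * (cmod e)\<^sup>2"
proof -
  have "(cmod (v + e))\<^sup>2 \<le> (cmod v + cmod e)\<^sup>2"
    by (intro power_mono norm_triangle_ineq) auto
  also have "\<dots> \<le> (1 + \<tau>) * (cmod v)\<^sup>2 + (1 + 1 / \<tau>) * (cmod e)\<^sup>2"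
  proof -
    have "0 \<le> (\<tau> * cmod v - cmod e)\<^sup>2 / \<tau>" using assms by simp
    also have "\<dots> = \<tau> * (cmod v)\<^sup>2 + (cmod e)\<^sup>2 / \<tau> - 2 * (cmod v * cmod e)"
      using assms by (simp add: power2_diff power_mult_distrib add_divide_distrib diff_divide_distrib) (simp add: power2_eq_square)
    finally show ?thesis by (simp add: power2_sum algebra_simps)
  qed
  finally show ?thesis .
qed

lemma cmod2_add_ge:
  assumes \<tau>: "0 < \<tau>"
  shows "(1 - \<tau>) * (cmod x)\<^sup>2 - (cmod e)\<^sup>2 / \<tau> \<le> (cmod (x + e))\<^sup>2"
proof -
  have "cmod x - cmod e \<le> cmod (x + e)" "cmod e - cmod x \<le> cmod (x + e)"
    using norm_diff_triangle_ineq norm_triangle_ineq2[of x "-e"] norm_triangle_ineq2[of e "-x"]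
    by (auto simp: add.commute)
  then have "\<bar>cmod x - cmod e\<bar>\<^sup>2 \<le> (cmod (x + e))\<^sup>2" by (intro power_mono) auto
  moreover have "(1 - \<tau>) * (cmod x)\<^sup>2 - (cmod e)\<^sup>2 / \<tau> \<le> \<bar>cmod x - cmod e\<bar>\<^sup>2"
  proof -
    have "0 \<le> (\<tau> * cmod x - cmod e)\<^sup>2 / \<tau>" using \<tau> by simp
    also have "\<dots> = \<tau> * (cmod x)\<^sup>2 + (cmod e)\<^sup>2 / \<tau> - 2 * (cmod x * cmod e)"
      using \<tau> by (simp add: power2_diff power_mult_distrib add_divide_distrib diff_divide_distrib) (simp add: power2_eq_square)
    finally have "2 * (cmod x * cmod e) \<le> \<tau> * (cmod x)\<^sup>2 + (cmod e)\<^sup>2 / \<tau>" by simp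
    then show ?thesis by (simp add: power2_diff algebra_simps) (rule add_increasing; simp)
  qed
  ultimately show ?thesis by simp
qed

text \<open>\<open>c\<close> is the codeword, \<open>v\<close> the noise and \<open>e\<close> the residual interference.\<close>
lemma sum_iden_lower_bound:
  fixes c v e :: "nat \<Rightarrow> complex"
  assumes \<tau>: "0 < \<tau>" "\<tau> < 1" and b: "0 \<le> b"
    and v: "\<bar>\<Sum>i<p. (cmod (v i))\<^sup>2 - 2\<bar> \<le> \<tau> * real p"
    and c: "\<bar>\<Sum>i<p. (cmod (c i))\<^sup>2 - 1\<bar> \<le> \<tau> * real p"
    and x: "\<bar>\<Sum>i<p. Re (cnj (v i) * c i)\<bar> \<le> \<tau> * real p"
    and e: "(\<Sum>i<p. (cmod (e i))\<^sup>2) \<le> \<tau>\<^sup>2 * real p"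
  shows "real p * (ln (1 + b\<^sup>2 / 2) - 6 * \<tau>) \<le> (\<Sum>i<p. iden b (of_real b * c i + e i + v i) (c i))"
proof -
  define p' where "p' = real p"
  have p0: "0 \<le> p'" by (simp add: p'_def)
  define V where "V = (\<Sum>i<p. (cmod (v i))\<^sup>2)"
  define C where "C = (\<Sum>i<p. (cmod (c i))\<^sup>2)"
  define X where "X = (\<Sum>i<p. Re (cnj (v i) * c i))"
  define E where "E = (\<Sum>i<p. (cmod (e i))\<^sup>2)"
  have V: "(2 - \<tau>) * p' \<le> V" "V \<le> (2 + \<tau>) * p'"
    using v by (auto simp: V_def p'_def sum_subtractf algebra_simps abs_le_iff)
  have C: "(1 - \<tau>) * p' \<le> C" using c by (auto simp: C_def p'_def sum_subtractf algebra_simps abs_le_iff)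
  have X: "- (\<tau> * p') \<le> X" using x by (auto simp: X_def p'_def abs_le_iff)
  have E: "E \<le> \<tau>\<^sup>2 * p'" "0 \<le> E" using e by (auto simp: E_def p'_def intro: sum_nonneg)
  have E1: "E / \<tau> \<le> \<tau> * p'" using E \<tau> by (simp add: field_simps power2_eq_square)
  \<comment> \<open>Noise and residual interference together have energy 2 per symbol up to order
    \<tau>; \<open>\<tau> < 1\<close> turns 4\<tau> + 2\<tau>^2 into 6\<tau>.\<close>
  have W: "(\<Sum>i<p. (cmod (e i + v i))\<^sup>2) \<le> p' * (2 + 6 * \<tau>)"
  proof -
    have "(\<Sum>i<p. (cmod (e i + v i))\<^sup>2) \<le> (\<Sum>i<p. (1 + \<tau>) * (cmod (v i))\<^sup>2 + (1 + 1 / \<tau>) * (cmod (e i))\<^sup>2)"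
      using cmod2_add_le[OF \<tau>(1)] by (intro sum_mono) (metis add.commute)
    also have "\<dots> = (1 + \<tau>) * V + E + E / \<tau>"
      by (simp add: V_def E_def sum.distrib sum_distrib_left[symmetric] sum_divide_distrib[symmetric] algebra_simps)
    also have "\<dots> \<le> (1 + \<tau>) * ((2 + \<tau>) * p') + \<tau>\<^sup>2 * p' + \<tau> * p'"
      using V E E1 \<tau> by (intro add_mono mult_left_mono) auto
    also have "\<dots> = p' * (2 + 4 * \<tau> + 2 * \<tau>\<^sup>2)" by (simp add: power2_eq_square algebra_simps)
    also have "\<dots> \<le> p' * (2 + 6 * \<tau>)"
      using \<tau> p0 by (intro mult_left_mono) (auto simp: power2_eq_square)
    finally show ?thesis .
  qed
  have Y: "p' * (1 - 3 * \<tau>) * (b\<^sup>2 + 2) \<le> (\<Sum>i<p. (cmod (of_real b * c i + e i + v i))\<^sup>2)"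
  proof -
    \<comment> \<open>Errors that grow with \<open>b\<close> are measured against the mean output
      energy \<open>b\<^sup>2 + 2\<close>. This makes the final loss 6\<tau> uniform in
      \<open>b\<close>.\<close>
    have "(b + 1)\<^sup>2 + 1 \<le> 2 * (b\<^sup>2 + 2)" using zero_le_power2[of "b - 1"] by (simp add: power2_eq_square algebra_simps)
    then have "\<tau> * ((b + 1)\<^sup>2 + 1) \<le> \<tau> * (2 * (b\<^sup>2 + 2))" using \<tau> by (intro mult_left_mono) auto
    then have "p' * (1 - 3 * \<tau>) * (b\<^sup>2 + 2) \<le> p' * ((b\<^sup>2 + 2) - \<tau> * (b + 1)\<^sup>2 - \<tau> * (b\<^sup>2 + 2) - \<tau>)"
      unfolding mult.assoc using p0 by (intro mult_left_mono) (auto simp: algebra_simps)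
    also have "\<dots> \<le> (1 - \<tau>) * (p' * (b\<^sup>2 + 2 - \<tau> * (b + 1)\<^sup>2)) - \<tau> * p'"
    proof -
      have "0 \<le> p' * (\<tau> * (\<tau> * (b + 1)\<^sup>2))" using p0 \<tau> by simp
      then show ?thesis by (simp add: algebra_simps)
    qed
    also have "\<dots> \<le> (1 - \<tau>) * (b\<^sup>2 * C + 2 * b * X + V) - E / \<tau>"
    proof (intro diff_mono mult_left_mono E1)
      have "b\<^sup>2 * ((1 - \<tau>) * p') + 2 * b * (- (\<tau> * p')) + (2 - \<tau>) * p' \<le> b\<^sup>2 * C + 2 * b * X + V"
        using C X V b by (intro add_mono mult_left_mono) auto
      then show "p' * (b\<^sup>2 + 2 - \<tau> * (b + 1)\<^sup>2) \<le> b\<^sup>2 * C + 2 * b * X + V"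
        by (simp add: power2_eq_square algebra_simps)
    qed (use \<tau> in auto)
    also have "\<dots> = (\<Sum>i<p. (1 - \<tau>) * (cmod (of_real b * c i + v i))\<^sup>2 - (cmod (e i))\<^sup>2 / \<tau>)"
    proof -
      have "(cmod (of_real b * c i + v i))\<^sup>2 = b\<^sup>2 * (cmod (c i))\<^sup>2 + 2 * b * Re (cnj (v i) * c i) + (cmod (v i))\<^sup>2" for i
        unfolding cmod_power2 by (simp add: power2_eq_square algebra_simps)
      then have "(\<Sum>i<p. (cmod (of_real b * c i + v i))\<^sup>2) = b\<^sup>2 * C + 2 * b * X + V"
        by (simp only: sum.distrib C_def X_def V_def sum_distrib_left)
      then show ?thesis
        by (simp only: sum_subtractf sum_distrib_left[symmetric] sum_divide_distrib[symmetric] E_def)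
    qed
    also have "\<dots> \<le> (\<Sum>i<p. (cmod (of_real b * c i + e i + v i))\<^sup>2)"
      by (intro sum_mono) (metis cmod2_add_ge[OF \<tau>(1)] add.assoc add.commute)
    finally show ?thesis .
  qed
  have b2: "0 < b\<^sup>2 + 2" by (rule add_nonneg_pos) auto
  have "(\<Sum>i<p. iden b (of_real b * c i + e i + v i) (c i)) = p' * ln (1 + b\<^sup>2 / 2)
      - (\<Sum>i<p. (cmod (e i + v i))\<^sup>2) / 2 + (\<Sum>i<p. (cmod (of_real b * c i + e i + v i))\<^sup>2) / (b\<^sup>2 + 2)"
    by (simp add: iden_def sum.distrib sum_subtractf sum_divide_distrib p'_def algebra_simps)
  also have "\<dots> \<ge> p' * ln (1 + b\<^sup>2 / 2) - p' * (2 + 6 * \<tau>) / 2 + p' * (1 - 3 * \<tau>) * (b\<^sup>2 + 2) / (b\<^sup>2 + 2)"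
    using W Y b2 by (intro add_mono diff_mono divide_right_mono) auto
  \<comment> \<open>The two energy terms contribute -(1 + 3\<tau>) and 1 - 3\<tau> per symbol: the
    constants cancel and the errors add up to 6\<tau>.\<close>
  also have "p' * ln (1 + b\<^sup>2 / 2) - p' * (2 + 6 * \<tau>) / 2 + p' * (1 - 3 * \<tau>) * (b\<^sup>2 + 2) / (b\<^sup>2 + 2)
      = p' * (ln (1 + b\<^sup>2 / 2) - 6 * \<tau>)"
    using b2 by (subst nonzero_mult_div_cancel_right) (auto simp: field_simps)
  finally show ?thesis by (simp add: p'_def)
qed

section \<open>Random Gaussian codebooks\<close>

text \<open>The variances of the energy of one noise value and of the sum of two independent ones.
  They enter the error bounds as constants only and are kept as integrals.\<close>

definition cmod2_var :: real where
  "cmod2_var = (\<integral>z. ((cmod z)\<^sup>2 - 1)\<^sup>2 \<partial>cgauss)"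

definition cmod2_sum_var :: real where
  "cmod2_sum_var = (\<integral>x. ((cmod (fst x + snd x))\<^sup>2 - 2)\<^sup>2 \<partial>(cgauss \<Otimes>\<^sub>M cgauss))"

lemma cmod2_var_nonneg: "0 \<le> cmod2_var" and cmod2_sum_var_nonneg: "0 \<le> cmod2_sum_var"
  unfolding cmod2_var_def cmod2_sum_var_def by (intro integral_nonneg_AE; simp)+

lemma cmod2_deviation:
  assumes J: "finite J" "J \<subseteq> I" and a: "0 < a"
  shows "measure (PiM I (\<lambda>_. cgauss)) {x \<in> space (PiM I (\<lambda>_. cgauss)). a \<le> \<bar>\<Sum>j\<in>J. (cmod (x j))\<^sup>2 - 1\<bar>}
    \<le> real (card J) * cmod2_var / a\<^sup>2"
proof -
  have "integrable cgauss (\<lambda>z. ((cmod z)\<^sup>2)\<^sup>2 - 2 * (cmod z)\<^sup>2 + 1)"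
    using has_bochner_integral_cgauss_cmod2
    by (intro Bochner_Integration.integrable_add Bochner_Integration.integrable_diff integrable_cgauss_cmod4 integrable_mult_right)
       (auto simp: has_bochner_integral_iff)
  then have sq: "integrable cgauss (\<lambda>z. ((cmod z)\<^sup>2 - 1)\<^sup>2)"
    by (simp add: power2_diff algebra_simps)
  have "measure (PiM I (\<lambda>_. cgauss)) {x \<in> space (PiM I (\<lambda>_. cgauss)). a \<le> \<bar>\<Sum>j\<in>J. (cmod (x j))\<^sup>2 - 1\<bar>}
    \<le> (\<Sum>j\<in>J. cmod2_var) / a\<^sup>2"
    using has_bochner_integral_cgauss_cmod2
    by (intro PiM_Chebyshev[OF prob_space_cgauss J _ _ sq _ a])
       (auto simp: cmod2_var_def has_bochner_integral_iff cgauss.prob_space[simplified])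
  then show ?thesis by simp
qed

text \<open>The sum of two independent noise values has mean energy 2. Its fourth moment, bounded by
  those of the summands, makes the variance finite, and disjoint pairs of coordinates are
  independent.\<close>

lemma cmod2_sum_deviation:
  assumes J: "finite J" and ab: "inj_on a J" "inj_on b J" "a ` J \<subseteq> I" "b ` J \<subseteq> I" "a ` J \<inter> b ` J = {}"
    and c: "0 < c"
  shows "measure (PiM I (\<lambda>_. cgauss)) {x \<in> space (PiM I (\<lambda>_. cgauss)). c \<le> \<bar>\<Sum>j\<in>J. (cmod (x (a j) + x (b j)))\<^sup>2 - 2\<bar>}
    \<le> real (card J) * cmod2_sum_var / c\<^sup>2"
proof -
  let ?G = "cgauss \<Otimes>\<^sub>M cgauss"
  interpret GG: pair_prob_space cgauss cgauss ..
  let ?h = "\<lambda>x. (cmod (fst x + snd x))\<^sup>2 - 2"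
  have cst: "integrable ?G (\<lambda>_. c)" for c :: real by simp
  have F: "integrable ?G (\<lambda>x. f (fst x))" "integrable ?G (\<lambda>x. f (snd x))" if "integrable cgauss f" for f :: "complex \<Rightarrow> real"
  proof -
    have "integrable (distr ?G cgauss fst) f" using that by (simp add: cgauss.distr_pair_fst)
    then show 1: "integrable ?G (\<lambda>x. f (fst x))" using that by (subst (asm) integrable_distr_eq) auto
    show "integrable ?G (\<lambda>x. f (snd x))"
      using GG.integrable_product_swap[OF 1] by (simp add: split_beta')
  qed
  have 4: "((cmod (x + y))\<^sup>2)\<^sup>2 \<le> 8 * ((cmod x)\<^sup>2)\<^sup>2 + 8 * ((cmod y)\<^sup>2)\<^sup>2" for x y
  proof -
    have "(cmod (x + y))\<^sup>2 \<le> 2 * (cmod x)\<^sup>2 + 2 * (cmod y)\<^sup>2"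
      using cmod2_add_le[of 1 x y] by simp
    then have "((cmod (x + y))\<^sup>2)\<^sup>2 \<le> (2 * (cmod x)\<^sup>2 + 2 * (cmod y)\<^sup>2)\<^sup>2" by (intro power_mono) auto
    also have "\<dots> \<le> 8 * ((cmod x)\<^sup>2)\<^sup>2 + 8 * ((cmod y)\<^sup>2)\<^sup>2"
      using zero_le_power2[of "2 * (cmod x)\<^sup>2 - 2 * (cmod y)\<^sup>2"] by (simp add: power2_sum power2_diff power_mult_distrib)
    finally show ?thesis .
  qed
  have hb: "(?h x)\<^sup>2 \<le> 16 * ((cmod (fst x))\<^sup>2)\<^sup>2 + 16 * ((cmod (snd x))\<^sup>2)\<^sup>2 + 8" for x :: "complex \<times> complex"
  proof -
    have "(s - 2)\<^sup>2 \<le> 2 * s\<^sup>2 + 8" for s :: real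
      using zero_le_power2[of "s + 2"] by (simp add: power2_eq_square algebra_simps)
    from this[of "(cmod (fst x + snd x))\<^sup>2"] show ?thesis using 4[of "fst x" "snd x"] by simp
  qed
  have hm [measurable]: "?h \<in> borel_measurable ?G"
    by (intro borel_measurable_diff borel_measurable_power borel_measurable_norm borel_measurable_add) measurable
  have sq: "integrable ?G (\<lambda>x. (?h x)\<^sup>2)"
  proof (rule Bochner_Integration.integrable_bound)
    show "integrable ?G (\<lambda>x. 16 * ((cmod (fst x))\<^sup>2)\<^sup>2 + 16 * ((cmod (snd x))\<^sup>2)\<^sup>2 + 8)"
      using F[OF integrable_cgauss_cmod4]
      by (intro Bochner_Integration.integrable_add integrable_mult_right cst) auto
    show "AE x in ?G. norm ((?h x)\<^sup>2) \<le> norm (16 * ((cmod (fst x))\<^sup>2)\<^sup>2 + 16 * ((cmod (snd x))\<^sup>2)\<^sup>2 + 8)"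
      using hb by (intro AE_I2) (simp add: abs_of_nonneg)
  qed measurable
  have hi: "integrable ?G ?h" using GG.square_integrable_imp_integrable[OF hm sq] .
  have "(\<integral>x. ?h x \<partial>?G) = (\<integral>x. (\<integral>y. ?h (x, y) \<partial>cgauss) \<partial>cgauss)"
    using hi by (subst GG.integral_fst'[symmetric]) auto
  also have "\<dots> = (\<integral>x. (cmod x)\<^sup>2 + 1 - 2 \<partial>cgauss)"
  proof (rule Bochner_Integration.integral_cong[OF refl])
    fix x
    have "has_bochner_integral cgauss (\<lambda>y. (cmod (x + y))\<^sup>2 - 2) ((cmod x)\<^sup>2 + 1 - 2)"
      using cgauss.prob_space
      by (intro has_bochner_integral_diff has_bochner_integral_cgauss_shift_cmod2) (auto simp: has_bochner_integral_iff)
    then show "(\<integral>y. ?h (x, y) \<partial>cgauss) = (cmod x)\<^sup>2 + 1 - 2" by (simp add: has_bochner_integral_iff)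
  qed
  also have "\<dots> = 0"
  proof -
    have "has_bochner_integral cgauss (\<lambda>x. (cmod x)\<^sup>2 - 1) (1 - 1)"
      using cgauss.prob_space
      by (intro has_bochner_integral_diff has_bochner_integral_cgauss_cmod2) (auto simp: has_bochner_integral_iff)
    then show ?thesis by (simp add: has_bochner_integral_iff)
  qed
  finally have mean: "(\<integral>x. ?h x \<partial>?G) = 0" .
  show ?thesis
    using PiM_Chebyshev_pairs[OF prob_space_cgauss J ab hm mean sq c] unfolding cmod2_sum_var_def by simp
qed

text \<open>Controls the correlation of a random codeword with a fixed noise vector
  \<open>u\<close>, the mixed term in the output energy.\<close>

lemma linear_deviation:
  assumes J: "finite J" "J \<subseteq> I" and a: "0 < a"
  shows "measure (PiM I (\<lambda>_. cgauss)) {x \<in> space (PiM I (\<lambda>_. cgauss)). a \<le> \<bar>\<Sum>j\<in>J. Re (u j * x j)\<bar>}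
    \<le> (\<Sum>j\<in>J. (cmod (u j))\<^sup>2) / a\<^sup>2"
proof (rule PiM_Chebyshev[OF prob_space_cgauss J _ _ _ _ a])
  fix j
  show "(\<integral>z. Re (u j * z) \<partial>cgauss) = 0"
    by (rule has_bochner_integral_integral_eq[OF has_bochner_integral_cgauss_linear])
  have le: "(Re (u j * z))\<^sup>2 \<le> (cmod (u j))\<^sup>2 * (cmod z)\<^sup>2" for z
    using power_mono[OF abs_Re_le_cmod[of "u j * z"], of 2] by (simp add: norm_mult power_mult_distrib)
  have b: "has_bochner_integral cgauss (\<lambda>z. (cmod (u j))\<^sup>2 * (cmod z)\<^sup>2) ((cmod (u j))\<^sup>2 * 1)"
    by (intro has_bochner_integral_mult_right has_bochner_integral_cgauss_cmod2)
  show i: "integrable cgauss (\<lambda>z. (Re (u j * z))\<^sup>2)"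
    by (rule Bochner_Integration.integrable_bound[OF has_bochner_integral_iff[THEN iffD1, OF b, THEN conjunct1]])
       (use le in auto)
  have "(\<integral>z. (Re (u j * z))\<^sup>2 \<partial>cgauss) \<le> (\<integral>z. (cmod (u j))\<^sup>2 * (cmod z)\<^sup>2 \<partial>cgauss)"
    using i b le by (intro integral_mono) (auto simp: has_bochner_integral_iff)
  also have "\<dots> = (cmod (u j))\<^sup>2"
    using has_bochner_integral_integral_eq[OF b] by (simp only: mult_1_right)
  finally show "(\<integral>z. (Re (u j * z))\<^sup>2 \<partial>cgauss) \<le> (cmod (u j))\<^sup>2" .
qed auto

definition decode_fail :: "real \<Rightarrow> nat \<Rightarrow> nat \<Rightarrow> real \<Rightarrow> nat \<Rightarrow> nat \<Rightarrow> (nat \<Rightarrow> complex)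
    \<Rightarrow> (nat \<times> nat \<times> nat \<Rightarrow> complex) \<Rightarrow> bool" where
  "decode_fail b p M \<gamma> k m0 Y C \<longleftrightarrow> (\<Sum>i<p. iden b (Y i) (C (k, m0, i))) < \<gamma> \<or>
     (\<exists>m<M. m \<noteq> m0 \<and> \<gamma> \<le> (\<Sum>i<p. iden b (Y i) (C (k, m, i))))"

text \<open>Coordinate \<open>(t, m, i)\<close> is symbol \<open>i\<close> of codeword
  \<open>m\<close> of user \<open>t\<close>.\<close>

definition codebooks :: "nat \<Rightarrow> nat \<Rightarrow> nat \<Rightarrow> (nat \<times> nat \<times> nat \<Rightarrow> complex) measure" where
  "codebooks K M p = PiM ({1..K} \<times> {..<M} \<times> {..<p}) (\<lambda>_. cgauss)"

lemma prob_space_codebooks: "prob_space (codebooks K M p)"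
  unfolding codebooks_def by (intro prob_space_PiM prob_space_cgauss)

lemma measurable_codebook_entry:
  assumes "t \<in> {1..K}" "m < M" "i < p"
  shows "(\<lambda>C. C (t, m, i)) \<in> borel_measurable (codebooks K M p)"
proof -
  have "(\<lambda>C. C (t, m, i)) \<in> measurable (codebooks K M p) cgauss"
    unfolding codebooks_def using assms by (intro measurable_component_singleton) auto
  then show ?thesis by (simp cong: measurable_cong_sets)
qed

lemma merge_eq_outside: "z \<notin> B \<Longrightarrow> merge A B (x, y) z = merge A B (x, y') z"
  by (simp add: merge_def)

text \<open>Hypothesis \<open>indep\<close> expresses that the output does not involve codeword
  \<open>m\<close> of user \<open>k\<close>. Integrating over that codeword first,
  \<open>nn_integral_exp_iden\<close> gives mean one to the exponential of the information density,
  and Markov's inequality yields the bound.\<close>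

lemma wrong_codeword_bound:
  assumes k: "k \<in> {1..K}" and m: "m < M"
    and Y: "\<And>i. i < p \<Longrightarrow> (\<lambda>C. Y C i) \<in> borel_measurable (codebooks K M p)"
    and indep: "\<And>C C' i. (\<And>t l i. (t, l) \<noteq> (k, m) \<Longrightarrow> C (t, l, i) = C' (t, l, i)) \<Longrightarrow> Y C i = Y C' i"
  shows "measure (codebooks K M p) {C \<in> space (codebooks K M p). \<gamma> \<le> (\<Sum>i<p. iden b (Y C i) (C (k, m, i)))} \<le> exp (- \<gamma>)"
proof -
  interpret CB: prob_space "codebooks K M p" by (rule prob_space_codebooks)
  interpret G: product_sigma_finite "\<lambda>_::nat \<times> nat \<times> nat. cgauss" by standard
  let ?I = "{1..K} \<times> {..<M} \<times> {..<p}" and ?J = "{k} \<times> {m} \<times> {..<p}"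
  let ?E = "\<lambda>C. \<Sum>i<p. iden b (Y C i) (C (k, m, i))"
  have E: "?E \<in> borel_measurable (codebooks K M p)"
    using k m Y by (intro borel_measurable_sum iden_measurable measurable_codebook_entry) auto
  have I: "?I = (?I - ?J) \<union> ?J" using k m by auto
  have eq: "codebooks K M p = PiM ((?I - ?J) \<union> ?J) (\<lambda>_. cgauss)"
    unfolding codebooks_def using I by simp
  have "(\<lambda>C. ennreal (exp (?E C))) \<in> borel_measurable (codebooks K M p)"
    by (rule measurable_compose[OF measurable_compose[OF E borel_measurable_exp] measurable_ennreal])
  then have Em: "(\<lambda>C. ennreal (exp (?E C))) \<in> borel_measurable (PiM ((?I - ?J) \<union> ?J) (\<lambda>_. cgauss))"
    unfolding eq .
  have "(\<integral>\<^sup>+C. ennreal (exp (?E C)) \<partial>codebooks K M p)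
      = (\<integral>\<^sup>+x. \<integral>\<^sup>+y. ennreal (exp (?E (merge (?I - ?J) ?J (x, y)))) \<partial>PiM ?J (\<lambda>_. cgauss) \<partial>PiM (?I - ?J) (\<lambda>_. cgauss))"
    unfolding eq by (rule G.product_nn_integral_fold[OF _ _ _ Em]) auto
  also have "\<dots> = (\<integral>\<^sup>+x. 1 \<partial>PiM (?I - ?J) (\<lambda>_. cgauss))"
  proof (rule nn_integral_cong)
    fix x assume "x \<in> space (PiM (?I - ?J) (\<lambda>_. cgauss))"
    \<comment> \<open>By \<open>indep\<close> the output may be computed with zeros in place of the
      codeword that is integrated out.\<close>
    define y0 where "y0 = Y (merge (?I - ?J) ?J (x, \<lambda>_. 0))"
    have y0: "Y (merge (?I - ?J) ?J (x, y)) i = y0 i" for y i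
      unfolding y0_def
    proof (rule indep)
      fix t l i assume "(t, l) \<noteq> (k, m)"
      then have "(t, l, i) \<notin> ?J" by auto
      then show "merge (?I - ?J) ?J (x, y) (t, l, i) = merge (?I - ?J) ?J (x, \<lambda>_. 0) (t, l, i)"
        by (rule merge_eq_outside)
    qed
    have "(\<integral>\<^sup>+y. ennreal (exp (?E (merge (?I - ?J) ?J (x, y)))) \<partial>PiM ?J (\<lambda>_. cgauss))
        = (\<integral>\<^sup>+y. (\<Prod>j\<in>?J. ennreal (exp (iden b (y0 (snd (snd j))) (y j)))) \<partial>PiM ?J (\<lambda>_. cgauss))"
    proof (rule nn_integral_cong)
      fix y
      have bij: "bij_betw (\<lambda>i. (k, m, i)) {..<p} ?J" by (auto simp: bij_betw_def inj_on_def)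
      have "?E (merge (?I - ?J) ?J (x, y)) = (\<Sum>i<p. iden b (y0 i) (y (k, m, i)))"
        unfolding y0 by (rule sum.cong) (auto simp: merge_def)
      also have "\<dots> = (\<Sum>j\<in>?J. iden b (y0 (snd (snd j))) (y j))"
        by (subst sum.reindex_bij_betw[OF bij, symmetric]) simp
      finally show "ennreal (exp (?E (merge (?I - ?J) ?J (x, y)))) = (\<Prod>j\<in>?J. ennreal (exp (iden b (y0 (snd (snd j))) (y j))))"
        by (simp add: exp_sum prod_ennreal)
    qed
    also have "\<dots> = (\<Prod>j\<in>?J. \<integral>\<^sup>+c. ennreal (exp (iden b (y0 (snd (snd j))) c)) \<partial>cgauss)"
    proof -
      have "(\<lambda>c. ennreal (exp (iden b y c))) \<in> borel_measurable cgauss" for y by measurable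
      then show ?thesis by (intro G.product_nn_integral_prod) simp_all
    qed
    also have "\<dots> = 1" by (simp add: nn_integral_exp_iden)
    finally show "(\<integral>\<^sup>+y. ennreal (exp (?E (merge (?I - ?J) ?J (x, y)))) \<partial>PiM ?J (\<lambda>_. cgauss)) = 1" .
  qed
  also have "\<dots> = 1"
    using prob_space.emeasure_space_1[OF prob_space_PiM[OF prob_space_cgauss]] by simp
  finally have one: "(\<integral>\<^sup>+C. ennreal (exp (?E C)) \<partial>codebooks K M p) = 1" .
  have "emeasure (codebooks K M p) {C \<in> space (codebooks K M p). \<gamma> \<le> ?E C}
      = (\<integral>\<^sup>+C. indicator {C \<in> space (codebooks K M p). \<gamma> \<le> ?E C} C \<partial>codebooks K M p)"
    using borel_measurable_le[OF borel_measurable_const E] by simp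
  also have "\<dots> \<le> (\<integral>\<^sup>+C. ennreal (exp (- \<gamma>)) * ennreal (exp (?E C)) \<partial>codebooks K M p)"
    by (intro nn_integral_mono) (auto simp: indicator_def ennreal_mult[symmetric] exp_add[symmetric] ennreal_ge_1)
  also have "\<dots> = ennreal (exp (- \<gamma>))"
    using E by (subst nn_integral_cmult) (auto simp: one)
  finally show ?thesis by (simp add: CB.emeasure_eq_measure)
qed

text \<open>Noise \<open>v\<close> and residual cross gains \<open>d\<close> are fixed; only the
  codebooks are random. The test fails only if some sent codeword has atypical energy
  (\<open>U\<close>), the wanted codeword correlates with the noise (\<open>X\<close>), or a wrong
  codeword reaches the threshold (\<open>W\<close>).\<close>

lemma codebook_bound:
  assumes \<tau>: "0 < \<tau>" "\<tau> < 1" and b: "0 \<le> b" and p: "0 < p" and k: "k \<in> {1..K}"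
    and w: "\<And>t. t \<in> {1..K} \<Longrightarrow> w t < M"
    and v: "\<bar>\<Sum>i<p. (cmod (v i))\<^sup>2 - 2\<bar> \<le> \<tau> * real p"
    and d: "\<And>t i. i < p \<Longrightarrow> t \<in> {1..K} - {k} \<Longrightarrow> cmod (d t i) \<le> \<delta>" and \<delta>: "2 * (real K)\<^sup>2 * \<delta>\<^sup>2 \<le> \<tau>\<^sup>2"
  defines "\<gamma> \<equiv> real p * (ln (1 + b\<^sup>2 / 2) - 6 * \<tau>)"
    and "Y \<equiv> \<lambda>C i. of_real b * C (k, w k, i) + (\<Sum>t\<in>{1..K} - {k}. d t i * C (t, w t, i)) + v i"
  shows "measure (codebooks K M p) {C \<in> space (codebooks K M p). decode_fail b p M \<gamma> k (w k) (Y C) C}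
    \<le> (real K * cmod2_var + 3) / (real p * \<tau>\<^sup>2) + real M * exp (- \<gamma>)"
proof -
  let ?CB = "codebooks K M p"
  interpret CB: prob_space ?CB by (rule prob_space_codebooks)
  define a where "a = \<tau> * real p"
  have a: "0 < a" using \<tau> p by (simp add: a_def)
  have ce: "(\<lambda>C. C (t, w t, i)) \<in> borel_measurable ?CB" if "t \<in> {1..K}" "i < p" for t i
    using that w by (intro measurable_codebook_entry) auto
  have Ym: "(\<lambda>C. Y C i) \<in> borel_measurable ?CB" if "i < p" for i
    unfolding Y_def using that k by (intro borel_measurable_add borel_measurable_times borel_measurable_sum ce) auto
  define U where "U t = {C \<in> space ?CB. a \<le> \<bar>\<Sum>i<p. (cmod (C (t, w t, i)))\<^sup>2 - 1\<bar>}" for t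
  define X where "X = {C \<in> space ?CB. a \<le> \<bar>\<Sum>i<p. Re (cnj (v i) * C (k, w k, i))\<bar>}"
  define W where "W m = {C \<in> space ?CB. \<gamma> \<le> (\<Sum>i<p. iden b (Y C i) (C (k, m, i)))}" for m
  have row: "(\<Sum>i<p. F i (C (t, w t, i))) = (\<Sum>j\<in>{t} \<times> {w t} \<times> {..<p}. F (snd (snd j)) (C j))"
    for F :: "nat \<Rightarrow> complex \<Rightarrow> real" and C :: "nat \<times> nat \<times> nat \<Rightarrow> complex" and t
  proof -
    have "bij_betw (\<lambda>i. (t, w t, i)) {..<p} ({t} \<times> {w t} \<times> {..<p})" by (auto simp: bij_betw_def inj_on_def)
    from sum.reindex_bij_betw[OF this, of "\<lambda>j. F (snd (snd j)) (C j)"] show ?thesis by simp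
  qed
  have Us: "U t \<in> sets ?CB" if "t \<in> {1..K}" for t
  proof -
    have "(\<lambda>C. \<bar>\<Sum>i<p. (cmod (C (t, w t, i)))\<^sup>2 - 1\<bar>) \<in> borel_measurable ?CB"
    proof -
      have [measurable]: "(\<lambda>C. C (t, w t, i)) \<in> borel_measurable ?CB" if "i \<in> {..<p}" for i
        using ce \<open>t \<in> {1..K}\<close> that by simp
      show ?thesis by measurable
    qed
    then show ?thesis unfolding U_def by measurable
  qed
  have Xs: "X \<in> sets ?CB"
  proof -
    have "(\<lambda>C. \<bar>\<Sum>i<p. Re (cnj (v i) * C (k, w k, i))\<bar>) \<in> borel_measurable ?CB"
    proof -
      have [measurable]: "(\<lambda>C. C (k, w k, i)) \<in> borel_measurable ?CB" if "i \<in> {..<p}" for i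
        using ce k that by simp
      show ?thesis by measurable
    qed
    then show ?thesis unfolding X_def by measurable
  qed
  have Ws: "W m \<in> sets ?CB" if "m < M" for m
  proof -
    have "(\<lambda>C. \<Sum>i<p. iden b (Y C i) (C (k, m, i))) \<in> borel_measurable ?CB"
      using that k by (intro borel_measurable_sum iden_measurable Ym measurable_codebook_entry) auto
    then show ?thesis unfolding W_def by measurable
  qed
  have mU: "measure ?CB (U t) \<le> cmod2_var / (real p * \<tau>\<^sup>2)" if t: "t \<in> {1..K}" for t
  proof -
    have "measure ?CB (U t) \<le> real (card ({t} \<times> {w t} \<times> {..<p})) * cmod2_var / a\<^sup>2"
      unfolding U_def row[of "\<lambda>_ c. (cmod c)\<^sup>2 - 1"] codebooks_def
      using t w by (intro cmod2_deviation a) auto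
    also have "\<dots> = cmod2_var / (real p * \<tau>\<^sup>2)"
      using p \<tau> by (simp add: a_def power2_eq_square)
    finally show ?thesis .
  qed
  have mX: "measure ?CB X \<le> 3 / (real p * \<tau>\<^sup>2)"
  proof -
    have "measure ?CB X \<le> (\<Sum>j\<in>{k} \<times> {w k} \<times> {..<p}. (cmod (cnj (v (snd (snd j)))))\<^sup>2) / a\<^sup>2"
      unfolding X_def row[of "\<lambda>i c. Re (cnj (v i) * c)"] codebooks_def
      using k w by (intro linear_deviation a) auto
    also have "(\<Sum>j\<in>{k} \<times> {w k} \<times> {..<p}. (cmod (cnj (v (snd (snd j)))))\<^sup>2) = (\<Sum>i<p. (cmod (v i))\<^sup>2)"
      using row[of "\<lambda>i _. (cmod (v i))\<^sup>2" _ k, symmetric] by simp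
    \<comment> \<open>The origin of the 3 in the bound: the noise energy per symbol is at most 2 +
      \<tau>.\<close>
    also have "\<dots> \<le> 3 * real p"
    proof -
      have "(\<Sum>i<p. (cmod (v i))\<^sup>2) \<le> (2 + \<tau>) * real p"
        using v by (simp add: sum_subtractf abs_le_iff algebra_simps)
      also have "\<dots> \<le> 3 * real p" using \<tau> by (intro mult_right_mono) auto
      finally show ?thesis .
    qed
    also have "3 * real p / a\<^sup>2 = 3 / (real p * \<tau>\<^sup>2)" using p \<tau> by (simp add: a_def power2_eq_square)
    finally show ?thesis using a by (simp add: divide_right_mono)
  qed
  have mW: "measure ?CB (W m) \<le> exp (- \<gamma>)" if "m < M" "m \<noteq> w k" for m
    unfolding W_def
  proof (rule wrong_codeword_bound[OF k that(1) Ym])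
    fix C C' :: "nat \<times> nat \<times> nat \<Rightarrow> complex" and i
    assume "\<And>t l i. (t, l) \<noteq> (k, m) \<Longrightarrow> C (t, l, i) = C' (t, l, i)"
    then show "Y C i = Y C' i" unfolding Y_def using that by (auto intro!: sum.cong)
  qed
  have sub: "{C \<in> space ?CB. decode_fail b p M \<gamma> k (w k) (Y C) C}
      \<subseteq> (\<Union>t\<in>{1..K}. U t) \<union> X \<union> (\<Union>m\<in>{..<M} - {w k}. W m)"
  proof (rule subsetI, rule ccontr)
    fix C assume C: "C \<in> {C \<in> space ?CB. decode_fail b p M \<gamma> k (w k) (Y C) C}"
      and not: "C \<notin> (\<Union>t\<in>{1..K}. U t) \<union> X \<union> (\<Union>m\<in>{..<M} - {w k}. W m)"
    have nU: "\<bar>\<Sum>i<p. (cmod (C (t, w t, i)))\<^sup>2 - 1\<bar> \<le> a" if "t \<in> {1..K}" for t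
      using C not that unfolding U_def by force
    have nX: "\<bar>\<Sum>i<p. Re (cnj (v i) * C (k, w k, i))\<bar> \<le> a"
      using C not unfolding X_def by force
    define e where "e i = (\<Sum>t\<in>{1..K} - {k}. d t i * C (t, w t, i))" for i
    have eb: "(cmod (e i))\<^sup>2 \<le> real K * (\<Sum>t\<in>{1..K}. \<delta>\<^sup>2 * (cmod (C (t, w t, i)))\<^sup>2)" if "i < p" for i
    proof -
      have "cmod (e i) \<le> (\<Sum>t\<in>{1..K} - {k}. cmod (d t i * C (t, w t, i)))"
        unfolding e_def by (rule norm_sum)
      also have "\<dots> \<le> (\<Sum>t\<in>{1..K} - {k}. \<delta> * cmod (C (t, w t, i)))"
        unfolding norm_mult using that by (intro sum_mono mult_right_mono d) auto
      finally have "(cmod (e i))\<^sup>2 \<le> (\<Sum>t\<in>{1..K} - {k}. \<delta> * cmod (C (t, w t, i)))\<^sup>2"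
        by (intro power_mono) auto
      also have "\<dots> \<le> (\<Sum>t\<in>{1..K} - {k}. 1\<^sup>2) * (\<Sum>t\<in>{1..K} - {k}. (\<delta> * cmod (C (t, w t, i)))\<^sup>2)"
        using Cauchy_Schwarz_ineq_sum[of "\<lambda>_. 1" "\<lambda>t. \<delta> * cmod (C (t, w t, i))" "{1..K} - {k}"] by simp
      also have "\<dots> \<le> real K * (\<Sum>t\<in>{1..K}. \<delta>\<^sup>2 * (cmod (C (t, w t, i)))\<^sup>2)"
      proof (intro mult_mono)
        have "card ({1..K} - {k}) \<le> card {1..K}" by (intro card_mono) auto
        then show "(\<Sum>t\<in>{1..K} - {k}. 1\<^sup>2) \<le> real K" by simp
        show "(\<Sum>t\<in>{1..K} - {k}. (\<delta> * cmod (C (t, w t, i)))\<^sup>2) \<le> (\<Sum>t\<in>{1..K}. \<delta>\<^sup>2 * (cmod (C (t, w t, i)))\<^sup>2)"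
          unfolding power_mult_distrib by (intro sum_mono2) auto
      qed (auto intro: sum_nonneg)
      finally show ?thesis .
    qed
    have "(\<Sum>i<p. (cmod (e i))\<^sup>2) \<le> (\<Sum>i<p. real K * (\<Sum>t\<in>{1..K}. \<delta>\<^sup>2 * (cmod (C (t, w t, i)))\<^sup>2))"
      by (intro sum_mono eb) auto
    also have "\<dots> = real K * (\<Sum>t\<in>{1..K}. \<delta>\<^sup>2 * (\<Sum>i<p. (cmod (C (t, w t, i)))\<^sup>2))"
      unfolding sum_distrib_left[symmetric] sum.swap[of _ "{1..K}"] ..
    also have "\<dots> \<le> real K * (\<Sum>t\<in>{1..K}. \<delta>\<^sup>2 * (2 * real p))"
    proof (intro mult_left_mono sum_mono)
      fix t assume t: "t \<in> {1..K}"
      have "(\<Sum>i<p. (cmod (C (t, w t, i)))\<^sup>2) \<le> (1 + \<tau>) * real p"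
        using nU[OF t] by (simp add: a_def sum_subtractf abs_le_iff algebra_simps)
      also have "\<dots> \<le> 2 * real p" using \<tau> by (intro mult_right_mono) auto
      finally show "(\<Sum>i<p. (cmod (C (t, w t, i)))\<^sup>2) \<le> 2 * real p" .
    qed auto
    \<comment> \<open>One factor \<open>K\<close> comes from Cauchy-Schwarz over the interferers,
      the other from summing over the users, and 2 bounds the energy 1 + \<tau> per symbol. The
      hypothesis on \<delta> is made for this line.\<close>
    also have "\<dots> = (2 * (real K)\<^sup>2 * \<delta>\<^sup>2) * real p" by (simp add: power2_eq_square)
    also have "\<dots> \<le> \<tau>\<^sup>2 * real p" by (intro mult_right_mono \<delta>) auto
    finally have E: "(\<Sum>i<p. (cmod (e i))\<^sup>2) \<le> \<tau>\<^sup>2 * real p" .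
    have "\<gamma> \<le> (\<Sum>i<p. iden b (Y C i) (C (k, w k, i)))"
      unfolding \<gamma>_def Y_def e_def[symmetric]
      using nU[OF k] nX v by (intro sum_iden_lower_bound \<tau> b E) (auto simp: a_def)
    then obtain m where "m < M" "m \<noteq> w k" "\<gamma> \<le> (\<Sum>i<p. iden b (Y C i) (C (k, m, i)))"
      using C unfolding decode_fail_def by auto
    then show False using C not unfolding W_def by auto
  qed
  have "measure ?CB {C \<in> space ?CB. decode_fail b p M \<gamma> k (w k) (Y C) C}
      \<le> measure ?CB ((\<Union>t\<in>{1..K}. U t) \<union> X \<union> (\<Union>m\<in>{..<M} - {w k}. W m))"
    using Us Xs Ws by (intro CB.finite_measure_mono[OF sub] sets.Un sets.finite_UN) auto
  also have "\<dots> \<le> measure ?CB (\<Union>t\<in>{1..K}. U t) + measure ?CB X + measure ?CB (\<Union>m\<in>{..<M} - {w k}. W m)"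
    using Us Xs Ws by (intro order_trans[OF measure_Un_le] add_mono order_refl sets.Un sets.finite_UN measure_Un_le) auto
  also have "\<dots> \<le> (\<Sum>t\<in>{1..K}. measure ?CB (U t)) + measure ?CB X + (\<Sum>m\<in>{..<M} - {w k}. measure ?CB (W m))"
    using Us Ws by (intro add_mono order_refl CB.finite_measure_subadditive_finite) auto
  also have "\<dots> \<le> (\<Sum>t\<in>{1..K}. cmod2_var / (real p * \<tau>\<^sup>2)) + 3 / (real p * \<tau>\<^sup>2) + (\<Sum>m\<in>{..<M} - {w k}. exp (- \<gamma>))"
    by (intro add_mono sum_mono mU mX mW) auto
  also have "\<dots> \<le> real K * (cmod2_var / (real p * \<tau>\<^sup>2)) + 3 / (real p * \<tau>\<^sup>2) + real M * exp (- \<gamma>)"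
  proof -
    have "card ({..<M} - {w k}) \<le> card {..<M}" by (intro card_mono) auto
    then have "real (card ({..<M} - {w k})) * exp (- \<gamma>) \<le> real M * exp (- \<gamma>)" by (intro mult_right_mono) auto
    then show ?thesis by simp
  qed
  finally show ?thesis by (simp add: add_divide_distrib)
qed

section \<open>Pairing complementary channel states\<close>

text \<open>The set of true predicates takes finitely many values, so any property \<open>P\<close>
  of it is measurable, even one defined by arbitrary choice. This settles the measurability of the
  pairing, however it is selected.\<close>

lemma sets_Collect_finite_preds:
  assumes E: "finite E" and Q: "\<And>e. e \<in> E \<Longrightarrow> {x \<in> space M. Q e x} \<in> sets M"
  shows "{x \<in> space M. P {e \<in> E. Q e x}} \<in> sets M"
proof -
  have "{x \<in> space M. \<forall>e\<in>E. Q e x \<longleftrightarrow> e \<in> X} \<in> sets M" for X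
  proof (rule sets.sets_Collect_finite_All[OF _ E])
    fix e assume e: "e \<in> E"
    have "{x \<in> space M. \<not> Q e x} \<in> sets M" using Q[OF e] by (rule sets.sets_Collect_neg)
    then show "{x \<in> space M. Q e x \<longleftrightarrow> e \<in> X} \<in> sets M" using Q[OF e] by (cases "e \<in> X") auto
  qed
  moreover have "{x \<in> space M. P {e \<in> E. Q e x}}
      = (\<Union>X\<in>{X \<in> Pow E. P X}. {x \<in> space M. \<forall>e\<in>E. Q e x \<longleftrightarrow> e \<in> X})"
  proof (intro equalityI subsetI)
    fix x assume "x \<in> {x \<in> space M. P {e \<in> E. Q e x}}"
    then show "x \<in> (\<Union>X\<in>{X \<in> Pow E. P X}. {x \<in> space M. \<forall>e\<in>E. Q e x \<longleftrightarrow> e \<in> X})"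
      by (intro UN_I[of "{e \<in> E. Q e x}"]) auto
  next
    fix x assume "x \<in> (\<Union>X\<in>{X \<in> Pow E. P X}. {x \<in> space M. \<forall>e\<in>E. Q e x \<longleftrightarrow> e \<in> X})"
    then obtain X where X: "X \<subseteq> E" "P X" "x \<in> space M" "\<forall>e\<in>E. Q e x \<longleftrightarrow> e \<in> X" by auto
    then have "{e \<in> E. Q e x} = X" by auto
    with X show "x \<in> {x \<in> space M. P {e \<in> E. Q e x}}" by simp
  qed
  ultimately show ?thesis using E by (auto intro!: sets.finite_UN)
qed

text \<open>\<open>B n q\<close> stands for: time \<open>n\<close> is of class \<open>q\<close>. For
  each class, \<open>c\<close> of its times in \<open>H1\<close> are matched with \<open>c\<close>
  times of class \<open>f q\<close> in \<open>H2\<close>; \<open>uniq\<close> and the injectivity of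
  \<open>f\<close> keep times of different classes apart.\<close>

lemma matching_exists:
  fixes B :: "'n \<Rightarrow> 'q \<Rightarrow> bool"
  assumes CS: "finite CS" and H: "finite H1" "finite H2"
    and uniq: "\<And>n q q'. q \<in> CS \<Longrightarrow> q' \<in> CS \<Longrightarrow> B n q \<Longrightarrow> B n q' \<Longrightarrow> q = q'"
    and f: "inj_on f CS" "f ` CS \<subseteq> CS"
    and c: "\<And>q. q \<in> CS \<Longrightarrow> c \<le> card {n \<in> H1. B n q}" "\<And>q. q \<in> CS \<Longrightarrow> c \<le> card {n \<in> H2. B n q}"
  shows "\<exists>a b. inj_on a {..<card CS * c} \<and> inj_on b {..<card CS * c} \<and> a ` {..<card CS * c} \<subseteq> H1 \<and> b ` {..<card CS * c} \<subseteq> H2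
    \<and> (\<forall>i<card CS * c. \<exists>q\<in>CS. B (a i) q \<and> B (b i) (f q))"
proof -
  have "\<exists>g. g ` {..<c} \<subseteq> {n \<in> H1. B n q} \<and> inj_on g {..<c}" if "q \<in> CS" for q
    using c(1)[OF that] H by (intro card_le_inj) auto
  then obtain \<alpha> where \<alpha>: "\<And>q. q \<in> CS \<Longrightarrow> \<alpha> q ` {..<c} \<subseteq> {n \<in> H1. B n q}" "\<And>q. q \<in> CS \<Longrightarrow> inj_on (\<alpha> q) {..<c}"
    by metis
  have "\<exists>g. g ` {..<c} \<subseteq> {n \<in> H2. B n (f q)} \<and> inj_on g {..<c}" if "q \<in> CS" for q
    using c(2)[of "f q"] f(2) that H by (intro card_le_inj) auto
  then obtain \<beta> where \<beta>: "\<And>q. q \<in> CS \<Longrightarrow> \<beta> q ` {..<c} \<subseteq> {n \<in> H2. B n (f q)}" "\<And>q. q \<in> CS \<Longrightarrow> inj_on (\<beta> q) {..<c}"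
    by metis
  have "card {..<card CS * c} = card (CS \<times> {..<c})" by (simp add: card_cartesian_product)
  \<comment> \<open>Symbol numbers are identified with pairs of a class and an occurrence within
    it.\<close>
  then obtain e where e: "bij_betw e {..<card CS * c} (CS \<times> {..<c})"
    using CS finite_same_card_bij[of "{..<card CS * c}" "CS \<times> {..<c}"] by auto
  have eI: "fst (e i) \<in> CS" "snd (e i) < c" if "i < card CS * c" for i
    using bij_betwE[OF e] that by (auto simp: mem_Times_iff)
  define a where "a i = \<alpha> (fst (e i)) (snd (e i))" for i
  define b where "b i = \<beta> (fst (e i)) (snd (e i))" for i
  have a: "a i \<in> H1" "B (a i) (fst (e i))" and b: "b i \<in> H2" "B (b i) (f (fst (e i)))" if "i < card CS * c" for i
    using \<alpha>(1)[OF eI(1)[OF that]] \<beta>(1)[OF eI(1)[OF that]] eI(2)[OF that] by (auto simp: a_def b_def)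
  have einj: "i = j" if "i < card CS * c" "j < card CS * c" "fst (e i) = fst (e j)" "snd (e i) = snd (e j)" for i j
    using bij_betw_imp_inj_on[OF e] that by (auto simp: inj_on_def prod_eq_iff)
  have ia: "inj_on a {..<card CS * c}"
  proof (rule inj_onI)
    fix i j assume ij: "i \<in> {..<card CS * c}" "j \<in> {..<card CS * c}" "a i = a j"
    then have q: "fst (e i) = fst (e j)" using uniq[OF eI(1) eI(1)] a(2)[of i] a(2)[of j] by auto
    then have "snd (e i) = snd (e j)"
      using ij eI inj_onD[OF \<alpha>(2)[OF eI(1)], of i "snd (e i)" "snd (e j)"] by (auto simp: a_def)
    then show "i = j" using einj q ij by auto
  qed
  have ib: "inj_on b {..<card CS * c}"
  proof (rule inj_onI)
    fix i j assume ij: "i \<in> {..<card CS * c}" "j \<in> {..<card CS * c}" "b i = b j"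
    have "f (fst (e i)) = f (fst (e j))"
      by (rule uniq[where n="b i"]) (use ij eI f(2) b(2)[of i] b(2)[of j] in auto)
    then have q: "fst (e i) = fst (e j)" using inj_onD[OF f(1)] eI ij by auto
    then have "snd (e i) = snd (e j)"
      using ij eI inj_onD[OF \<beta>(2)[OF eI(1)], of i "snd (e i)" "snd (e j)"] by (auto simp: b_def)
    then show "i = j" using einj q ij by auto
  qed
  show ?thesis
  proof (rule exI[of _ a], rule exI[of _ b], intro conjI)
    show "\<forall>i<card CS * c. \<exists>q\<in>CS. B (a i) q \<and> B (b i) (f q)" using a(2) b(2) eI(1) by blast
  qed (use ia ib a b in auto)
qed

text \<open>Chord against arc: the squared chord is 4 times the squared sine of half the
  angle.\<close>

lemma cmod_cis_diff_le: "cmod (cis x - cis y) \<le> \<bar>x - y\<bar>"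
proof -
  have "(cmod (cis x - cis y))\<^sup>2 = 2 - 2 * cos (x - y)"
  proof -
    have "(cmod (cis x - cis y))\<^sup>2 = ((cos x)\<^sup>2 + (sin x)\<^sup>2) + ((cos y)\<^sup>2 + (sin y)\<^sup>2) - 2 * (cos x * cos y + sin x * sin y)"
      unfolding cmod_power2 by (simp add: power2_eq_square algebra_simps)
    then show ?thesis by (simp add: cos_diff)
  qed
  also have "\<dots> = 4 * (sin ((x - y) / 2))\<^sup>2"
  proof -
    have "2 * ((x - y) / 2) = x - y" by simp
    from cos_double_sin[of "(x - y) / 2", unfolded this] show ?thesis by simp
  qed
  also have "\<dots> \<le> 4 * ((x - y) / 2)\<^sup>2"
    using power_mono[OF abs_sin_x_le_abs_x[of "(x - y) / 2"], of 2] by (simp add: power_divide)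
  also have "\<dots> = \<bar>x - y\<bar>\<^sup>2" by (simp add: power_divide)
  finally show ?thesis by (rule power2_le_imp_le) auto
qed

context equal_strength begin

text \<open>The phases are quantised with step \<open>\<pi> / L\<close>, so that adding \<open>\<pi>\<close> to a phase shifts its index
  by \<open>L\<close>.\<close>
definition in_cell :: "nat \<Rightarrow> (nat \<times> nat \<Rightarrow> nat) \<Rightarrow> state \<Rightarrow> bool" where
  "in_cell L q s \<longleftrightarrow> (\<forall>x\<in>{1..K} \<times> {1..K}. pi * real (q x) / real L \<le> snd s x \<and> snd s x < pi * (real (q x) + 1) / real L)"

text \<open>With step \<pi> / L, indices below \<open>2 * L\<close> cover the phase range [0,
  2\<pi>).\<close>

definition cells :: "nat \<Rightarrow> (nat \<times> nat \<Rightarrow> nat) set" where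
  "cells L = PiE ({1..K} \<times> {1..K}) (\<lambda>_. {..<2 * L})"

text \<open>The cell in which all cross channels are negated.\<close>
definition opposite :: "nat \<Rightarrow> (nat \<times> nat \<Rightarrow> nat) \<Rightarrow> (nat \<times> nat \<Rightarrow> nat)" where
  "opposite L q = (\<lambda>x\<in>{1..K} \<times> {1..K}. if fst x = snd x then q x else if q x < L then q x + L else q x - L)"

lemma finite_cells: "finite (cells L)"
  unfolding cells_def by (intro finite_PiE) auto

lemma opposite_inj: "inj_on (opposite L) (cells L)" and opposite_cells: "opposite L ` cells L \<subseteq> cells L"
proof -
  show "inj_on (opposite L) (cells L)"
  proof (rule inj_onI)
    fix q q' assume q: "q \<in> cells L" "q' \<in> cells L" "opposite L q = opposite L q'"
    show "q = q'"
    proof (rule PiE_ext[OF q(1,2)[unfolded cells_def]])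
      fix x assume x: "x \<in> {1..K} \<times> {1..K}"
      have "q x < 2 * L" "q' x < 2 * L" using q x by (auto simp: cells_def)
      moreover have "opposite L q x = opposite L q' x" using q by simp
      ultimately show "q x = q' x" using x by (auto simp: opposite_def split: if_splits)
    qed
  qed
  show "opposite L ` cells L \<subseteq> cells L"
    by (force simp: opposite_def cells_def PiE_iff)
qed

lemma in_cell_unique:
  assumes "q \<in> cells L" "q' \<in> cells L" "in_cell L q s" "in_cell L q' s" and L: "0 < L"
  shows "q = q'"
proof (rule PiE_ext[OF assms(1,2)[unfolded cells_def]])
  fix x assume x: "x \<in> {1..K} \<times> {1..K}"
  have "pi * real (q x) / real L < pi * (real (q' x) + 1) / real L"
    "pi * real (q' x) / real L < pi * (real (q x) + 1) / real L"
    using assms(3,4) x unfolding in_cell_def by (meson le_less_trans)+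
  then have "real (q x) < real (q' x) + 1" "real (q' x) < real (q x) + 1"
    using L by (auto simp: divide_less_cancel)
  then show "q x = q' x" by linarith
qed

text \<open>The phase of the cross link counts relative to the direct phase of its transmitter,
  which the encoder removes. Each of these two phases is known up to one step \<pi> / L, hence the
  error of two steps.\<close>

lemma opposite_cancels:
  assumes L: "0 < L" and q: "q \<in> cells L" and s: "in_cell L q s" "in_cell L (opposite L q) s'"
    and rt: "r \<in> {1..K}" "t \<in> {1..K}" "r \<noteq> t"
  shows "cmod (cis (snd s (r, t) - snd s (t, t)) + cis (snd s' (r, t) - snd s' (t, t))) \<le> 2 * pi / real L"
proof -
  define h where "h = pi / real L"
  have h: "0 < h" "h * real L = pi" using L by (auto simp: h_def)
  have cell: "h * real (q x) \<le> snd s x" "snd s x < h * real (q x) + h"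
     "h * real (opposite L q x) \<le> snd s' x" "snd s' x < h * real (opposite L q x) + h" if "x \<in> {1..K} \<times> {1..K}" for x
    using s that unfolding in_cell_def h_def by (auto simp: distrib_left add_divide_distrib)
  \<comment> \<open>The index is shifted up or down by \<open>L\<close>, but
    \<open>cis \<sigma> = - 1\<close> in both cases.\<close>
  define \<sigma> where "\<sigma> = (if q (r, t) < L then pi else - pi)"
  have "q (r, t) < 2 * L" using q rt by (auto simp: cells_def)
  then have o: "h * real (opposite L q (r, t)) = h * real (q (r, t)) + \<sigma>"
    using rt h by (auto simp: opposite_def \<sigma>_def algebra_simps of_nat_diff)
  have o': "opposite L q (t, t) = q (t, t)" using rt by (simp add: opposite_def)
  define \<zeta> where "\<zeta> = (snd s' (r, t) - snd s (r, t) - \<sigma>) - (snd s' (t, t) - snd s (t, t))"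
  have z: "\<bar>\<zeta>\<bar> \<le> 2 * h"
    using cell[of "(r, t)"] cell[of "(t, t)"] rt unfolding \<zeta>_def o o' by auto
  have "cis (snd s' (r, t) - snd s' (t, t)) = cis (snd s (r, t) - snd s (t, t) + \<zeta>) * cis \<sigma>"
    by (simp add: cis_mult \<zeta>_def)
  also have "cis \<sigma> = - 1" by (auto simp: \<sigma>_def complex_eq_iff)
  finally have "cis (snd s (r, t) - snd s (t, t)) + cis (snd s' (r, t) - snd s' (t, t))
      = cis (snd s (r, t) - snd s (t, t)) - cis (snd s (r, t) - snd s (t, t) + \<zeta>)" by simp
  then show ?thesis
    using cmod_cis_diff_le[of "snd s (r, t) - snd s (t, t)" "snd s (r, t) - snd s (t, t) + \<zeta>"] z
    by (simp add: h_def)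
qed

text \<open>Phases are uniform, mutually independent and independent of the strengths, so all cells
  have the same probability. In particular a cell is as likely as its opposite.\<close>

lemma
  assumes L: "0 < L" and q: "q \<in> cells L"
  shows in_cell_sets: "{s \<in> space (state_meas K D). in_cell L q s} \<in> sets (state_meas K D)"
    and in_cell_measure: "measure (state_meas K D) {s \<in> space (state_meas K D). in_cell L q s} = 1 / real (card (cells L))"
proof -
  interpret D: prob_space D by (rule prob_D)
  interpret P: prob_space "phase_meas K" by (rule prob_space_phase_meas)
  interpret S: prob_space "state_meas K D" by (rule prob_state)
  let ?U = "uniform_measure lborel {0..<2 * pi}"
  interpret U: prob_space ?U by (intro prob_space_uniform_measure) auto
  interpret PU: product_sigma_finite "\<lambda>_::nat \<times> nat. ?U" by standard
  let ?KK = "{1..K} \<times> {1..K}"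
  define B where "B x = {pi * real (q x) / real L..<pi * (real (q x) + 1) / real L}" for x
  have eq: "{s \<in> space (state_meas K D). in_cell L q s} = space D \<times> PiE ?KK B"
    by (auto simp: state_meas_def phase_meas_def space_pair_measure space_PiM in_cell_def B_def PiE_iff)
  have Bs: "PiE ?KK B \<in> sets (phase_meas K)"
    unfolding phase_meas_def by (intro sets_PiM_I_finite) (auto simp: B_def)
  show "{s \<in> space (state_meas K D). in_cell L q s} \<in> sets (state_meas K D)"
  proof -
    have "space D \<times> PiE ?KK B \<in> sets (D \<Otimes>\<^sub>M phase_meas K)" using Bs by (rule pair_measureI[OF sets.top])
    then show ?thesis unfolding eq state_meas_def[symmetric] .
  qed
  have U1: "emeasure ?U (B x) = ennreal (1 / (2 * real L))" if x: "x \<in> ?KK" for x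
  proof -
    have "q x < 2 * L" using q x by (auto simp: cells_def)
    then have "real (q x) + 1 \<le> 2 * real L" by linarith
    then have "pi * (real (q x) + 1) / real L \<le> pi * (2 * real L) / real L"
      by (intro divide_right_mono mult_left_mono) auto
    then have "pi * (real (q x) + 1) / real L \<le> 2 * pi" using L by simp
    moreover have "0 \<le> pi * real (q x) / real L" by simp
    ultimately have sub: "{0..<2 * pi} \<inter> B x = B x" by (auto simp: B_def)
    have "emeasure lborel (B x) = ennreal (pi / real L)"
      using L by (simp add: B_def field_simps)
    then show ?thesis
      using sub L emeasure_uniform_measure[of "{0..<2 * pi}" lborel "B x"] by (simp add: B_def divide_ennreal)
  qed
  have "emeasure (phase_meas K) (PiE ?KK B) = (\<Prod>x\<in>?KK. emeasure ?U (B x))"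
    unfolding phase_meas_def by (rule PU.emeasure_PiM) (auto simp: B_def)
  also have "\<dots> = (\<Prod>x\<in>?KK. ennreal (1 / (2 * real L)))" by (intro prod.cong refl U1)
  also have "\<dots> = ennreal ((1 / (2 * real L)) ^ card ?KK)"
    by (simp add: ennreal_power)
  finally have ph: "emeasure (phase_meas K) (PiE ?KK B) = ennreal ((1 / (2 * real L)) ^ card ?KK)" .
  have "emeasure (state_meas K D) {s \<in> space (state_meas K D). in_cell L q s} = ennreal ((1 / (2 * real L)) ^ card ?KK)"
  proof -
    have "emeasure (D \<Otimes>\<^sub>M phase_meas K) (space D \<times> PiE ?KK B) = ennreal ((1 / (2 * real L)) ^ card ?KK)"
      using Bs ph by (simp add: P.emeasure_pair_measure_Times D.emeasure_space_1)
    then show ?thesis unfolding eq state_meas_def[symmetric] .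
  qed
  moreover have "(1 / (2 * real L)) ^ card ?KK = 1 / real (card (cells L))"
    unfolding cells_def by (simp add: card_PiE power_one_over)
  ultimately show "measure (state_meas K D) {s \<in> space (state_meas K D). in_cell L q s} = 1 / real (card (cells L))"
    by (simp add: measure_def)
qed

lemma card_cells_pos: "0 < L \<Longrightarrow> 0 < card (cells L)"
  unfolding cells_def by (simp add: card_PiE)

text \<open>A shortage by the fraction \<tau> is a deviation of
  \<open>\<tau> * \<pi> * card H\<close> from the mean count, where \<open>\<pi>\<close> denotes the
  cell probability. The centred indicators are bounded by one, which bounds their variances.\<close>

lemma cell_count_deviation:
  assumes L: "0 < L" and q: "q \<in> cells L" and H: "H \<subseteq> {..<N}" "H \<noteq> {}" and \<tau>: "0 < \<tau>"
  defines "\<pi> \<equiv> 1 / real (card (cells L))"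
  shows "measure (state_seq_meas K D N) {sq \<in> space (state_seq_meas K D N).
      real (card {n \<in> H. in_cell L q (sq n)}) \<le> (1 - \<tau>) * \<pi> * real (card H)} \<le> 1 / (real (card H) * (\<tau> * \<pi>)\<^sup>2)"
proof -
  let ?S = "state_meas K D" and ?SS = "state_seq_meas K D N"
  interpret S: prob_space ?S by (rule prob_state)
  interpret SS: prob_space ?SS by (rule prob_state_seq)
  have fH: "finite H" "0 < card H" using H finite_subset[OF H(1)] by (auto simp: card_gt_0_iff)
  have \<pi>: "0 < \<pi>" "\<pi> \<le> 1" using card_cells_pos[OF L] by (auto simp: \<pi>_def)
  define f where "f s = indicator {s \<in> space ?S. in_cell L q s} s - \<pi>" for s
  have [measurable]: "{s \<in> space ?S. in_cell L q s} \<in> sets ?S" by (rule in_cell_sets[OF L q])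
  have fm [measurable]: "f \<in> borel_measurable ?S" unfolding f_def[abs_def] by measurable
  have mean: "(\<integral>s. f s \<partial>?S) = 0"
  proof -
    have "has_bochner_integral ?S f (measure ?S {s \<in> space ?S. in_cell L q s} - \<pi>)"
      unfolding f_def[abs_def] using S.prob_space
      by (intro has_bochner_integral_diff has_bochner_integral_real_indicator)
         (auto simp: has_bochner_integral_iff S.emeasure_eq_measure)
    then show ?thesis by (simp add: has_bochner_integral_iff in_cell_measure[OF L q] \<pi>_def)
  qed
  have b1: "(f s)\<^sup>2 \<le> 1" for s
    using \<pi> by (auto simp: f_def indicator_def abs_square_le_1)
  have sq: "integrable ?S (\<lambda>s. (f s)\<^sup>2)"
    by (rule S.integrable_const_bound[where B=1]) (use b1 in auto)
  have var: "(\<integral>s. (f s)\<^sup>2 \<partial>?S) \<le> 1"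
    using integral_mono[OF sq, of "\<lambda>_. 1"] b1 S.prob_space by simp
  let ?a = "\<tau> * \<pi> * real (card H)"
  have a: "0 < ?a" using \<tau> \<pi> fH by simp
  have ch: "measure ?SS {sq \<in> space ?SS. ?a \<le> \<bar>\<Sum>n\<in>H. f (sq n)\<bar>} \<le> (\<Sum>n\<in>H. 1) / ?a\<^sup>2"
    unfolding state_seq_meas_def
    by (rule PiM_Chebyshev[OF prob_state fH(1) H(1) fm mean sq var a])
  have fsm: "{sq \<in> space ?SS. ?a \<le> \<bar>\<Sum>n\<in>H. f (sq n)\<bar>} \<in> sets ?SS"
  proof -
    have "(\<lambda>sq. f (sq n)) \<in> borel_measurable ?SS" if "n \<in> H" for n
      unfolding state_seq_meas_def using that H
      by (intro measurable_compose[OF measurable_component_singleton[where i=n and I="{..<N}"] fm]) auto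
    then have [measurable]: "(\<lambda>sq. \<Sum>n\<in>H. f (sq n)) \<in> borel_measurable ?SS" by (rule borel_measurable_sum)
    show ?thesis by measurable
  qed
  have "measure ?SS {sq \<in> space ?SS. real (card {n \<in> H. in_cell L q (sq n)}) \<le> (1 - \<tau>) * \<pi> * real (card H)}
      \<le> measure ?SS {sq \<in> space ?SS. ?a \<le> \<bar>\<Sum>n\<in>H. f (sq n)\<bar>}"
  proof (rule SS.finite_measure_mono[OF _ fsm], safe)
    fix sq assume sq: "sq \<in> space ?SS" and le: "real (card {n \<in> H. in_cell L q (sq n)}) \<le> (1 - \<tau>) * \<pi> * real (card H)"
    have sp: "sq n \<in> space ?S" if "n \<in> H" for n
      using sq that H by (auto simp: state_seq_meas_def space_PiM)
    have "(\<Sum>n\<in>H. f (sq n)) = (\<Sum>n\<in>H. of_bool (in_cell L q (sq n)) - \<pi>)"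
      by (rule sum.cong) (auto simp: f_def indicator_def sp)
    also have "\<dots> = real (card {n \<in> H. in_cell L q (sq n)}) - real (card H) * \<pi>"
      using fH by (simp add: sum_subtractf of_bool_def sum.If_cases Int_def)
    also have "\<dots> \<le> - ?a" using le by (simp add: algebra_simps)
    finally show "?a \<le> \<bar>\<Sum>n\<in>H. f (sq n)\<bar>" by linarith
  qed
  also note ch
  also have "(\<Sum>n\<in>H. 1) / ?a\<^sup>2 = 1 / (real (card H) * (\<tau> * \<pi>)\<^sup>2)"
    using fH by (simp add: power2_eq_square)
  finally show ?thesis .
qed

text \<open>\<open>A sq i n\<close> says that symbol \<open>i\<close> is sent at time \<open>n\<close>; each symbol is sent twice, in
  states whose cross channels nearly cancel.\<close>
definition is_pairing :: "nat \<Rightarrow> nat \<Rightarrow> real \<Rightarrow> ((nat \<Rightarrow> state) \<Rightarrow> nat \<Rightarrow> nat \<Rightarrow> bool) \<Rightarrow> (nat \<Rightarrow> state) set \<Rightarrow> bool" where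
  "is_pairing N p \<delta> A G \<longleftrightarrow> G \<in> sets (state_seq_meas K D N) \<and>
     (\<forall>i n. {sq \<in> space (state_seq_meas K D N). A sq i n} \<in> sets (state_seq_meas K D N)) \<and>
     (\<forall>sq n i j. i < p \<longrightarrow> j < p \<longrightarrow> A sq i n \<longrightarrow> A sq j n \<longrightarrow> i = j) \<and>
     (\<forall>sq\<in>G. \<exists>a b. inj_on a {..<p} \<and> inj_on b {..<p} \<and> a ` {..<p} \<subseteq> {..<N} \<and> b ` {..<p} \<subseteq> {..<N} \<and>
        a ` {..<p} \<inter> b ` {..<p} = {} \<and> (\<forall>i<p. \<forall>n. A sq i n \<longleftrightarrow> n = a i \<or> n = b i) \<and>
        (\<forall>i<p. \<forall>r\<in>{1..K}. \<forall>t\<in>{1..K}. r \<noteq> t \<longrightarrow>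
           cmod (cis (snd (sq (a i)) (r, t) - snd (sq (a i)) (t, t))
             + cis (snd (sq (b i)) (r, t) - snd (sq (b i)) (t, t))) \<le> \<delta>))"

text \<open>The block is cut into halves. If every cell occurs at least \<open>c\<close> times in
  each half, times of the first half can be matched with times of the second half in the opposite
  cell. As all cells are equally likely, nearly a fraction 1 - \<tau> of the block is used, two
  times per symbol.\<close>

lemma pairing_exists:
  assumes L: "0 < L" and \<tau>: "0 < \<tau>" "\<tau> < 1" and N: "2 \<le> N"
  shows "\<exists>p A G. (1 - \<tau>) / 2 * real N - (real (card (cells L)) + 1) \<le> real p \<and> p \<le> N \<and>
    is_pairing N p (2 * pi / real L) A G \<and>
    measure (state_seq_meas K D N) (space (state_seq_meas K D N) - G) \<le> 6 * real (card (cells L)) ^ 3 / \<tau>\<^sup>2 / real N"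
proof -
  let ?SS = "state_seq_meas K D N"
  interpret SS: prob_space ?SS by (rule prob_state_seq)
  define Q where "Q = card (cells L)"
  have Q: "0 < Q" using card_cells_pos[OF L] by (simp add: Q_def)
  define N' where "N' = N div 2"
  \<comment> \<open>The bound \<open>N / 3\<close> is attained at \<open>N = 3\<close>; halving an
    odd \<open>N\<close> costs half a channel use.\<close>
  have N': "0 < N'" "2 * N' \<le> N" "real N / 3 \<le> real N'" "real N / 2 - 1 / 2 \<le> real N'"
  proof -
    have "2 * N' = N \<or> 2 * N' + 1 = N" unfolding N'_def by linarith
    then have "2 * real N' = real N \<or> 2 * real N' + 1 = real N" by linarith
    moreover have "1 \<le> real N'" "2 * N' \<le> N" using N by (auto simp: N'_def)
    ultimately show "0 < N'" "2 * N' \<le> N" "real N / 3 \<le> real N'" "real N / 2 - 1 / 2 \<le> real N'"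
      by auto
  qed
  \<comment> \<open>The guaranteed number of occurrences per cell and half. Rounding down loses at
    most one per cell, thus \<open>Q\<close> symbols; with the loss from halving \<open>N\<close>
    this stays below \<open>Q + 1\<close>.\<close>
  define c where "c = nat \<lfloor>(1 - \<tau>) * real N' / real Q\<rfloor>"
  have c0: "0 \<le> (1 - \<tau>) * real N' / real Q" using \<tau> by simp
  have c: "real c \<le> (1 - \<tau>) * real N' / real Q" "(1 - \<tau>) * real N' / real Q - 1 \<le> real c"
    unfolding c_def using c0 by linarith+
  define p where "p = Q * c"
  have p1: "(1 - \<tau>) / 2 * real N - (real Q + 1) \<le> real p"
  proof -
    have "real Q * ((1 - \<tau>) * real N' / real Q - 1) \<le> real p"
      unfolding p_def of_nat_mult by (rule mult_left_mono[OF c(2)]) simp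
    then have 1: "(1 - \<tau>) * real N' - real Q \<le> real p" using Q by (simp add: right_diff_distrib)
    have "(1 - \<tau>) / 2 * real N - (real Q + 1) \<le> ((1 - \<tau>) / 2 * real N - (1 - \<tau>) / 2) - real Q"
      using \<tau> by simp
    also have "(1 - \<tau>) / 2 * real N - (1 - \<tau>) / 2 = (1 - \<tau>) * (real N / 2 - 1 / 2)"
      by (simp add: right_diff_distrib)
    also have "(1 - \<tau>) * (real N / 2 - 1 / 2) - real Q \<le> (1 - \<tau>) * real N' - real Q"
      using \<tau> by (intro diff_right_mono mult_left_mono N') auto
    also note 1
    finally show ?thesis .
  qed
  have p2: "p \<le> N"
  proof -
    have "real p \<le> real Q * ((1 - \<tau>) * real N' / real Q)"
      unfolding p_def of_nat_mult by (rule mult_left_mono[OF c(1)]) simp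
    also have "\<dots> = (1 - \<tau>) * real N'" using Q by simp
    also have "\<dots> \<le> 1 * real N'" using \<tau> by (intro mult_right_mono) auto
    also have "\<dots> \<le> real N" using N'(2) by simp
    finally show ?thesis by simp
  qed
  define H1 where "H1 = {..<N'}"
  define H2 where "H2 = {N'..<2 * N'}"
  have H: "H1 \<subseteq> {..<N}" "H2 \<subseteq> {..<N}" "H1 \<noteq> {}" "H2 \<noteq> {}" "card H1 = N'" "card H2 = N'" "H1 \<inter> H2 = {}" "finite H1" "finite H2"
    using N' by (auto simp: H1_def H2_def)
  define E where "E = {..<N} \<times> cells L"
  have fE: "finite E" unfolding E_def using finite_cells by auto
  \<comment> \<open>The finite information that determines the pairing. As \<open>sel\<close>
    depends on the states only through it, an arbitrary choice remains measurable.\<close>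
  define X where "X sq = {e \<in> E. in_cell L (snd e) (sq (fst e))}" for sq :: "nat \<Rightarrow> state"
  define ok where "ok = (\<lambda>X (a, b). inj_on a {..<p} \<and> inj_on b {..<p} \<and> a ` {..<p} \<subseteq> H1 \<and> b ` {..<p} \<subseteq> H2
    \<and> (\<forall>i<p. \<exists>q\<in>cells L. (a i, q) \<in> X \<and> (b i, opposite L q) \<in> X))"
  define sel where "sel X = (SOME ab. ok X ab)" for X
  define good where "good X \<longleftrightarrow> (\<exists>ab. ok X ab)" for X
  \<comment> \<open>Without a matching nothing is sent. So no two symbols share a time for any state
    sequence, good or not, as the power bound requires.\<close>
  define A where "A sq i n \<longleftrightarrow> good (X sq) \<and> (n = fst (sel (X sq)) i \<or> n = snd (sel (X sq)) i)" for sq i n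
  define G where "G = {sq \<in> space ?SS. good (X sq)}"
  have cs: "{sq \<in> space ?SS. in_cell L q (sq n)} \<in> sets ?SS" if "n < N" "q \<in> cells L" for n q
  proof -
    have "(\<lambda>sq. sq n) \<in> measurable ?SS (state_meas K D)"
      unfolding state_seq_meas_def using that by (intro measurable_component_singleton) auto
    from measurable_sets[OF this in_cell_sets[OF L that(2)]]
    have "(\<lambda>sq. sq n) -` {s \<in> space (state_meas K D). in_cell L q s} \<inter> space ?SS \<in> sets ?SS" .
    also have "(\<lambda>sq. sq n) -` {s \<in> space (state_meas K D). in_cell L q s} \<inter> space ?SS = {sq \<in> space ?SS. in_cell L q (sq n)}"
      using that by (auto simp: state_seq_meas_def space_PiM)
    finally show ?thesis .
  qed
  have meas: "{sq \<in> space ?SS. P (X sq)} \<in> sets ?SS" for P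
    unfolding X_def by (rule sets_Collect_finite_preds[OF fE]) (auto simp: E_def intro: cs)
  have selok: "ok (X sq) (sel (X sq))" if "good (X sq)" for sq
    using that unfolding good_def sel_def by (metis someI)
  have selD: "inj_on (fst (sel (X sq))) {..<p}" "inj_on (snd (sel (X sq))) {..<p}"
     "fst (sel (X sq)) ` {..<p} \<subseteq> H1" "snd (sel (X sq)) ` {..<p} \<subseteq> H2"
     "\<And>i. i < p \<Longrightarrow> \<exists>q\<in>cells L. in_cell L q (sq (fst (sel (X sq)) i)) \<and> in_cell L (opposite L q) (sq (snd (sel (X sq)) i))"
    if "good (X sq)" for sq
    using selok[OF that] unfolding ok_def split_beta' by (auto simp: X_def)
  have pairing: "is_pairing N p (2 * pi / real L) A G"
    unfolding is_pairing_def
  proof (intro conjI allI ballI impI)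
    show "G \<in> sets ?SS" unfolding G_def by (rule meas)
    show "{sq \<in> space ?SS. A sq i n} \<in> sets ?SS" for i n
      unfolding A_def by (rule meas)
    show "i = j" if "i < p" "j < p" "A sq i n" "A sq j n" for sq n i j
    proof -
      have g: "good (X sq)" using that by (simp add: A_def)
      have "fst (sel (X sq)) i \<noteq> snd (sel (X sq)) j" "fst (sel (X sq)) j \<noteq> snd (sel (X sq)) i"
        using selD(3,4)[OF g] H(7) that by auto
      then show ?thesis
        using that selD(1,2)[OF g] unfolding A_def inj_on_def by auto
    qed
    fix sq assume "sq \<in> G"
    then have g: "good (X sq)" by (simp add: G_def)
    show "\<exists>a b. inj_on a {..<p} \<and> inj_on b {..<p} \<and> a ` {..<p} \<subseteq> {..<N} \<and> b ` {..<p} \<subseteq> {..<N} \<and>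
        a ` {..<p} \<inter> b ` {..<p} = {} \<and> (\<forall>i<p. \<forall>n. A sq i n \<longleftrightarrow> n = a i \<or> n = b i) \<and>
        (\<forall>i<p. \<forall>r\<in>{1..K}. \<forall>t\<in>{1..K}. r \<noteq> t \<longrightarrow>
           cmod (cis (snd (sq (a i)) (r, t) - snd (sq (a i)) (t, t))
             + cis (snd (sq (b i)) (r, t) - snd (sq (b i)) (t, t))) \<le> 2 * pi / real L)"
    proof (rule exI[of _ "fst (sel (X sq))"], rule exI[of _ "snd (sel (X sq))"], intro conjI allI ballI impI)
      fix i r t assume i: "i < p" and rt: "r \<in> {1..K}" "t \<in> {1..K}" "r \<noteq> t"
      obtain q where "q \<in> cells L" "in_cell L q (sq (fst (sel (X sq)) i))" "in_cell L (opposite L q) (sq (snd (sel (X sq)) i))"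
        using selD(5)[OF g i] by blast
      from opposite_cancels[OF L this rt]
      show "cmod (cis (snd (sq (fst (sel (X sq)) i)) (r, t) - snd (sq (fst (sel (X sq)) i)) (t, t))
             + cis (snd (sq (snd (sel (X sq)) i)) (r, t) - snd (sq (snd (sel (X sq)) i)) (t, t))) \<le> 2 * pi / real L" .
    next
      show "fst (sel (X sq)) ` {..<p} \<inter> snd (sel (X sq)) ` {..<p} = {}"
        using selD(3,4)[OF g] H(7) by blast
    qed (use selD[OF g] H g in \<open>auto simp: A_def\<close>)
  qed
  define low where "low H q = {sq \<in> space ?SS. real (card {n \<in> H. in_cell L q (sq n)}) \<le> (1 - \<tau>) * (1 / real Q) * real (card H)}" for H q
  have lows: "low H q \<in> sets ?SS" if "H \<subseteq> {..<N}" "finite H" "q \<in> cells L" for H q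
    unfolding low_def by (rule sets_Collect_finite_preds[OF that(2)]) (use that cs in auto)
  have lowm: "measure ?SS (low H q) \<le> (real Q)\<^sup>2 / (real N' * \<tau>\<^sup>2)" if "H \<subseteq> {..<N}" "H \<noteq> {}" "card H = N'" "q \<in> cells L" for H q
    using cell_count_deviation[OF L that(4,1,2) \<tau>(1)] that(3) unfolding low_def Q_def
    by (simp add: power_mult_distrib power_divide)
  have sub: "space ?SS - G \<subseteq> (\<Union>q\<in>cells L. low H1 q \<union> low H2 q)"
  proof (rule subsetI, rule ccontr)
    fix sq assume sq: "sq \<in> space ?SS - G" and not: "sq \<notin> (\<Union>q\<in>cells L. low H1 q \<union> low H2 q)"
    define B where "B n q \<longleftrightarrow> in_cell L q (sq n)" for n q
    have ge: "c \<le> card {n \<in> H. B n q}" if "H = H1 \<or> H = H2" "q \<in> cells L" for H q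
    proof -
      have cH: "card H = N'" using that H by auto
      have "sq \<notin> low H q" using that not by auto
      then have "(1 - \<tau>) * (1 / real Q) * real (card H) < real (card {n \<in> H. B n q})"
        using sq unfolding low_def B_def by auto
      then have "real c < real (card {n \<in> H. B n q})" using c(1) cH by simp
      then show ?thesis by simp
    qed
    have "\<exists>a b. inj_on a {..<card (cells L) * c} \<and> inj_on b {..<card (cells L) * c} \<and> a ` {..<card (cells L) * c} \<subseteq> H1
      \<and> b ` {..<card (cells L) * c} \<subseteq> H2
      \<and> (\<forall>i<card (cells L) * c. \<exists>q\<in>cells L. B (a i) q \<and> B (b i) (opposite L q))"
    proof (rule matching_exists[OF finite_cells H(8,9) _ opposite_inj opposite_cells])
      fix n q q' assume "q \<in> cells L" "q' \<in> cells L" "B n q" "B n q'"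
      then show "q = q'" using in_cell_unique[OF _ _ _ _ L] unfolding B_def by blast
    qed (use ge in auto)
    then obtain a b where ab: "inj_on a {..<p}" "inj_on b {..<p}" "a ` {..<p} \<subseteq> H1" "b ` {..<p} \<subseteq> H2"
      "\<forall>i<p. \<exists>q\<in>cells L. B (a i) q \<and> B (b i) (opposite L q)"
      unfolding p_def Q_def by blast
    have "ok (X sq) (a, b)"
      unfolding ok_def prod.case
    proof (intro conjI ab allI impI)
      fix i assume i: "i < p"
      then obtain q where q: "q \<in> cells L" "B (a i) q" "B (b i) (opposite L q)" using ab(5) by blast
      have "a i < N" "b i < N" using ab(3,4) H i by auto
      then show "\<exists>q\<in>cells L. (a i, q) \<in> X sq \<and> (b i, opposite L q) \<in> X sq"
        using q opposite_cells[of L] unfolding X_def E_def B_def by auto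
    qed
    then have "good (X sq)" unfolding good_def by blast
    then show False using sq by (simp add: G_def)
  qed
  have "measure ?SS (space ?SS - G) \<le> measure ?SS (\<Union>q\<in>cells L. low H1 q \<union> low H2 q)"
    using lows H finite_cells by (intro SS.finite_measure_mono[OF sub] sets.finite_UN) auto
  also have "\<dots> \<le> (\<Sum>q\<in>cells L. measure ?SS (low H1 q \<union> low H2 q))"
    using lows H finite_cells by (intro SS.finite_measure_subadditive_finite) auto
  also have "\<dots> \<le> (\<Sum>q\<in>cells L. (real Q)\<^sup>2 / (real N' * \<tau>\<^sup>2) + (real Q)\<^sup>2 / (real N' * \<tau>\<^sup>2))"
    using lows H by (intro sum_mono order_trans[OF measure_Un_le] add_mono lowm) auto
  \<comment> \<open>There are \<open>2 * Q\<close> events, two halves for each cell, each of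
    probability at most Q^2 / (N' \<tau>^2). Passing from \<open>N'\<close> to \<open>N / 3\<close>
    turns the 2 into 6.\<close>
  also have "\<dots> = 2 * real Q ^ 3 / \<tau>\<^sup>2 / real N'"
    by (simp add: Q_def[symmetric] power2_eq_square power3_eq_cube mult_ac)
  also have "\<dots> \<le> 2 * real Q ^ 3 / \<tau>\<^sup>2 / (real N / 3)"
    using N N' \<tau> by (intro divide_left_mono) auto
  finally have "measure ?SS (space ?SS - G) \<le> 6 * real Q ^ 3 / \<tau>\<^sup>2 / real N" by simp
  then show ?thesis using p1 p2 pairing unfolding Q_def by blast
qed

end

section \<open>Ergodic interference alignment\<close>

text \<open>Sections over \<open>G\<close> have measure at most \<open>c\<close>, all others at most
  one. It is applied twice: over the states, and over states together with noise.\<close>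

lemma measure_pair_le:
  assumes A: "prob_space A" and B: "prob_space B" and S: "S \<in> sets (A \<Otimes>\<^sub>M B)" and G: "G \<in> sets A"
    and c: "0 \<le> c" "\<And>x. x \<in> G \<Longrightarrow> measure B (Pair x -` S) \<le> c"
  shows "measure (A \<Otimes>\<^sub>M B) S \<le> measure A (space A - G) + c"
proof -
  interpret A: prob_space A by fact
  interpret B: prob_space B by fact
  have 1: "has_bochner_integral A (\<lambda>x. measure B (Pair x -` S)) (measure (A \<Otimes>\<^sub>M B) S)"
    by (rule has_bochner_integral_measure_section[OF A B S])
  have 2: "has_bochner_integral A (\<lambda>x. indicator (space A - G) x + c) (measure A (space A - G) + c)"
    using G A.prob_space
    by (intro has_bochner_integral_add has_bochner_integral_real_indicator)
       (auto simp: has_bochner_integral_iff A.emeasure_eq_measure)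
  have "integral\<^sup>L A (\<lambda>x. measure B (Pair x -` S)) \<le> integral\<^sup>L A (\<lambda>x. indicator (space A - G) x + c)"
  proof (rule integral_mono)
    fix x assume "x \<in> space A"
    then show "measure B (Pair x -` S) \<le> indicator (space A - G) x + c"
      using c B.prob_le_1[of "Pair x -` S"] by (cases "x \<in> G") (auto simp: add_increasing2)
  qed (use 1 2 in \<open>auto simp: has_bochner_integral_iff\<close>)
  then show ?thesis
    unfolding has_bochner_integral_integral_eq[OF 1] has_bochner_integral_integral_eq[OF 2] .
qed

text \<open>The random coding argument: the mean over \<open>y\<close> of the summed section
  measures is at most \<open>card W * \<beta>\<close>, so not every \<open>y\<close> can exceed
  this. Summing over \<open>W\<close> before choosing \<open>y\<close> yields one codebook for all
  message tuples.\<close>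

lemma exists_good_parameter:
  assumes A: "prob_space A" and B: "prob_space B" and W: "finite W" "W \<noteq> {}"
    and S: "\<And>w. w \<in> W \<Longrightarrow> S w \<in> sets (A \<Otimes>\<^sub>M B)"
    and le: "\<And>w. w \<in> W \<Longrightarrow> measure (A \<Otimes>\<^sub>M B) (S w) \<le> \<beta>" and \<beta>: "\<beta> < \<beta>'"
  shows "\<exists>y\<in>space B. (\<Sum>w\<in>W. measure A ((\<lambda>x. (x, y)) -` S w)) < real (card W) * \<beta>'"
proof (rule ccontr)
  assume neg: "\<not> ?thesis"
  interpret A: prob_space A by fact
  interpret B: prob_space B by fact
  interpret AB: pair_prob_space A B ..
  have sec: "has_bochner_integral B (\<lambda>y. measure A ((\<lambda>x. (x, y)) -` S w)) (measure (A \<Otimes>\<^sub>M B) (S w))"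
    if w: "w \<in> W" for w
  proof (rule has_bochner_integral_nn_integral)
    have m: "(\<lambda>y. emeasure A ((\<lambda>x. (x, y)) -` S w)) \<in> borel_measurable B"
      using S[OF w] by (rule AB.measurable_emeasure_Pair2)
    show "(\<lambda>y. measure A ((\<lambda>x. (x, y)) -` S w)) \<in> borel_measurable B"
      using m unfolding measure_def by measurable
    show "(\<integral>\<^sup>+y. ennreal (measure A ((\<lambda>x. (x, y)) -` S w)) \<partial>B) = ennreal (measure (A \<Otimes>\<^sub>M B) (S w))"
      using S[OF w] by (simp add: A.emeasure_eq_measure[symmetric] AB.P.emeasure_eq_measure[symmetric] AB.emeasure_pair_measure_alt2)
  qed auto
  have I: "has_bochner_integral B (\<lambda>y. \<Sum>w\<in>W. measure A ((\<lambda>x. (x, y)) -` S w)) (\<Sum>w\<in>W. measure (A \<Otimes>\<^sub>M B) (S w))"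
    by (intro has_bochner_integral_sum sec)
  have "real (card W) * \<beta>' \<le> (\<integral>y. (\<Sum>w\<in>W. measure A ((\<lambda>x. (x, y)) -` S w)) \<partial>B)"
  proof -
    have "(\<integral>y. real (card W) * \<beta>' \<partial>B) \<le> (\<integral>y. (\<Sum>w\<in>W. measure A ((\<lambda>x. (x, y)) -` S w)) \<partial>B)"
      using neg I by (intro integral_mono) (auto simp: has_bochner_integral_iff not_less)
    then show ?thesis by (simp add: B.prob_space)
  qed
  also have "\<dots> \<le> (\<Sum>w\<in>W. \<beta>)"
    unfolding has_bochner_integral_integral_eq[OF I] by (intro sum_mono le)
  finally show False using \<beta> W by (simp add: card_gt_0_iff)
qed

section \<open>Encoder, decoder and the channel seen after combining\<close>

context equal_strength begin

text \<open>The leading factor undoes the direct phase, so that both copies of a symbol arrive in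
  phase at the intended receiver. The power \<open>P\<close> leaves room for fluctuations of the
  codebook energy.\<close>

definition enc :: "((nat \<Rightarrow> state) \<Rightarrow> nat \<Rightarrow> nat \<Rightarrow> bool) \<Rightarrow> nat \<Rightarrow> real \<Rightarrow> (nat \<times> nat \<times> nat \<Rightarrow> complex)
    \<Rightarrow> nat \<Rightarrow> nat \<Rightarrow> (nat \<Rightarrow> state) \<Rightarrow> nat \<Rightarrow> complex" where
  "enc A p P C t m sq n = cis (- snd (sq n) (t, t)) * of_real (sqrt P) * (\<Sum>i<p. of_bool (A sq i n) * C (t, m, i))"

text \<open>The receiver adds the two copies of each symbol.\<close>
definition comb :: "nat \<Rightarrow> ((nat \<Rightarrow> state) \<Rightarrow> nat \<Rightarrow> nat \<Rightarrow> bool) \<Rightarrow> (nat \<Rightarrow> state) \<Rightarrow> (nat \<Rightarrow> complex) \<Rightarrow> nat \<Rightarrow> complex" where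
  "comb N A sq y i = (\<Sum>n<N. of_bool (A sq i n) * y n)"

text \<open>Outside \<open>decode_fail\<close> exactly one message passes the test, and
  \<open>LEAST\<close> merely names it.\<close>

definition dec :: "nat \<Rightarrow> nat \<Rightarrow> nat \<Rightarrow> real \<Rightarrow> real \<Rightarrow> ((nat \<Rightarrow> state) \<Rightarrow> nat \<Rightarrow> nat \<Rightarrow> bool) \<Rightarrow> (nat \<times> nat \<times> nat \<Rightarrow> complex)
    \<Rightarrow> nat \<Rightarrow> (nat \<Rightarrow> complex) \<times> (nat \<Rightarrow> state) \<Rightarrow> nat" where
  "dec N p M b \<gamma> A C k ys = (LEAST m. m < M \<and> \<gamma> \<le> (\<Sum>i<p. iden b (comb N A (snd ys) (fst ys) i) (C (k, m, i))))"

lemma dec_correct: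
  assumes "\<not> decode_fail b p M \<gamma> k m (comb N A sq y) C" "m < M"
  shows "dec N p M b \<gamma> A C k (y, sq) = m"
  unfolding dec_def fst_conv snd_conv
proof (rule Least_equality)
  show "m < M \<and> \<gamma> \<le> (\<Sum>i<p. iden b (comb N A sq y i) (C (k, m, i)))"
    using assms by (auto simp: decode_fail_def)
  fix m' assume m': "m' < M \<and> \<gamma> \<le> (\<Sum>i<p. iden b (comb N A sq y i) (C (k, m', i)))"
  then have "m' = m" using assms unfolding decode_fail_def by blast
  then show "m \<le> m'" by simp
qed

lemma comb_restrict: "comb N A sq (restrict y {..<N}) = comb N A sq y"
  by (simp add: comb_def fun_eq_iff)

lemma measurable_of_bool_pairing:
  assumes "is_pairing N p \<delta> A G" and s: "s \<in> measurable \<Omega> (state_seq_meas K D N)"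
  shows "(\<lambda>\<omega>. of_bool (A (s \<omega>) i n) :: complex) \<in> borel_measurable \<Omega>"
proof -
  have "{sq \<in> space (state_seq_meas K D N). A sq i n} \<in> sets (state_seq_meas K D N)"
    using assms by (auto simp: is_pairing_def)
  then have "(\<lambda>sq. A sq i n) \<in> measurable (state_seq_meas K D N) (count_space UNIV)"
    by (simp add: pred_def)
  from measurable_compose[OF measurable_compose[OF s this], of "of_bool :: bool \<Rightarrow> complex" borel]
  show ?thesis by simp
qed

lemma comb_measurable:
  assumes "is_pairing N p \<delta> A G" and "s \<in> measurable \<Omega> (state_seq_meas K D N)"
    and "\<And>n. n < N \<Longrightarrow> (\<lambda>\<omega>. y \<omega> n) \<in> borel_measurable \<Omega>"
  shows "(\<lambda>\<omega>. comb N A (s \<omega>) (y \<omega>) i) \<in> borel_measurable \<Omega>"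
  unfolding comb_def
  by (intro borel_measurable_sum borel_measurable_times measurable_of_bool_pairing[OF assms(1,2)] assms(3)) auto

lemma enc_measurable:
  assumes "is_pairing N p \<delta> A G" and s: "s \<in> measurable \<Omega> (state_seq_meas K D N)"
    and C: "\<And>i. i < p \<Longrightarrow> (\<lambda>\<omega>. C \<omega> (t, m, i)) \<in> borel_measurable \<Omega>"
    and t: "t \<in> {1..K}" and n: "n < N"
  shows "(\<lambda>\<omega>. enc A p P (C \<omega>) t m (s \<omega>) n) \<in> borel_measurable \<Omega>"
proof -
  have 1: "(\<lambda>\<omega>. cis (- snd (s \<omega> n) (t, t))) \<in> borel_measurable \<Omega>"
    by (intro borel_measurable_cis borel_measurable_uminus measurable_compose[OF s measurable_state_phase[OF n t t]])
  have 2: "(\<lambda>\<omega>. of_bool (A (s \<omega>) i n) * C \<omega> (t, m, i)) \<in> borel_measurable \<Omega>" if "i \<in> {..<p}" for i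
    using that by (intro borel_measurable_times measurable_of_bool_pairing[OF assms(1,2)] C) simp
  show ?thesis
    unfolding enc_def by (intro borel_measurable_times borel_measurable_const borel_measurable_sum 1 2)
qed

text \<open>After the phase correction the direct gain is the same in both states, so the wanted
  symbol is doubled. A cross gain \<open>d t i\<close> is the sum of two nearly opposite numbers and
  has size of order \<delta>.\<close>

lemma comb_received:
  assumes p: "is_pairing N p \<delta> A G" and P: "0 \<le> P" and sq: "sq \<in> G"
    and gain: "\<forall>n<N. \<forall>r\<in>{1..K}. \<forall>t\<in>{1..K}. gain SNR (sq n) r t = complex_of_real (sqrt SNR) * cis (snd (sq n) (r, t))"
    and k: "k \<in> {1..K}"
  obtains a b d where "inj_on a {..<p}" "inj_on b {..<p}" "a ` {..<p} \<subseteq> {..<N}" "b ` {..<p} \<subseteq> {..<N}"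
    "a ` {..<p} \<inter> b ` {..<p} = {}"
    "\<And>y i. i < p \<Longrightarrow> comb N A sq y i = y (a i) + y (b i)"
    "\<And>t i. i < p \<Longrightarrow> t \<in> {1..K} - {k} \<Longrightarrow> cmod (d t i) \<le> sqrt (SNR * P) * \<delta>"
    "\<And>C w z i. i < p \<Longrightarrow> comb N A sq (\<lambda>n. sig (enc A p P C) w sq k n + z n) i
       = of_real (2 * sqrt (SNR * P)) * C (k, w k, i) + (\<Sum>t\<in>{1..K} - {k}. d t i * C (t, w t, i)) + comb N A sq z i"
proof -
  obtain a b where ab: "inj_on a {..<p}" "inj_on b {..<p}" "a ` {..<p} \<subseteq> {..<N}" "b ` {..<p} \<subseteq> {..<N}"
    "a ` {..<p} \<inter> b ` {..<p} = {}" and Aab: "\<forall>i<p. \<forall>n. A sq i n \<longleftrightarrow> n = a i \<or> n = b i"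
    and cancel: "\<forall>i<p. \<forall>r\<in>{1..K}. \<forall>t\<in>{1..K}. r \<noteq> t \<longrightarrow>
           cmod (cis (snd (sq (a i)) (r, t) - snd (sq (a i)) (t, t))
             + cis (snd (sq (b i)) (r, t) - snd (sq (b i)) (t, t))) \<le> \<delta>"
    using bspec[OF p[unfolded is_pairing_def, THEN conjunct2, THEN conjunct2, THEN conjunct2] sq]
    by (elim exE conjE) (rule that; assumption)
  have uniq: "A sq i n \<Longrightarrow> A sq j n \<Longrightarrow> i < p \<Longrightarrow> j < p \<Longrightarrow> i = j" for i j n
    using p[unfolded is_pairing_def, THEN conjunct2, THEN conjunct2, THEN conjunct1] by blast
  have rng: "a i < N" "b i < N" "a i \<noteq> b i" if "i < p" for i using ab that by auto
  have comb: "comb N A sq y i = y (a i) + y (b i)" if i: "i < p" for y i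
  proof -
    have "comb N A sq y i = (\<Sum>n\<in>{a i, b i}. y n)"
      unfolding comb_def
      by (rule sum.mono_neutral_cong_right) (use Aab i rng[OF i] in auto)
    then show ?thesis using rng[OF i] by simp
  qed
  \<comment> \<open>The phase factor of the link from \<open>t\<close> to \<open>k\<close> after
    \<open>t\<close> has removed its own direct phase; it is 1 for \<open>t = k\<close>.\<close>
  define e where "e n t = cis (snd (sq n) (k, t) - snd (sq n) (t, t))" for n t
  define d where "d t i = of_real (sqrt (SNR * P)) * (e (a i) t + e (b i) t)" for t i
  \<comment> \<open>All users follow the same schedule \<open>A\<close>, so at time \<open>n\<close>
    each of them sends its symbol \<open>i\<close> and no other.\<close>
  have sigA: "sig (enc A p P C) w sq k n = of_real (sqrt (SNR * P)) * (\<Sum>t\<in>{1..K}. e n t * C (t, w t, i))"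
    if i: "i < p" and n: "n < N" and Ain: "A sq i n" for C w i n
  proof -
    have nA: "\<not> A sq j n" if "j < p" "j \<noteq> i" for j using uniq[OF Ain _ i that(1)] that(2) by blast
    have "(\<Sum>j<p. of_bool (A sq j n) * C (t, m, j)) = C (t, m, i)" for t m
    proof -
      have "(\<Sum>j<p. of_bool (A sq j n) * C (t, m, j)) = (\<Sum>j\<in>{i}. C (t, m, j))"
        by (rule sum.mono_neutral_cong_right) (use i Ain nA in auto)
      then show ?thesis by simp
    qed
    then have "gain SNR (sq n) k t * enc A p P C t (w t) sq n = of_real (sqrt (SNR * P)) * (e n t * C (t, w t, i))"
      if "t \<in> {1..K}" for t
    proof -
      have "e n t = cis (snd (sq n) (k, t)) * cis (- snd (sq n) (t, t))" by (simp add: e_def cis_mult)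
      then show ?thesis
        using gain n k that \<open>\<And>t m. (\<Sum>j<p. of_bool (A sq j n) * C (t, m, j)) = C (t, m, i)\<close>
        by (simp add: enc_def real_sqrt_mult mult_ac)
    qed
    then show ?thesis unfolding sig_def sum_distrib_left by (intro sum.cong refl) auto
  qed
  have rec: "comb N A sq (\<lambda>n. sig (enc A p P C) w sq k n + z n) i
       = of_real (2 * sqrt (SNR * P)) * C (k, w k, i) + (\<Sum>t\<in>{1..K} - {k}. d t i * C (t, w t, i)) + comb N A sq z i"
    if i: "i < p" for C w z i
  proof -
    have "sig (enc A p P C) w sq k (a i) + sig (enc A p P C) w sq k (b i) = (\<Sum>t\<in>{1..K}. d t i * C (t, w t, i))"
      using sigA[OF i rng(1)[OF i]] sigA[OF i rng(2)[OF i]] Aab i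
      by (simp add: d_def sum_distrib_left sum.distrib[symmetric] algebra_simps)
    also have "\<dots> = d k i * C (k, w k, i) + (\<Sum>t\<in>{1..K} - {k}. d t i * C (t, w t, i))"
      using k by (subst sum.remove[of _ k]) auto
    also have "d k i = of_real (2 * sqrt (SNR * P))" by (simp add: d_def e_def)
    finally show ?thesis unfolding comb[OF i] by (simp add: algebra_simps)
  qed
  have dle: "cmod (d t i) \<le> sqrt (SNR * P) * \<delta>" if "i < p" "t \<in> {1..K} - {k}" for t i
    using cancel k that P SNR unfolding d_def e_def norm_mult by (auto intro!: mult_mono)
  show ?thesis by (rule that[OF ab comb dle rec])
qed

text \<open>At most one symbol is sent at a time, so the sum over the messages is that of one
  codebook column, scaled by \<open>P\<close>. This holds for each state sequence and not only on
  average.\<close>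

lemma enc_power:
  assumes p: "is_pairing N p \<delta> A G" and P: "0 \<le> P" "P * (1 + \<tau>) \<le> 1"
    and C: "\<And>i. i < p \<Longrightarrow> (\<Sum>m<M. (cmod (C (t, m, i)))\<^sup>2) \<le> (1 + \<tau>) * real M"
  shows "(\<Sum>m<M. (cmod (enc A p P C t m sq n))\<^sup>2) \<le> real M"
proof (cases "\<exists>i<p. A sq i n")
  case False
  then have "enc A p P C t m sq n = 0" for m by (simp add: enc_def)
  then show ?thesis by simp
next
  case True
  then obtain i where i: "i < p" "A sq i n" by blast
  have nA: "\<not> A sq j n" if "j < p" "j \<noteq> i" for j
    using p[unfolded is_pairing_def, THEN conjunct2, THEN conjunct2, THEN conjunct1] i that by blast
  have "(\<Sum>j<p. of_bool (A sq j n) * C (t, m, j)) = C (t, m, i)" for m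
  proof -
    have "(\<Sum>j<p. of_bool (A sq j n) * C (t, m, j)) = (\<Sum>j\<in>{i}. C (t, m, j))"
      by (rule sum.mono_neutral_cong_right) (use i nA in auto)
    then show ?thesis by simp
  qed
  then have "(\<Sum>m<M. (cmod (enc A p P C t m sq n))\<^sup>2) = P * (\<Sum>m<M. (cmod (C (t, m, i)))\<^sup>2)"
    using P by (simp add: enc_def norm_mult power_mult_distrib sum_distrib_left)
  also have "\<dots> \<le> P * ((1 + \<tau>) * real M)" using P C[OF i(1)] by (intro mult_left_mono) auto
  also have "\<dots> \<le> 1 * real M" unfolding mult.assoc[symmetric] by (intro mult_right_mono P) auto
  finally show ?thesis by simp
qed

lemma is_code_random:
  assumes p: "is_pairing N p \<delta> A G" and P: "0 \<le> P" "P * (1 + \<tau>) \<le> 1" and N: "0 < N" and M: "1 \<le> M"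
    and C: "\<And>t i. t \<in> {1..K} \<Longrightarrow> i < p \<Longrightarrow> (\<Sum>m<M. (cmod (C (t, m, i)))\<^sup>2) \<le> (1 + \<tau>) * real M"
  shows "is_code K SNR D N (\<lambda>_. M) (enc A p P C) (dec N p M b \<gamma> A C)"
  unfolding is_code_def
proof (intro conjI ballI allI impI)
  let ?S = "state_seq_meas K D N"
  interpret S: prob_space ?S by (rule prob_state_seq)
  show "0 < N" by fact
  show "1 \<le> M" by fact
  show em: "(\<lambda>sq. enc A p P C t m sq n) \<in> borel_measurable ?S" if "t \<in> {1..K}" "n < N" for t m n
    using enc_measurable[OF p measurable_ident, of "\<lambda>_. C" t m n P] that by (simp add: id_def)
  show "dec N p M b \<gamma> A C k \<in> measurable (PiM {..<N} (\<lambda>_. borel) \<Otimes>\<^sub>M ?S) (count_space UNIV)" for k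
  proof -
    let ?\<Omega> = "PiM {..<N} (\<lambda>_. borel) \<Otimes>\<^sub>M ?S :: ((nat \<Rightarrow> complex) \<times> (nat \<Rightarrow> state)) measure"
    have y: "(\<lambda>ys. fst ys n) \<in> borel_measurable ?\<Omega>" if "n < N" for n
      by (rule measurable_compose[OF measurable_fst measurable_component_singleton]) (use that in simp)
    have "(\<lambda>ys. \<Sum>i<p. iden b (comb N A (snd ys) (fst ys) i) (C (k, m, i))) \<in> borel_measurable ?\<Omega>" for m
      by (intro borel_measurable_sum iden_measurable comb_measurable[OF p measurable_snd y] borel_measurable_const)
    then have [measurable]: "Measurable.pred ?\<Omega> (\<lambda>ys. \<gamma> \<le> (\<Sum>i<p. iden b (comb N A (snd ys) (fst ys) i) (C (k, m, i))))" for m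
      unfolding pred_def by (rule borel_measurable_le[OF borel_measurable_const])
    show ?thesis unfolding dec_def[abs_def] by measurable
  qed
  show "ennreal (1 / real M) * (\<Sum>m<M. \<integral>\<^sup>+ sq. ennreal ((cmod (enc A p P C t m sq n))\<^sup>2) \<partial>?S) \<le> 1"
    if t: "t \<in> {1..K}" and n: "n < N" for t n
  proof -
    have [measurable]: "(\<lambda>sq. enc A p P C t m sq n) \<in> borel_measurable ?S" for m by (rule em[OF t n])
    have "(\<Sum>m<M. \<integral>\<^sup>+ sq. ennreal ((cmod (enc A p P C t m sq n))\<^sup>2) \<partial>?S)
        = (\<integral>\<^sup>+ sq. (\<Sum>m<M. ennreal ((cmod (enc A p P C t m sq n))\<^sup>2)) \<partial>?S)"
      by (rule nn_integral_sum[symmetric]) measurable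
    also have "\<dots> \<le> (\<integral>\<^sup>+ sq. ennreal (real M) \<partial>?S)"
      using enc_power[OF p P C[OF t]] by (intro nn_integral_mono) (simp add: sum_ennreal ennreal_leI)
    also have "\<dots> = ennreal (real M)" by (simp add: S.emeasure_space_1)
    finally have "ennreal (1 / real M) * (\<Sum>m<M. \<integral>\<^sup>+ sq. ennreal ((cmod (enc A p P C t m sq n))\<^sup>2) \<partial>?S)
      \<le> ennreal (1 / real M) * ennreal (real M)" by (intro mult_left_mono) auto
    also have "\<dots> = 1" using M by (simp add: ennreal_mult[symmetric])
    finally show ?thesis .
  qed
qed

text \<open>The almost sure event of \<open>AE_state_seq_gain\<close> as a measurable set, so that
  it can be intersected with the good states.\<close>

definition gain_ok :: "nat \<Rightarrow> (nat \<Rightarrow> state) set" where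
  "gain_ok N = {sq \<in> space (state_seq_meas K D N). \<forall>n\<in>{..<N}. \<forall>r\<in>{1..K}. \<forall>t\<in>{1..K}.
     gain SNR (sq n) r t = complex_of_real (sqrt SNR) * cis (snd (sq n) (r, t))}"

lemma gain_ok_sets: "gain_ok N \<in> sets (state_seq_meas K D N)"
  unfolding gain_ok_def
proof (intro sets.sets_Collect_finite_All finite_lessThan finite_atLeastAtMost)
  fix n r t assume *: "n \<in> {..<N}" "r \<in> {1..K}" "t \<in> {1..K}"
  have "(\<lambda>sq. gain SNR (sq n) r t - complex_of_real (sqrt SNR) * cis (snd (sq n) (r, t))) \<in> borel_measurable (state_seq_meas K D N)"
    using * by (intro borel_measurable_diff borel_measurable_times borel_measurable_const borel_measurable_cis
        measurable_state_phase measurable_gain) auto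
  from measurable_sets[OF this, of "{0}"] show "{sq \<in> space (state_seq_meas K D N). gain SNR (sq n) r t = complex_of_real (sqrt SNR) * cis (snd (sq n) (r, t))}
      \<in> sets (state_seq_meas K D N)"
    by (simp add: vimage_def Int_def conj_commute)
qed

lemma gain_ok_measure: "measure (state_seq_meas K D N) (space (state_seq_meas K D N) - gain_ok N) = 0"
proof -
  interpret S: prob_space "state_seq_meas K D N" by (rule prob_state_seq)
  have "AE sq in state_seq_meas K D N. sq \<in> gain_ok N"
    using AE_state_seq_gain[of N] AE_space by eventually_elim (auto simp: gain_ok_def)
  then have "measure (state_seq_meas K D N) (gain_ok N) = 1"
    using gain_ok_sets by (subst S.prob_eq_1) auto
  then show ?thesis using S.prob_compl[OF gain_ok_sets] by simp
qed

section \<open>Error events of the random code\<close>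

lemma noise_deviation:
  assumes p: "is_pairing N p \<delta> A G" and p0: "0 < p" and \<tau>: "0 < \<tau>" and k: "k \<in> {1..K}"
    and sq: "sq \<in> G" "sq \<in> gain_ok N"
  shows "measure (noise_seq_meas K N) {z \<in> space (noise_seq_meas K N).
     \<tau> * real p \<le> \<bar>\<Sum>i<p. (cmod (comb N A sq (\<lambda>n. z (n, k)) i))\<^sup>2 - 2\<bar>} \<le> cmod2_sum_var / (real p * \<tau>\<^sup>2)"
proof -
  have gain: "\<forall>n<N. \<forall>r\<in>{1..K}. \<forall>t\<in>{1..K}. gain SNR (sq n) r t = complex_of_real (sqrt SNR) * cis (snd (sq n) (r, t))"
    using sq(2) by (auto simp: gain_ok_def)
  \<comment> \<open>Only the two sending times are wanted here; \<open>order_refl\<close>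
    instantiates the power with 0.\<close>
  obtain a b where ab: "inj_on a {..<p}" "inj_on b {..<p}" "a ` {..<p} \<subseteq> {..<N}" "b ` {..<p} \<subseteq> {..<N}"
    "a ` {..<p} \<inter> b ` {..<p} = {}"
    and comb: "\<And>y i. i < p \<Longrightarrow> comb N A sq y i = y (a i) + y (b i)"
    by (rule comb_received[OF p order_refl sq(1) gain k]) (rule that; assumption)
  have "measure (noise_seq_meas K N) {z \<in> space (noise_seq_meas K N).
     \<tau> * real p \<le> \<bar>\<Sum>i<p. (cmod (z (a i, k) + z (b i, k)))\<^sup>2 - 2\<bar>} \<le> real (card {..<p}) * cmod2_sum_var / (\<tau> * real p)\<^sup>2"
    unfolding noise_seq_meas_def
    by (rule cmod2_sum_deviation) (use ab k p0 \<tau> in \<open>auto simp: inj_on_def\<close>)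
  also have "\<dots> = cmod2_sum_var / (real p * \<tau>\<^sup>2)" using p0 by (simp add: power2_eq_square)
  finally show ?thesis by (simp add: comb)
qed

text \<open>The power constraint of the random codebook is treated as one more error event, so that a
  codebook with error sum below one satisfies it automatically.\<close>
definition power_bad :: "nat \<Rightarrow> nat \<Rightarrow> real \<Rightarrow> (nat \<times> nat \<times> nat \<Rightarrow> complex) \<Rightarrow> bool" where
  "power_bad M p \<tau> C \<longleftrightarrow> (\<exists>t\<in>{1..K}. \<exists>i\<in>{..<p}. \<tau> * real M \<le> \<bar>\<Sum>m<M. (cmod (C (t, m, i)))\<^sup>2 - 1\<bar>)"

lemma power_bad_sets: "{C \<in> space (codebooks K M p). power_bad M p \<tau> C} \<in> sets (codebooks K M p)"
  unfolding power_bad_def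
proof (intro sets.sets_Collect_finite_Ex finite_lessThan finite_atLeastAtMost)
  fix t i assume *: "t \<in> {1..K}" "i \<in> {..<p}"
  have "(\<lambda>C. C (t, m, i)) \<in> borel_measurable (codebooks K M p)" if "m \<in> {..<M}" for m
    using * that by (intro measurable_codebook_entry) auto
  then have "(\<lambda>C. \<bar>\<Sum>m<M. (cmod (C (t, m, i)))\<^sup>2 - 1\<bar>) \<in> borel_measurable (codebooks K M p)"
    by (intro borel_measurable_abs borel_measurable_sum borel_measurable_diff borel_measurable_power
        measurable_compose[OF _ borel_measurable_norm] borel_measurable_const)
  then show "{C \<in> space (codebooks K M p). \<tau> * real M \<le> \<bar>\<Sum>m<M. (cmod (C (t, m, i)))\<^sup>2 - 1\<bar>} \<in> sets (codebooks K M p)"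
    by (rule borel_measurable_le[OF borel_measurable_const])
qed

text \<open>Each of the \<open>K * p\<close> columns has \<open>M\<close> independent entries. The
  bound is useful because \<open>M\<close> will grow exponentially in the block length and
  \<open>p\<close> only linearly.\<close>

lemma power_bad_measure:
  assumes \<tau>: "0 < \<tau>" and M: "1 \<le> M"
  shows "measure (codebooks K M p) {C \<in> space (codebooks K M p). power_bad M p \<tau> C}
    \<le> real K * real p * cmod2_var / (real M * \<tau>\<^sup>2)"
proof -
  interpret CB: prob_space "codebooks K M p" by (rule prob_space_codebooks)
  define B where "B t i = {C \<in> space (codebooks K M p). \<tau> * real M \<le> \<bar>\<Sum>m<M. (cmod (C (t, m, i)))\<^sup>2 - 1\<bar>}" for t i
  have eq: "(\<Sum>m<M. (cmod (C (t, m, i)))\<^sup>2 - 1) = (\<Sum>j\<in>{t} \<times> {..<M} \<times> {i}. (cmod (C j))\<^sup>2 - 1)"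
    for C :: "nat \<times> nat \<times> nat \<Rightarrow> complex" and t i
  proof -
    have "bij_betw (\<lambda>m. (t, m, i)) {..<M} ({t} \<times> {..<M} \<times> {i})" by (auto simp: bij_betw_def inj_on_def)
    from sum.reindex_bij_betw[OF this, of "\<lambda>j. (cmod (C j))\<^sup>2 - 1"] show ?thesis by simp
  qed
  have Bm: "measure (codebooks K M p) (B t i) \<le> cmod2_var / (real M * \<tau>\<^sup>2)" if "t \<in> {1..K}" "i < p" for t i
  proof -
    have "measure (codebooks K M p) (B t i) \<le> real (card ({t} \<times> {..<M} \<times> {i})) * cmod2_var / (\<tau> * real M)\<^sup>2"
      unfolding B_def eq codebooks_def
      using that \<tau> M by (intro cmod2_deviation) auto
    also have "\<dots> = cmod2_var / (real M * \<tau>\<^sup>2)" using M by (simp add: power2_eq_square)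
    finally show ?thesis .
  qed
  have Bs: "B t i \<in> sets (codebooks K M p)" if "t \<in> {1..K}" "i < p" for t i
  proof -
    have "(\<lambda>C. C (t, m, i)) \<in> borel_measurable (codebooks K M p)" if "m \<in> {..<M}" for m
      using \<open>t \<in> {1..K}\<close> \<open>i < p\<close> that by (intro measurable_codebook_entry) auto
    then have "(\<lambda>C. \<bar>\<Sum>m<M. (cmod (C (t, m, i)))\<^sup>2 - 1\<bar>) \<in> borel_measurable (codebooks K M p)"
      by (intro borel_measurable_abs borel_measurable_sum borel_measurable_diff borel_measurable_power
          measurable_compose[OF _ borel_measurable_norm] borel_measurable_const)
    then show ?thesis unfolding B_def by (rule borel_measurable_le[OF borel_measurable_const])
  qed
  define bad where "bad C t i \<longleftrightarrow> \<tau> * real M \<le> \<bar>\<Sum>m<M. (cmod (C (t, m, i)))\<^sup>2 - 1\<bar>"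
    for C :: "nat \<times> nat \<times> nat \<Rightarrow> complex" and t i
  have "{C \<in> space (codebooks K M p). power_bad M p \<tau> C} = (\<Union>x\<in>{1..K} \<times> {..<p}. B (fst x) (snd x))"
    unfolding power_bad_def B_def bad_def[symmetric] by (auto simp: Bex_def) blast+
  also have "measure (codebooks K M p) \<dots> \<le> (\<Sum>x\<in>{1..K} \<times> {..<p}. measure (codebooks K M p) (B (fst x) (snd x)))"
    using Bs by (intro CB.finite_measure_subadditive_finite) auto
  also have "\<dots> \<le> (\<Sum>x\<in>{1..K} \<times> {..<p}. cmod2_var / (real M * \<tau>\<^sup>2))"
    by (intro sum_mono Bm) auto
  finally show ?thesis by simp
qed

lemma received_measurable:
  assumes p: "is_pairing N p \<delta> A G" and w: "\<And>t. t \<in> {1..K} \<Longrightarrow> w t < M" and k: "k \<in> {1..K}"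
  shows "(\<lambda>\<omega>. comb N A (fst (fst \<omega>)) (\<lambda>n. sig (enc A p P (snd \<omega>)) w (fst (fst \<omega>)) k n + snd (fst \<omega>) (n, k)) i)
    \<in> borel_measurable (exper K D N \<Otimes>\<^sub>M codebooks K M p)"
proof -
  let ?\<Omega> = "exper K D N \<Otimes>\<^sub>M codebooks K M p"
  have s: "(\<lambda>\<omega>. fst (fst \<omega>)) \<in> measurable ?\<Omega> (state_seq_meas K D N)"
    unfolding exper_def by (rule measurable_compose[OF measurable_fst measurable_fst])
  have C: "(\<lambda>\<omega>. snd \<omega> (t, m, i)) \<in> borel_measurable ?\<Omega>" if "t \<in> {1..K}" "m < M" "i < p" for t m i
    by (rule measurable_compose[OF measurable_snd measurable_codebook_entry[OF that]])
  have z: "(\<lambda>\<omega>. snd (fst \<omega>) (n, k)) \<in> borel_measurable ?\<Omega>" if "n < N" for n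
  proof -
    have "(\<lambda>z. z (n, k)) \<in> measurable (noise_seq_meas K N) cgauss"
      unfolding noise_seq_meas_def using that k by (intro measurable_component_singleton) auto
    then have "(\<lambda>z. z (n, k)) \<in> borel_measurable (noise_seq_meas K N)"
      by (simp cong: measurable_cong_sets)
    then show ?thesis
      unfolding exper_def by (intro measurable_compose[OF measurable_compose[OF measurable_fst measurable_snd]])
  qed
  show ?thesis
    unfolding sig_def
    by (intro comb_measurable[OF p s] borel_measurable_add borel_measurable_sum borel_measurable_times z
        measurable_compose[OF s measurable_gain] enc_measurable[OF p s] C w k) auto
qed

text \<open>It lives on the joint space of experiment and codebook, so that averaging over codebooks
  becomes a statement about sections. The code built from a codebook \<open>C\<close> errs only
  inside the section at \<open>C\<close>.\<close>

definition bad_event :: "nat \<Rightarrow> nat \<Rightarrow> nat \<Rightarrow> real \<Rightarrow> real \<Rightarrow> real \<Rightarrow> real \<Rightarrow> ((nat \<Rightarrow> state) \<Rightarrow> nat \<Rightarrow> nat \<Rightarrow> bool) \<Rightarrow> (nat \<Rightarrow> nat)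
    \<Rightarrow> (((nat \<Rightarrow> state) \<times> (nat \<times> nat \<Rightarrow> complex)) \<times> (nat \<times> nat \<times> nat \<Rightarrow> complex)) set" where
  "bad_event N p M P b \<gamma> \<tau> A w = {\<omega> \<in> space (exper K D N \<Otimes>\<^sub>M codebooks K M p).
     (\<exists>k\<in>{1..K}. decode_fail b p M \<gamma> k (w k)
        (comb N A (fst (fst \<omega>)) (\<lambda>n. sig (enc A p P (snd \<omega>)) w (fst (fst \<omega>)) k n + snd (fst \<omega>) (n, k))) (snd \<omega>))
     \<or> power_bad M p \<tau> (snd \<omega>)}"

lemma bad_event_sets:
  assumes p: "is_pairing N p \<delta> A G" and w: "\<And>t. t \<in> {1..K} \<Longrightarrow> w t < M"
  shows "bad_event N p M P b \<gamma> \<tau> A w \<in> sets (exper K D N \<Otimes>\<^sub>M codebooks K M p)"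
proof -
  let ?\<Omega> = "exper K D N \<Otimes>\<^sub>M codebooks K M p"
  define Y where "Y k \<omega> = comb N A (fst (fst \<omega>)) (\<lambda>n. sig (enc A p P (snd \<omega>)) w (fst (fst \<omega>)) k n + snd (fst \<omega>) (n, k))"
    for k and \<omega> :: "((nat \<Rightarrow> state) \<times> (nat \<times> nat \<Rightarrow> complex)) \<times> (nat \<times> nat \<times> nat \<Rightarrow> complex)"
  have E: "(\<lambda>\<omega>. \<Sum>i<p. iden b (Y k \<omega> i) (snd \<omega> (k, m, i))) \<in> borel_measurable ?\<Omega>" if "k \<in> {1..K}" "m < M" for k m
    unfolding Y_def using that
    by (intro borel_measurable_sum iden_measurable received_measurable[OF p w]
        measurable_compose[OF measurable_snd measurable_codebook_entry]) auto
  have 1: "{\<omega> \<in> space ?\<Omega>. decode_fail b p M \<gamma> k (w k) (Y k \<omega>) (snd \<omega>)} \<in> sets ?\<Omega>" if k: "k \<in> {1..K}" for k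
  proof -
    have a: "{\<omega> \<in> space ?\<Omega>. (\<Sum>i<p. iden b (Y k \<omega> i) (snd \<omega> (k, w k, i))) < \<gamma>} \<in> sets ?\<Omega>"
      using borel_measurable_less[OF E[OF k w[OF k]] borel_measurable_const] .
    have b: "{\<omega> \<in> space ?\<Omega>. m \<noteq> w k \<and> \<gamma> \<le> (\<Sum>i<p. iden b (Y k \<omega> i) (snd \<omega> (k, m, i)))} \<in> sets ?\<Omega>" if "m \<in> {..<M}" for m
      using borel_measurable_le[OF borel_measurable_const E[OF k], of m \<gamma>] that by (cases "m = w k") auto
    have c: "{\<omega> \<in> space ?\<Omega>. \<exists>m\<in>{..<M}. m \<noteq> w k \<and> \<gamma> \<le> (\<Sum>i<p. iden b (Y k \<omega> i) (snd \<omega> (k, m, i)))} \<in> sets ?\<Omega>"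
      by (intro sets.sets_Collect_finite_Ex b) auto
    show ?thesis
      using sets.sets_Collect_disj[OF c a] unfolding decode_fail_def Bex_def lessThan_iff .
  qed
  have 2: "{\<omega> \<in> space ?\<Omega>. power_bad M p \<tau> (snd \<omega>)} \<in> sets ?\<Omega>"
  proof -
    have "snd -` {C \<in> space (codebooks K M p). power_bad M p \<tau> C} \<inter> space ?\<Omega> \<in> sets ?\<Omega>"
      by (rule measurable_sets[OF measurable_snd power_bad_sets])
    also have "snd -` {C \<in> space (codebooks K M p). power_bad M p \<tau> C} \<inter> space ?\<Omega> = {\<omega> \<in> space ?\<Omega>. power_bad M p \<tau> (snd \<omega>)}"
      by (auto simp: space_pair_measure)
    finally show ?thesis .
  qed
  have 3: "{\<omega> \<in> space ?\<Omega>. \<exists>k\<in>{1..K}. decode_fail b p M \<gamma> k (w k) (Y k \<omega>) (snd \<omega>)} \<in> sets ?\<Omega>"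
    by (intro sets.sets_Collect_finite_Ex 1) auto
  show ?thesis
    using sets.sets_Collect_disj[OF 2 3] unfolding bad_event_def Y_def .
qed

text \<open>The terms follow the order in which randomness is fixed: states without a pairing,
  combined noise of atypical energy, then, with states and noise held fixed, failures of the
  threshold test and codebooks of excessive power.\<close>

lemma bad_event_measure:
  assumes p: "is_pairing N p \<delta> A G" and p0: "0 < p" and \<tau>: "0 < \<tau>" "\<tau> < 1" and M: "1 \<le> M"
    and w: "\<And>t. t \<in> {1..K} \<Longrightarrow> w t < M" and \<delta>: "2 * (real K)\<^sup>2 * (SNR * \<delta>\<^sup>2) \<le> \<tau>\<^sup>2"
    and P: "P = 1 - \<tau>" and b: "b = 2 * sqrt (SNR * P)" and \<gamma>: "\<gamma> = real p * (ln (1 + b\<^sup>2 / 2) - 6 * \<tau>)"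
  shows "measure (exper K D N \<Otimes>\<^sub>M codebooks K M p) (bad_event N p M P b \<gamma> \<tau> A w)
    \<le> measure (state_seq_meas K D N) (space (state_seq_meas K D N) - G) + real K * (cmod2_sum_var / (real p * \<tau>\<^sup>2))
      + (real K * ((real K * cmod2_var + 3) / (real p * \<tau>\<^sup>2) + real M * exp (- \<gamma>))
        + real K * real p * cmod2_var / (real M * \<tau>\<^sup>2))"
proof -
  let ?S = "state_seq_meas K D N" and ?Z = "noise_seq_meas K N" and ?X = "exper K D N" and ?CB = "codebooks K M p"
  interpret S: prob_space ?S by (rule prob_state_seq)
  interpret Z: prob_space ?Z by (rule prob_space_noise_seq_meas)
  interpret X: prob_space ?X by (rule prob_exper)
  interpret CB: prob_space ?CB by (rule prob_space_codebooks)
  have P01: "0 \<le> P" "P \<le> 1" using \<tau> P by auto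
  have b0: "0 \<le> b" using b P01 SNR by simp
  define G0 where "G0 = G \<inter> gain_ok N"
  have Gs: "G \<in> sets ?S" using p by (simp add: is_pairing_def)
  have G0s: "G0 \<in> sets ?S" unfolding G0_def using Gs gain_ok_sets by auto
  have mG0: "measure ?S (space ?S - G0) \<le> measure ?S (space ?S - G)"
  proof -
    have "measure ?S (space ?S - G0) \<le> measure ?S ((space ?S - G) \<union> (space ?S - gain_ok N))"
      using Gs gain_ok_sets by (intro S.finite_measure_mono) (auto simp: G0_def)
    also have "\<dots> \<le> measure ?S (space ?S - G) + measure ?S (space ?S - gain_ok N)"
      using Gs gain_ok_sets by (intro measure_Un_le) auto
    finally show ?thesis by (simp add: gain_ok_measure)
  qed
  define v where "v x k i = comb N A (fst x) (\<lambda>n. snd x (n, k)) i"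
    for x :: "(nat \<Rightarrow> state) \<times> (nat \<times> nat \<Rightarrow> complex)" and k i
  define V where "V = {x \<in> space ?X. \<exists>k\<in>{1..K}. \<tau> * real p \<le> \<bar>\<Sum>i<p. (cmod (v x k i))\<^sup>2 - 2\<bar>}"
  have Vs: "V \<in> sets ?X"
    unfolding V_def
  proof (intro sets.sets_Collect_finite_Ex finite_atLeastAtMost)
    fix k assume k: "k \<in> {1..K}"
    have z: "(\<lambda>x. snd x (n, k)) \<in> borel_measurable ?X" if "n < N" for n
    proof -
      have "(\<lambda>z. z (n, k)) \<in> measurable ?Z cgauss"
        unfolding noise_seq_meas_def using that k by (intro measurable_component_singleton) auto
      then have "(\<lambda>z. z (n, k)) \<in> borel_measurable ?Z" by (simp cong: measurable_cong_sets)
      then show ?thesis unfolding exper_def by (rule measurable_compose[OF measurable_snd])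
    qed
    have s: "fst \<in> measurable ?X ?S" unfolding exper_def by (rule measurable_fst)
    have "(\<lambda>x. \<bar>\<Sum>i<p. (cmod (v x k i))\<^sup>2 - 2\<bar>) \<in> borel_measurable ?X"
      unfolding v_def
      by (intro borel_measurable_abs borel_measurable_sum borel_measurable_diff borel_measurable_power
        measurable_compose[OF _ borel_measurable_norm] borel_measurable_const comb_measurable[OF p s] z)
    then show "{x \<in> space ?X. \<tau> * real p \<le> \<bar>\<Sum>i<p. (cmod (v x k i))\<^sup>2 - 2\<bar>} \<in> sets ?X"
      by (rule borel_measurable_le[OF borel_measurable_const])
  qed
  have mV: "measure ?X ((space ?X - G0 \<times> UNIV) \<union> V) \<le> measure ?S (space ?S - G0) + real K * (cmod2_sum_var / (real p * \<tau>\<^sup>2))"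
  proof -
    have s: "fst \<in> measurable ?X ?S" unfolding exper_def by (rule measurable_fst)
    have Gx: "G0 \<times> UNIV \<inter> space ?X \<in> sets ?X"
    proof -
      have "fst -` G0 \<inter> space ?X \<in> sets ?X" by (rule measurable_sets[OF s G0s])
      also have "fst -` G0 \<inter> space ?X = G0 \<times> UNIV \<inter> space ?X" by auto
      finally show ?thesis .
    qed
    have eq: "(space ?X - G0 \<times> UNIV) \<union> V = (space ?X - (G0 \<times> UNIV \<inter> space ?X)) \<union> V" by auto
    have "(space ?X - G0 \<times> UNIV) \<union> V \<in> sets ?X"
      unfolding eq by (rule sets.Un[OF sets.compl_sets[OF Gx] Vs])
    then have Us: "(space ?X - G0 \<times> UNIV) \<union> V \<in> sets (?S \<Otimes>\<^sub>M ?Z)"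
      unfolding exper_def .
    have "measure (?S \<Otimes>\<^sub>M ?Z) ((space ?X - G0 \<times> UNIV) \<union> V) \<le> measure ?S (space ?S - G0) + real K * (cmod2_sum_var / (real p * \<tau>\<^sup>2))"
    proof (rule measure_pair_le[OF prob_state_seq prob_space_noise_seq_meas Us G0s])
      show "0 \<le> real K * (cmod2_sum_var / (real p * \<tau>\<^sup>2))" using cmod2_sum_var_nonneg by simp
      fix sq assume sq: "sq \<in> G0"
      define B where "B k = {z \<in> space ?Z. \<tau> * real p \<le> \<bar>\<Sum>i<p. (cmod (comb N A sq (\<lambda>n. z (n, k)) i))\<^sup>2 - 2\<bar>}" for k
      have sqs: "sq \<in> space ?S" using sq G0s sets.sets_into_space by auto
      have Bs: "B k \<in> sets ?Z" if k: "k \<in> {1..K}" for k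
      proof -
        have z: "(\<lambda>z. z (n, k)) \<in> borel_measurable ?Z" if "n < N" for n
        proof -
          have "(\<lambda>z. z (n, k)) \<in> measurable ?Z cgauss"
            unfolding noise_seq_meas_def using that k by (intro measurable_component_singleton) auto
          then show ?thesis by (simp cong: measurable_cong_sets)
        qed
        have "(\<lambda>z. \<bar>\<Sum>i<p. (cmod (comb N A sq (\<lambda>n. z (n, k)) i))\<^sup>2 - 2\<bar>) \<in> borel_measurable ?Z"
          by (intro borel_measurable_abs borel_measurable_sum borel_measurable_diff borel_measurable_power
            measurable_compose[OF _ borel_measurable_norm] borel_measurable_const
            comb_measurable[OF p measurable_const[OF sqs]] z)
        then show ?thesis unfolding B_def by (rule borel_measurable_le[OF borel_measurable_const])
      qed
      have "Pair sq -` ((space ?X - G0 \<times> UNIV) \<union> V) \<subseteq> (\<Union>k\<in>{1..K}. B k)"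
        using sq unfolding V_def v_def B_def by (auto simp: exper_def space_pair_measure)
      then have "measure ?Z (Pair sq -` ((space ?X - G0 \<times> UNIV) \<union> V)) \<le> measure ?Z (\<Union>k\<in>{1..K}. B k)"
        using Bs by (intro Z.finite_measure_mono sets.finite_UN) auto
      also have "\<dots> \<le> (\<Sum>k\<in>{1..K}. measure ?Z (B k))"
        using Bs by (intro Z.finite_measure_subadditive_finite) auto
      also have "\<dots> \<le> (\<Sum>k\<in>{1..K}. cmod2_sum_var / (real p * \<tau>\<^sup>2))"
        unfolding B_def using sq by (intro sum_mono noise_deviation[OF p p0 \<tau>(1)]) (auto simp: G0_def)
      finally show "measure ?Z (Pair sq -` ((space ?X - G0 \<times> UNIV) \<union> V)) \<le> real K * (cmod2_sum_var / (real p * \<tau>\<^sup>2))" by simp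
    qed
    then show ?thesis unfolding exper_def .
  qed
  \<comment> \<open>States and noise that are both typical. Over them the combined noise is a fixed
    vector, as \<open>codebook_bound\<close> requires.\<close>
  define GX where "GX = space ?X - ((space ?X - G0 \<times> UNIV) \<union> V)"
  have s: "fst \<in> measurable ?X ?S" unfolding exper_def by (rule measurable_fst)
  have GXeq: "GX = (fst -` G0 \<inter> space ?X) - V" unfolding GX_def by auto
  have GXs: "GX \<in> sets ?X" unfolding GXeq using measurable_sets[OF s G0s] Vs by auto
  have GXc: "space ?X - GX = (space ?X - G0 \<times> UNIV) \<union> V"
    unfolding GX_def using sets.sets_into_space[OF Vs] by auto
  let ?c = "real K * ((real K * cmod2_var + 3) / (real p * \<tau>\<^sup>2) + real M * exp (- \<gamma>))
        + real K * real p * cmod2_var / (real M * \<tau>\<^sup>2)"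
  have "measure (?X \<Otimes>\<^sub>M ?CB) (bad_event N p M P b \<gamma> \<tau> A w) \<le> measure ?X (space ?X - GX) + ?c"
  proof (rule measure_pair_le[OF prob_exper prob_space_codebooks bad_event_sets[OF p w] GXs])
    show "0 \<le> ?c" using cmod2_var_nonneg by (intro add_nonneg_nonneg mult_nonneg_nonneg divide_nonneg_nonneg) auto
    fix x assume x: "x \<in> GX"
    obtain sq z where xe: "x = (sq, z)" by (cases x)
    have xs: "x \<in> space ?X" "sq \<in> G" "sq \<in> gain_ok N" "x \<notin> V"
      using x unfolding GXeq G0_def xe by auto
    have gain: "\<forall>n<N. \<forall>r\<in>{1..K}. \<forall>t\<in>{1..K}. gain SNR (sq n) r t = complex_of_real (sqrt SNR) * cis (snd (sq n) (r, t))"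
      using xs(3) by (auto simp: gain_ok_def)
    define Y where "Y k C = comb N A sq (\<lambda>n. sig (enc A p P C) w sq k n + z (n, k))" for k C
    define F where "F k = {C \<in> space ?CB. decode_fail b p M \<gamma> k (w k) (Y k C) C}" for k
    define PB where "PB = {C \<in> space ?CB. power_bad M p \<tau> C}"
    have bs: "Pair x -` bad_event N p M P b \<gamma> \<tau> A w = (\<Union>k\<in>{1..K}. F k) \<union> PB"
      using xs(1) unfolding bad_event_def F_def PB_def Y_def xe by (auto simp: space_pair_measure)
    have F: "measure ?CB (F k) \<le> (real K * cmod2_var + 3) / (real p * \<tau>\<^sup>2) + real M * exp (- \<gamma>)" and Fs: "F k \<in> sets ?CB"
      if k: "k \<in> {1..K}" for k
    proof -
      obtain d where d: "\<And>t i. i < p \<Longrightarrow> t \<in> {1..K} - {k} \<Longrightarrow> cmod (d t i) \<le> sqrt (SNR * P) * \<delta>"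
        and rec: "\<And>C w z i. i < p \<Longrightarrow> comb N A sq (\<lambda>n. sig (enc A p P C) w sq k n + z n) i
       = of_real (2 * sqrt (SNR * P)) * C (k, w k, i) + (\<Sum>t\<in>{1..K} - {k}. d t i * C (t, w t, i)) + comb N A sq z i"
        by (rule comb_received[OF p P01(1) xs(2) gain k]) (rule that; assumption)
      have vb: "\<bar>\<Sum>i<p. (cmod (v x k i))\<^sup>2 - 2\<bar> \<le> \<tau> * real p"
        using xs k unfolding V_def by force
      have "2 * (real K)\<^sup>2 * (sqrt (SNR * P) * \<delta>)\<^sup>2 = P * (2 * (real K)\<^sup>2 * (SNR * \<delta>\<^sup>2))"
        using SNR P01 by (simp add: power_mult_distrib)
      also have "\<dots> \<le> 1 * (2 * (real K)\<^sup>2 * (SNR * \<delta>\<^sup>2))"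
        using SNR P01 by (intro mult_right_mono) auto
      finally have d2: "2 * (real K)\<^sup>2 * (sqrt (SNR * P) * \<delta>)\<^sup>2 \<le> \<tau>\<^sup>2" using \<delta> by simp
      define Y' where "Y' C i = of_real b * C (k, w k, i) + (\<Sum>t\<in>{1..K} - {k}. d t i * C (t, w t, i)) + v x k i" for C i
      have YY: "Y k C i = Y' C i" if "i < p" for C i
        using rec[OF that, of C w "\<lambda>n. z (n, k)"] unfolding Y_def Y'_def v_def xe b by simp
      have "decode_fail b p M \<gamma> k (w k) (Y k C) C \<longleftrightarrow> decode_fail b p M \<gamma> k (w k) (Y' C) C" for C
        unfolding decode_fail_def using YY by simp
      then have Fk: "F k = {C \<in> space ?CB. decode_fail b p M \<gamma> k (w k) (Y' C) C}" unfolding F_def by simp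
      show "measure ?CB (F k) \<le> (real K * cmod2_var + 3) / (real p * \<tau>\<^sup>2) + real M * exp (- \<gamma>)"
        unfolding Fk Y'_def \<gamma> by (rule codebook_bound[OF \<tau> b0 p0 k w vb d d2])
      have ce: "(\<lambda>C. C (t, m, i)) \<in> borel_measurable ?CB" if "t \<in> {1..K}" "m < M" "i < p" for t m i
        by (rule measurable_codebook_entry[OF that])
      have Ym: "(\<lambda>C. Y' C i) \<in> borel_measurable ?CB" if "i < p" for i
        unfolding Y'_def using that k by (intro borel_measurable_add borel_measurable_times borel_measurable_sum ce w) auto
      have E: "(\<lambda>C. \<Sum>i<p. iden b (Y' C i) (C (k, m, i))) \<in> borel_measurable ?CB" if "m < M" for m
        using that k by (intro borel_measurable_sum iden_measurable Ym ce) auto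
      have a: "{C \<in> space ?CB. (\<Sum>i<p. iden b (Y' C i) (C (k, w k, i))) < \<gamma>} \<in> sets ?CB"
        using borel_measurable_less[OF E[OF w[OF k]] borel_measurable_const] .
      have b: "{C \<in> space ?CB. m \<noteq> w k \<and> \<gamma> \<le> (\<Sum>i<p. iden b (Y' C i) (C (k, m, i)))} \<in> sets ?CB" if "m \<in> {..<M}" for m
        using borel_measurable_le[OF borel_measurable_const E, of m \<gamma>] that by (cases "m = w k") auto
      have c: "{C \<in> space ?CB. \<exists>m\<in>{..<M}. m \<noteq> w k \<and> \<gamma> \<le> (\<Sum>i<p. iden b (Y' C i) (C (k, m, i)))} \<in> sets ?CB"
        by (intro sets.sets_Collect_finite_Ex b) auto
      show "F k \<in> sets ?CB"
        using sets.sets_Collect_disj[OF c a] unfolding Fk decode_fail_def Bex_def lessThan_iff .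
    qed
    have "measure ?CB (Pair x -` bad_event N p M P b \<gamma> \<tau> A w) \<le> measure ?CB (\<Union>k\<in>{1..K}. F k) + measure ?CB PB"
      unfolding bs using Fs power_bad_sets by (intro measure_Un_le sets.finite_UN) (auto simp: PB_def)
    also have "\<dots> \<le> (\<Sum>k\<in>{1..K}. measure ?CB (F k)) + measure ?CB PB"
      using Fs by (intro add_mono CB.finite_measure_subadditive_finite order_refl) auto
    also have "\<dots> \<le> (\<Sum>k\<in>{1..K}. (real K * cmod2_var + 3) / (real p * \<tau>\<^sup>2) + real M * exp (- \<gamma>))
        + real K * real p * cmod2_var / (real M * \<tau>\<^sup>2)"
      unfolding PB_def by (intro add_mono sum_mono F power_bad_measure \<tau> M)
    finally show "measure ?CB (Pair x -` bad_event N p M P b \<gamma> \<tau> A w) \<le> ?c" by simp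
  qed
  then show ?thesis using mV mG0 unfolding GXc by linarith
qed

lemma random_code:
  assumes p: "is_pairing N p \<delta> A G" and p0: "0 < p" and N: "0 < N" and \<tau>: "0 < \<tau>" "\<tau> < 1" and M: "1 \<le> M"
    and \<delta>: "2 * (real K)\<^sup>2 * (SNR * \<delta>\<^sup>2) \<le> \<tau>\<^sup>2"
  defines "\<gamma> \<equiv> real p * (ln (1 + 2 * SNR * (1 - \<tau>)) - 6 * \<tau>)"
  assumes \<beta>: "measure (state_seq_meas K D N) (space (state_seq_meas K D N) - G) + real K * (cmod2_sum_var / (real p * \<tau>\<^sup>2))
      + (real K * ((real K * cmod2_var + 3) / (real p * \<tau>\<^sup>2) + real M * exp (- \<gamma>))
        + real K * real p * cmod2_var / (real M * \<tau>\<^sup>2)) < \<beta>" "\<beta> \<le> 1"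
  shows "\<exists>f g. is_code K SNR D N (\<lambda>_. M) f g \<and> err_prob K SNR D N (\<lambda>_. M) f g \<le> \<beta>"
proof -
  let ?X = "exper K D N" and ?CB = "codebooks K M p"
  interpret X: prob_space ?X by (rule prob_exper)
  \<comment> \<open>The energy of a codebook column may exceed its mean by the fraction \<tau>, and
    \<open>(1 - \<tau>) * (1 + \<tau>)\<close> is at most one.\<close>
  define P where "P = 1 - \<tau>"
  \<comment> \<open>The amplitude of two coherent copies; against noise variance 2 the
    signal-to-noise ratio is \<open>b\<^sup>2 / 2 = 2 * SNR * (1 - \<tau>)\<close>.\<close>
  define b where "b = 2 * sqrt (SNR * P)"
  have P01: "0 \<le> P" "P * (1 + \<tau>) \<le> 1" using \<tau> by (auto simp: P_def algebra_simps)
  have b2: "b\<^sup>2 / 2 = 2 * SNR * (1 - \<tau>)" using SNR \<tau> by (simp add: b_def P_def power_mult_distrib)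
  have \<gamma>: "\<gamma> = real p * (ln (1 + b\<^sup>2 / 2) - 6 * \<tau>)" unfolding \<gamma>_def b2 ..
  define W where "W = PiE {1..K} (\<lambda>_. {..<M})"
  have W: "finite W" "W \<noteq> {}" "real (card W) = real M ^ K"
    unfolding W_def using M by (auto simp: PiE_eq_empty_iff lessThan_empty_iff card_PiE intro!: finite_PiE)
  have wW: "w t < M" if "w \<in> W" "t \<in> {1..K}" for w t using that PiE_mem[of w] unfolding W_def by fastforce
  define S where "S = bad_event N p M P b \<gamma> \<tau> A"
  obtain C where C: "C \<in> space ?CB" and lt: "(\<Sum>w\<in>W. measure ?X ((\<lambda>x. (x, C)) -` S w)) < real (card W) * \<beta>"
  proof -
    have "\<exists>C\<in>space ?CB. (\<Sum>w\<in>W. measure ?X ((\<lambda>x. (x, C)) -` S w)) < real (card W) * \<beta>"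
    proof (rule exists_good_parameter[OF prob_exper prob_space_codebooks W(1,2) _ _ \<beta>(1)])
      fix w assume w: "w \<in> W"
      show "S w \<in> sets (?X \<Otimes>\<^sub>M ?CB)" unfolding S_def by (rule bad_event_sets[OF p wW[OF w]])
      show "measure (?X \<Otimes>\<^sub>M ?CB) (S w) \<le> measure (state_seq_meas K D N) (space (state_seq_meas K D N) - G)
        + real K * (cmod2_sum_var / (real p * \<tau>\<^sup>2))
        + (real K * ((real K * cmod2_var + 3) / (real p * \<tau>\<^sup>2) + real M * exp (- \<gamma>))
          + real K * real p * cmod2_var / (real M * \<tau>\<^sup>2))"
        unfolding S_def by (rule bad_event_measure[OF p p0 \<tau> M wW[OF w] \<delta> P_def b_def \<gamma>])
    qed
    then show ?thesis using that by blast
  qed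
  have Ssub: "(\<lambda>x. (x, C)) -` S w \<in> sets ?X" if "w \<in> W" for w
    unfolding S_def using bad_event_sets[OF p wW[OF that]] by (rule sets_Pair2)
  have pow: "\<not> power_bad M p \<tau> C"
  proof
    assume "power_bad M p \<tau> C"
    then have "(\<lambda>x. (x, C)) -` S w = space ?X" for w
      using C unfolding S_def bad_event_def by (auto simp: space_pair_measure)
    then have "(\<Sum>w\<in>W. measure ?X ((\<lambda>x. (x, C)) -` S w)) = real (card W)" by (simp add: X.prob_space)
    moreover have "real (card W) * \<beta> \<le> real (card W) * 1" using \<beta>(2) by (intro mult_left_mono) auto
    ultimately show False using lt by simp
  qed
  have powC: "(\<Sum>m<M. (cmod (C (t, m, i)))\<^sup>2) \<le> (1 + \<tau>) * real M" if "t \<in> {1..K}" "i < p" for t i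
  proof -
    have "\<bar>\<Sum>m<M. (cmod (C (t, m, i)))\<^sup>2 - 1\<bar> < \<tau> * real M"
      using pow that unfolding power_bad_def by (metis lessThan_iff not_less)
    then show ?thesis by (simp add: sum_subtractf abs_less_iff algebra_simps)
  qed
  let ?f = "enc A p P C" and ?g = "dec N p M b \<gamma> A C"
  have code: "is_code K SNR D N (\<lambda>_. M) ?f ?g"
    by (rule is_code_random[OF p P01 N M powC])
  have sub: "err_event N ?f ?g w \<subseteq> (\<lambda>x. (x, C)) -` S w" if w: "w \<in> W" for w
  proof
    fix x assume x: "x \<in> err_event N ?f ?g w"
    then obtain k where k: "k \<in> {1..K}"
      and e: "?g k (\<lambda>n\<in>{..<N}. sig ?f w (fst x) k n + snd x (n, k), fst x) \<noteq> w k" and xs: "x \<in> space ?X"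
      by (auto simp: err_event_def)
    have "decode_fail b p M \<gamma> k (w k) (comb N A (fst x) (\<lambda>n\<in>{..<N}. sig ?f w (fst x) k n + snd x (n, k))) C"
      using dec_correct[OF _ wW[OF w k]] e by blast
    then show "x \<in> (\<lambda>x. (x, C)) -` S w"
      using k xs C unfolding S_def bad_event_def comb_restrict by (auto simp: space_pair_measure)
  qed
  have "err_prob K SNR D N (\<lambda>_. M) ?f ?g = (1 / real (card W)) * (\<Sum>w\<in>W. measure ?X (err_event N ?f ?g w))"
    unfolding err_prob_eq W(3) W_def[symmetric] by simp
  also have "\<dots> \<le> (1 / real (card W)) * (\<Sum>w\<in>W. measure ?X ((\<lambda>x. (x, C)) -` S w))"
    using sub Ssub by (intro mult_left_mono sum_mono X.finite_measure_mono) auto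
  also have "\<dots> \<le> (1 / real (card W)) * (real (card W) * \<beta>)"
    using lt by (intro mult_left_mono) auto
  also have "\<dots> = \<beta>" using W(1,2) by simp
  finally show ?thesis using code by blast
qed

end

section \<open>The sum capacity\<close>

context equal_strength begin

text \<open>Parameters are fixed in the order \<tau>, \<open>L\<close>, \<open>N\<close>: \<tau>
  keeps the rate loss below the gap to the limit, \<open>L\<close> makes the residual interference
  small relative to \<tau>, and a large \<open>N\<close> then makes all error terms small.\<close>

lemma achievable_symmetric:
  assumes R: "0 < R" "R < 1 / 2 * log 2 (1 + 2 * SNR)"
  shows "achievable K SNR D (\<lambda>_. R)"
  unfolding achievable_def
proof (intro conjI ballI allI impI)
  show "0 \<le> R" using R by simp
  fix \<epsilon> :: real assume \<epsilon>: "0 < \<epsilon>"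
  have Rln: "R * ln 2 < 1 / 2 * ln (1 + 2 * SNR)"
    using R(2) by (simp add: log_def field_simps)
  \<comment> \<open>Symbols per channel use times the information density guaranteed per symbol. At
    \<tau> = 0 this is half of \<open>ln (1 + 2 * SNR)\<close>, which exceeds the rate.\<close>
  have "((\<lambda>\<tau>. (1 - \<tau>) / 2 * (ln (1 + 2 * SNR * (1 - \<tau>)) - 6 * \<tau>))
      \<longlongrightarrow> (1 - 0) / 2 * (ln (1 + 2 * SNR * (1 - 0)) - 6 * 0)) (at_right 0)"
    using SNR by (intro tendsto_intros) auto
  then have "eventually (\<lambda>\<tau>. R * ln 2 < (1 - \<tau>) / 2 * (ln (1 + 2 * SNR * (1 - \<tau>)) - 6 * \<tau>)) (at_right 0)"
    using Rln by (intro order_tendstoD(1)) auto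
  with eventually_at_right_real[of 0 1]
  have "eventually (\<lambda>\<tau>. \<tau> \<in> {0<..<1} \<and> R * ln 2 < (1 - \<tau>) / 2 * (ln (1 + 2 * SNR * (1 - \<tau>)) - 6 * \<tau>)) (at_right 0)"
    by (intro eventually_conj) auto
  from eventually_happens'[OF trivial_limit_at_right_real this]
  obtain \<tau> where \<tau>: "0 < \<tau>" "\<tau> < 1" and g0: "R * ln 2 < (1 - \<tau>) / 2 * (ln (1 + 2 * SNR * (1 - \<tau>)) - 6 * \<tau>)"
    by (elim exE conjE) (rule that; simp)
  define g where "g = ln (1 + 2 * SNR * (1 - \<tau>)) - 6 * \<tau>"
  define \<alpha> where "\<alpha> = (1 - \<tau>) / 2"
  have \<alpha>: "0 < \<alpha>" using \<tau> by (simp add: \<alpha>_def)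
  have "0 < R * ln 2" using R by simp
  also have ag: "R * ln 2 < \<alpha> * g" using g0 by (simp add: g_def \<alpha>_def)
  finally have g: "0 < g" using \<alpha> by (simp add: zero_less_mult_iff)
  have "((\<lambda>L. 2 * (real K)\<^sup>2 * (SNR * (2 * pi / real L)\<^sup>2)) \<longlongrightarrow> 0) at_top" by real_asymp
  then have "eventually (\<lambda>L. 2 * (real K)\<^sup>2 * (SNR * (2 * pi / real L)\<^sup>2) < \<tau>\<^sup>2) at_top"
    using \<tau> by (intro order_tendstoD(2)) auto
  with eventually_gt_at_top[of 0]
  have "eventually (\<lambda>L. 0 < L \<and> 2 * (real K)\<^sup>2 * (SNR * (2 * pi / real L)\<^sup>2) < \<tau>\<^sup>2) at_top"
    by (rule eventually_conj)
  from eventually_happens'[OF sequentially_bot this]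
  obtain L :: nat where L: "0 < L" "2 * (real K)\<^sup>2 * (SNR * (2 * pi / real L)\<^sup>2) \<le> \<tau>\<^sup>2"
    by (elim exE conjE) (rule that, assumption, erule less_imp_le)
  define Q where "Q = real (card (cells L))"
  \<comment> \<open>\<open>c1\<close> belongs to states without a pairing, \<open>c2\<close> to
    atypical noise and codewords, \<open>c3\<close> to wrong codewords and \<open>c4\<close> to the
    codebook power.\<close>
  define c1 where "c1 = 6 * Q ^ 3 / \<tau>\<^sup>2"
  define c2 where "c2 = (real K * cmod2_sum_var + real K * (real K * cmod2_var + 3)) / \<tau>\<^sup>2"
  \<comment> \<open>The 2 pays for rounding up the number of messages, the exponential for the at
    most \<open>Q + 1\<close> symbols lost in the pairing.\<close>
  define c3 where "c3 = 2 * real K * exp ((Q + 1) * g)"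
  define c4 where "c4 = real K * cmod2_var / \<tau>\<^sup>2"
  have c: "0 \<le> c2" "0 \<le> c4" "0 \<le> c3"
    using cmod2_var_nonneg cmod2_sum_var_nonneg by (auto simp: c2_def c4_def c3_def)
  define B where "B N = c1 / real N + c2 / (\<alpha> * real N - (Q + 1)) + c3 * exp (- (real N * (\<alpha> * g - R * ln 2)))
      + c4 * (real N * exp (- (real N * (R * ln 2))))" for N
  have "B \<longlonglongrightarrow> 0 + 0 + c3 * 0 + c4 * 0"
    unfolding B_def
  proof (intro tendsto_add tendsto_mult tendsto_const)
    show "(\<lambda>N. c1 / real N) \<longlonglongrightarrow> 0" by real_asymp
    show "(\<lambda>N. c2 / (\<alpha> * real N - (Q + 1))) \<longlonglongrightarrow> 0" using \<alpha> by real_asymp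
    have "(\<lambda>N. exp (- (real N * x))) \<longlonglongrightarrow> 0" "(\<lambda>N. real N * exp (- (real N * x))) \<longlonglongrightarrow> 0"
      if "0 < x" for x :: real
      using that by real_asymp+
    then show "(\<lambda>N. exp (- (real N * (\<alpha> * g - R * ln 2)))) \<longlonglongrightarrow> 0"
      "(\<lambda>N. real N * exp (- (real N * (R * ln 2)))) \<longlonglongrightarrow> 0"
      using ag R by simp_all
  qed
  then have "eventually (\<lambda>N. B N < min \<epsilon> 1) sequentially"
    using \<epsilon> by (intro order_tendstoD(2)) auto
  moreover have "filterlim (\<lambda>N. \<alpha> * real N - (Q + 1)) at_top sequentially" using \<alpha> by real_asymp
  then have "eventually (\<lambda>N. 0 < \<alpha> * real N - (Q + 1)) sequentially"
    unfolding filterlim_at_top_dense by (rule spec)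
  ultimately have "eventually (\<lambda>N. B N < min \<epsilon> 1 \<and> 0 < \<alpha> * real N - (Q + 1) \<and> 2 \<le> N) sequentially"
    by (intro eventually_conj eventually_ge_at_top)
  then obtain N0 where N0: "\<And>N. N0 \<le> N \<Longrightarrow> B N < min \<epsilon> 1 \<and> 0 < \<alpha> * real N - (Q + 1) \<and> 2 \<le> N"
    by (auto simp: eventually_sequentially)
  show "\<exists>N0. \<forall>N\<ge>N0. \<exists>M f g. is_code K SNR D N M f g \<and> (\<forall>k\<in>{1..K}. 2 powr (real N * R) \<le> real (M k)) \<and>
         err_prob K SNR D N M f g \<le> \<epsilon>"
  proof (intro exI[of _ N0] allI impI)
    fix N assume "N0 \<le> N"
    then have BN: "B N < min \<epsilon> 1" and pos: "0 < \<alpha> * real N - (Q + 1)" and N: "2 \<le> N" using N0 by auto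
    obtain p A G where p1: "\<alpha> * real N - (Q + 1) \<le> real p" and pN: "p \<le> N"
      and pair: "is_pairing N p (2 * pi / real L) A G"
      and PG: "measure (state_seq_meas K D N) (space (state_seq_meas K D N) - G) \<le> c1 / real N"
      using pairing_exists[OF L(1) \<tau> N] unfolding \<alpha>_def Q_def c1_def by blast
    have p0: "0 < real p" "0 < p" using pos p1 by auto
    define M where "M = nat \<lceil>2 powr (real N * R)\<rceil>"
    have pw: "1 \<le> 2 powr (real N * R)" using R by (intro ge_one_powr_ge_zero) auto
    have M1: "2 powr (real N * R) \<le> real M" unfolding M_def by linarith
    have M2: "real M \<le> 2 * 2 powr (real N * R)" unfolding M_def using pw by linarith
    have M: "1 \<le> M" using M1 pw by linarith
    have pe: "2 powr (real N * R) = exp (real N * (R * ln 2))" by (simp add: powr_def mult_ac)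
    define \<gamma> where "\<gamma> = real p * g"
    have t1: "real K * (cmod2_sum_var / (real p * \<tau>\<^sup>2)) + real K * ((real K * cmod2_var + 3) / (real p * \<tau>\<^sup>2))
        \<le> c2 / (\<alpha> * real N - (Q + 1))"
    proof -
      have "real K * (cmod2_sum_var / (real p * \<tau>\<^sup>2)) + real K * ((real K * cmod2_var + 3) / (real p * \<tau>\<^sup>2)) = c2 / real p"
        unfolding c2_def times_divide_eq_right add_divide_distrib[symmetric] divide_divide_eq_left
        by (simp only: mult.commute)
      also have "\<dots> \<le> c2 / (\<alpha> * real N - (Q + 1))"
        using c pos p1 p0 by (intro divide_left_mono) auto
      finally show ?thesis .
    qed
    have t2: "real K * (real M * exp (- \<gamma>)) \<le> c3 * exp (- (real N * (\<alpha> * g - R * ln 2)))"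
    proof -
      have "(\<alpha> * real N - (Q + 1)) * g \<le> \<gamma>" unfolding \<gamma>_def using p1 g by (intro mult_right_mono) auto
      then have "real K * (real M * exp (- \<gamma>)) \<le> real K * ((2 * 2 powr (real N * R)) * exp (- ((\<alpha> * real N - (Q + 1)) * g)))"
        using M2 by (intro mult_left_mono mult_mono) auto
      also have "\<dots> = 2 * real K * (exp (real N * (R * ln 2)) * exp (- ((\<alpha> * real N - (Q + 1)) * g)))"
        unfolding pe by simp
      also have "\<dots> = c3 * exp (- (real N * (\<alpha> * g - R * ln 2)))"
        unfolding c3_def mult.assoc exp_add[symmetric] by (simp add: algebra_simps)
      finally show ?thesis .
    qed
    have t3: "real K * real p * cmod2_var / (real M * \<tau>\<^sup>2) \<le> c4 * (real N * exp (- (real N * (R * ln 2))))"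
    proof -
      have "real K * real p * cmod2_var / (real M * \<tau>\<^sup>2) = c4 * (real p / real M)"
        unfolding c4_def by (simp add: mult_ac)
      also have "\<dots> \<le> c4 * (real N / 2 powr (real N * R))"
        using c pN M1 by (intro mult_left_mono frac_le) auto
      also have "\<dots> = c4 * (real N * exp (- (real N * (R * ln 2))))"
        unfolding pe by (simp add: exp_minus field_simps)
      finally show ?thesis .
    qed
    have "measure (state_seq_meas K D N) (space (state_seq_meas K D N) - G) + real K * (cmod2_sum_var / (real p * \<tau>\<^sup>2))
      + (real K * ((real K * cmod2_var + 3) / (real p * \<tau>\<^sup>2) + real M * exp (- \<gamma>))
        + real K * real p * cmod2_var / (real M * \<tau>\<^sup>2)) \<le> B N"
      using PG t1 t2 t3 unfolding B_def distrib_left by linarith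
    also note BN
    finally have "\<exists>f g. is_code K SNR D N (\<lambda>_. M) f g \<and> err_prob K SNR D N (\<lambda>_. M) f g \<le> min \<epsilon> 1"
      using N unfolding \<gamma>_def g_def by (intro random_code[OF pair p0(2) _ \<tau> M L(2)]) auto
    then show "\<exists>M f g. is_code K SNR D N M f g \<and> (\<forall>k\<in>{1..K}. 2 powr (real N * R) \<le> real (M k)) \<and>
         err_prob K SNR D N M f g \<le> \<epsilon>"
      using M1 by auto
  qed
qed

lemma sum_capacity_equal_strength: "sum_capacity K SNR D = ereal (real K / 2 * log 2 (1 + 2 * SNR))"
proof (rule antisym)
  show "sum_capacity K SNR D \<le> ereal (real K / 2 * log 2 (1 + 2 * SNR))"
    unfolding sum_capacity_def by (rule Sup_least) (use converse in auto)
  define C where "C = 1 / 2 * log 2 (1 + 2 * SNR)"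
  have C: "0 < C" using SNR by (simp add: C_def)
  \<comment> \<open>Only rates strictly below \<open>C\<close> are known to be achievable, so the
    supremum is approached by a sequence; the 2 keeps the rate positive at
    \<open>n = 0\<close>.\<close>
  define R where "R n = C * (1 - 1 / (real n + 2))" for n
  have le: "ereal (real K * R n) \<le> sum_capacity K SNR D" for n
  proof -
    have "0 < 1 - 1 / (real n + 2)" "1 - 1 / (real n + 2) < 1" by (auto simp: field_simps)
    then have "0 < R n" "R n < C" using C by (auto simp: R_def)
    then have "achievable K SNR D (\<lambda>_. R n)" unfolding C_def by (rule achievable_symmetric)
    moreover have "ereal (real K * R n) = ereal (\<Sum>k\<in>{1..K}. R n)" by simp
    ultimately show ?thesis unfolding sum_capacity_def by (intro Sup_upper) blast
  qed
  have "(\<lambda>n. real K * R n) \<longlonglongrightarrow> real K * (C * (1 - 0))"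
    unfolding R_def by (intro tendsto_intros) real_asymp
  then have "(\<lambda>n. ereal (real K * R n)) \<longlonglongrightarrow> ereal (real K * (C * (1 - 0)))" by (intro tendsto_ereal)
  then have "ereal (real K * (C * (1 - 0))) \<le> sum_capacity K SNR D"
    by (rule LIMSEQ_le_const2) (use le in blast)
  then show "ereal (real K / 2 * log 2 (1 + 2 * SNR)) \<le> sum_capacity K SNR D" by (simp add: C_def)
qed

end

theorem theorem3:
  fixes K :: nat and SNR :: real and B :: "(nat \<times> nat) set"
    and D :: "((nat \<times> nat) \<Rightarrow> real) measure"
  assumes "2 \<le> K" and "0 < SNR"
    and "minimal_bottleneck_state K SNR B"
    and "admissible_dist K SNR B D"
  shows "sum_capacity K SNR D = ereal (real K / 2 * log 2 (1 + 2 * SNR))"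
proof -
  \<comment> \<open>The point mass at equal strengths. The constant is restricted to
    \<open>offdiag K\<close> because points of a product space are extensional functions.\<close>
  define D0 where "D0 = return (PiM (offdiag K) (\<lambda>_. borel)) (\<lambda>p\<in>offdiag K. SNR)"
  have sp: "(\<lambda>p\<in>offdiag K. SNR) \<in> space (PiM (offdiag K) (\<lambda>_. borel))" by (auto simp: space_PiM)
  have fin: "finite (offdiag K)"
    by (rule finite_subset[of _ "{1..K} \<times> {1..K}"]) (auto simp: offdiag_def)
  have m: "(\<lambda>x. x p) \<in> borel_measurable (PiM (offdiag K) (\<lambda>_. borel :: real measure))" if "p \<in> offdiag K" for p
    by (rule measurable_component_singleton[OF that])
  have pred1: "Measurable.pred (PiM (offdiag K) (\<lambda>_. borel)) (\<lambda>x. \<forall>p\<in>offdiag K. x p = SNR)"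
    unfolding pred_def
  proof (rule sets.sets_Collect_finite_All[OF _ fin])
    fix p assume p: "p \<in> offdiag K"
    show "{x \<in> space (PiM (offdiag K) (\<lambda>_. borel)). x p = SNR} \<in> sets (PiM (offdiag K) (\<lambda>_. borel))"
      using measurable_sets[OF m[OF p], of "{SNR}"] by (simp add: vimage_def Int_def conj_commute)
  qed
  have pred2: "Measurable.pred (PiM (offdiag K) (\<lambda>_. borel)) (\<lambda>x. \<forall>p\<in>offdiag K. 0 \<le> (x p :: real))"
    unfolding pred_def
    by (rule sets.sets_Collect_finite_All[OF _ fin], rule borel_measurable_le[OF borel_measurable_const m])
  have adm: "admissible_dist K SNR (offdiag K) D0"
    unfolding admissible_dist_def
  proof (intro conjI)
    show "prob_space D0" unfolding D0_def by (rule prob_space_return[OF sp])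
    show "sets D0 = sets (PiM (offdiag K) (\<lambda>_. borel))" unfolding D0_def by (rule sets_return)
    show "AE x in D0. \<forall>p\<in>offdiag K. 0 \<le> x p"
      unfolding D0_def by (rule AE_return[OF sp pred2, THEN iffD2]) (use assms(2) in simp)
    show "AE x in D0. \<forall>p\<in>offdiag K. x p = SNR"
      unfolding D0_def by (rule AE_return[OF sp pred1, THEN iffD2]) simp
  qed
  have bs: "bottleneck_state K SNR B"
    using assms(3) unfolding minimal_bottleneck_state_def by (rule conjunct1)
  then have B: "B \<subseteq> offdiag K" unfolding bottleneck_state_def by (rule conjunct1)
  have "admissible_dist K SNR B D0"
  proof -
    have "AE x in D0. \<forall>p\<in>offdiag K. x p = SNR" using adm unfolding admissible_dist_def by (elim conjE)
    then have "AE x in D0. \<forall>p\<in>B. x p = SNR" by (rule eventually_mono) (use B in blast)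
    then show ?thesis using adm unfolding admissible_dist_def by simp
  qed
  then have "sum_capacity K SNR D = sum_capacity K SNR D0"
    by (rule bs[unfolded bottleneck_state_def, THEN conjunct2, THEN spec, THEN spec, THEN mp, OF conjI, OF assms(4)])
  moreover have "equal_strength K SNR D0" using assms(1,2) adm by unfold_locales
  ultimately show ?thesis using equal_strength.sum_capacity_equal_strength by simp
qed

end
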